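(* Let $(P,P_0)=(\operatorname{Mat}_2(\mathbb Q)\rtimes\operatorname{GL}_2^+(\mathbb Q),\operatorname{Mat}_2(\mathbb Z)\rtimes\operatorname{SL}_2(\mathbb Z))$, $\Gamma=\operatorname{SL}_2(\mathbb Z)$ and $S=\operatorname{Mat}_2^+(\mathbb Z)$. For each $w\in\operatorname{GL}_2(\hat{\mathbb Z})$, the representation $\pi_w=\pi_{\chi^w}$ associated to the character $\chi^w(a)=\chi(\operatorname{Tr}(aw))$ is a faithful representation of $C^*_r(P,P_0)$ on $\ell^2(\Gamma\backslash S)$. The restriction of this representation to the subalgebra $\mathcal H(\operatorname{Mat}_2^+(\mathbb Z),\operatorname{SL}_2(\mathbb Z))$ is the left regular representation rescaled by the determinant: $$\pi_w([s]_{P_0})=\det(s)\lambda([s]_\Gamma)\quad\text{for } s\in\operatorname{Mat}_2^+(\mathbb Z).$$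
   Context: $\hat{\mathbb Z}=\prod_p\mathbb Z_p$; $\mathbb A_f$ is the ring of finite adeles of $\mathbb Q$. $\operatorname{GL}_2^+(\mathbb Q)$ is the group of rational $2\times2$ matrices with positive determinant, acting on the additive group $\operatorname{Mat}_2(\mathbb Q)$ by $\alpha_g(m)=mg^{-1}$; semidirect products are formed with respect to this action, $(m,g)(n,h)=(m+\alpha_g(n),gh)$, and elements of $\operatorname{Mat}_2(\mathbb Q)$ and $\operatorname{GL}_2^+(\mathbb Q)$ are identified with their images in $P$. $\operatorname{Mat}_2^+(\mathbb Z)=\{s\in\operatorname{Mat}_2(\mathbb Z):\det s>0\}$. For a Hecke pair $(N,N_0)$, $\mathcal H(N,N_0)$ is the algebra of complex $N_0$-biinvariant functions on $N$ supported on finitely many double cosets, with $(f_1*f_2)(x)=\sum_{y\in N_0\backslash N}f_1(xy^{-1})f_2(y)$, $f^*(x)=\overline{f(x^{-1})}$; $[x]_{N_0}$ is the characteristic function of $N_0xN_0$. $C^*_r(N,N_0)$ is the closure of the image of $\mathcal H(N,N_0)$ under $(\lambda(f)\xi)(x)=\sum_{y\in N_0\backslash N}f(xy^{-1})\xi(y)$ on $\ell^2(N_0\backslash N)$. $\mathcal H(S,\Gamma)$ is the subalgebra of $\mathcal H(\operatorname{GL}_2^+(\mathbb Q),\Gamma)$ of functions supported on $S$; it embeds in $\mathcal H(P,P_0)$ by $[s]_\Gamma\mapsto[s]_{P_0}$. Its regular representation $\lambda$ on $\ell^2(\Gamma\backslash S)$ is $(\lambda(f)\xi)(s)=\sum_{t\in\Gamma\backslash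 S}f(st^{-1})\xi(t)$. Fix a continuous character $\chi$ of $\mathbb A_f$ such that $y\mapsto\chi(\,\cdot\,y)$ is an isomorphism of $\mathbb A_f$ onto its dual group carrying $\hat{\mathbb Z}$ onto $\hat{\mathbb Z}^\perp$. For $w\in\operatorname{GL}_2(\hat{\mathbb Z})$ the character $\chi^w$ (restricted to $\operatorname{Mat}_2(\mathbb Q)$) is trivial on $\operatorname{Mat}_2(\mathbb Z)$, and $S=\{g\in\operatorname{GL}_2^+(\mathbb Q):(\chi^w\circ\alpha_{g^{-1}})|_{\operatorname{Mat}_2(\mathbb Z)}\equiv1\}$. The representation $\pi_w=\pi_{\chi^w}$ is given on $f\in\mathcal H(P,P_0)$ by $$(\pi_w(f)\xi)(t)=\sum_{s\in\Gamma\backslash S}\ \sum_{m\in\operatorname{Mat}_2(\mathbb Q)/\operatorname{Mat}_2(\mathbb Z)}\det(ts^{-1})\,\overline{\chi(\operatorname{Tr}(msw))}\,f\big(ts^{-1}\cdot(-m)\big)\,\xi(s),\quad \xi\in\ell^2(\Gamma\backslash S),\ t\in S,$$ where $ts^{-1}\cdot(-m)$ is the product in $P$ of $ts^{-1}\in\operatorname{GL}_2^+(\mathbb Q)$ and $-m\in\operatorname{Mat}_2(\mathbb Q)$. *)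

theory Defs
  imports "HOL-Analysis.Analysis" "HOL-Algebra.Coset" "HOL-Computational_Algebra.Primes"
begin

section \<open>The finite adeles of the rationals\<close>

definition padic_abs :: "nat \<Rightarrow> rat \<Rightarrow> real" where
  "padic_abs p q = (if q = 0 then 0 else
     real p powi (int (multiplicity (int p) (snd (quotient_of q)))
                - int (multiplicity (int p) (fst (quotient_of q)))))"

lemma padic_abs_fraction:
  assumes p: "prime p" and a: "a \<noteq> 0" and b: "b \<noteq> 0"
  shows "padic_abs p (of_int a / of_int b) =
    real p powi (int (multiplicity (int p) b) - int (multiplicity (int p) a))"
proof -
  define q :: rat where "q = of_int a / of_int b"
  obtain c d where cd: "quotient_of q = (c, d)" by force
  have d: "d > 0" using quotient_of_denom_pos[OF cd] .
  have q: "q = of_int c / of_int d" using quotient_of_div[OF cd] .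
  have q0: "q \<noteq> 0" using a b by (simp add: q_def)
  hence c: "c \<noteq> 0" using q by auto
  have "(of_int (a * d) :: rat) = of_int (c * b)"
    using q b d unfolding q_def by (simp add: field_simps)
  hence e: "a * d = c * b" by (simp only: of_int_eq_iff)
  have pp: "prime_elem (int p)" using p by simp
  have "multiplicity (int p) (a * d) = multiplicity (int p) (c * b)" using e by simp
  hence "multiplicity (int p) a + multiplicity (int p) d
       = multiplicity (int p) c + multiplicity (int p) b"
    using pp a b c d by (simp add: prime_elem_multiplicity_mult_distrib)
  hence "int (multiplicity (int p) d) - int (multiplicity (int p) c)
       = int (multiplicity (int p) b) - int (multiplicity (int p) a)" by linarith
  moreover have "padic_abs p q =
      real p powi (int (multiplicity (int p) d) - int (multiplicity (int p) c))"
    using q0 cd by (simp add: padic_abs_def)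
  ultimately show ?thesis by (simp add: q_def)
qed

lemma padic_abs_0 [simp]: "padic_abs p 0 = 0"
  by (simp add: padic_abs_def)

lemma padic_abs_nonneg [simp]: "padic_abs p x \<ge> 0"
  by (simp add: padic_abs_def)

lemma rat_fraction:
  fixes x :: rat
  obtains a b where "x = of_int a / of_int b" "b \<noteq> (0::int)"
proof -
  obtain c d where cd: "quotient_of x = (c, d)" by force
  thus ?thesis using that[of c d] quotient_of_div[OF cd] quotient_of_denom_pos[OF cd] by simp
qed

lemma padic_abs_le_1_of_int:
  assumes "prime p" shows "padic_abs p (of_int a) \<le> 1"
proof (cases "a = 0")
  case False
  have p1: "real p \<ge> 1" using assms prime_ge_1_nat[of p] by simp
  have "padic_abs p (of_int a / of_int 1) = real p powi (- int (multiplicity (int p) a))"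
    using padic_abs_fraction[OF assms False, of 1] by simp
  also have "\<dots> \<le> 1" using p1
    by (simp add: power_int_minus inverse_le_1_iff)
  finally show ?thesis by simp
qed auto

lemma padic_abs_mult:
  assumes p: "prime p" shows "padic_abs p (x * y) = padic_abs p x * padic_abs p y"
proof (cases "x = 0 \<or> y = 0")
  case False
  obtain a b where x: "x = of_int a / of_int b" "b \<noteq> (0::int)" by (rule rat_fraction)
  obtain c d where y: "y = of_int c / of_int d" "d \<noteq> (0::int)" by (rule rat_fraction)
  have ac: "a \<noteq> 0" "c \<noteq> 0" using False x y by auto
  have xy: "x * y = of_int (a * c) / of_int (b * d)" using x y by simp
  have pp: "prime_elem (int p)" using p by simp
  have p0: "real p \<noteq> 0" using p by (auto simp: prime_gt_0_nat)
  have "padic_abs p (x * y) =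
      real p powi (int (multiplicity (int p) (b * d)) - int (multiplicity (int p) (a * c)))"
    unfolding xy by (rule padic_abs_fraction) (use p ac x y in auto)
  also have "\<dots> = real p powi ((int (multiplicity (int p) b) - int (multiplicity (int p) a))
       + (int (multiplicity (int p) d) - int (multiplicity (int p) c)))"
    using pp ac x y by (simp add: prime_elem_multiplicity_mult_distrib algebra_simps)
  also have "\<dots> = padic_abs p x * padic_abs p y"
    using padic_abs_fraction[OF p ac(1) x(2)] padic_abs_fraction[OF p ac(2) y(2)] p0
    by (simp add: power_int_add x(1) y(1))
  finally show ?thesis .
qed auto

lemma padic_abs_minus:
  assumes p: "prime p" shows "padic_abs p (- x) = padic_abs p x"
proof (cases "x = 0")
  case False
  obtain a b where x: "x = of_int a / of_int b" "b \<noteq> (0::int)" by (rule rat_fraction)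
  have a: "a \<noteq> 0" using False x by auto
  have "- x = of_int (- a) / of_int b" using x by simp
  moreover have "multiplicity (int p) (- a) = multiplicity (int p) a"
    using multiplicity_times_unit_right[of "-1" "int p" a] by simp
  ultimately show ?thesis
    using padic_abs_fraction[OF p _ x(2), of "- a"] padic_abs_fraction[OF p a x(2)] a x(1) by simp
qed simp

lemma padic_abs_add:
  assumes p: "prime p"
  shows "padic_abs p (x + y) \<le> max (padic_abs p x) (padic_abs p y)"
proof (cases "x = 0 \<or> y = 0 \<or> x + y = 0")
  case False
  obtain a0 b where x: "x = of_int a0 / of_int b" "b \<noteq> (0::int)" by (rule rat_fraction)
  obtain c0 d where y: "y = of_int c0 / of_int d" "d \<noteq> (0::int)" by (rule rat_fraction)
  define a c e where "a = a0 * d" and "c = c0 * b" and "e = b * d"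
  have e: "e \<noteq> 0" using x y by (simp add: e_def)
  have xa: "x = of_int a / of_int e" and yc: "y = of_int c / of_int e"
    using x y by (auto simp: a_def c_def e_def field_simps)
  have xyc: "x + y = of_int (a + c) / of_int e"
    by (simp add: xa yc add_divide_distrib)
  have nz: "a \<noteq> 0" "c \<noteq> 0" "a + c \<noteq> 0" using False xa yc xyc by auto
  have p1: "real p \<ge> 1" using p prime_ge_1_nat[of p] by simp
  let ?m = "multiplicity (int p)"
  have "int p ^ min (?m a) (?m c) dvd a + c"
    by (intro dvd_add) (auto intro: multiplicity_dvd' )
  hence "min (?m a) (?m c) \<le> ?m (a + c)"
    by (intro multiplicity_geI) (use nz p in \<open>auto dest: prime_gt_1_nat\<close>)
  hence "int (?m e) - int (?m (a + c)) \<le> max (int (?m e) - int (?m a)) (int (?m e) - int (?m c))"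
    by linarith
  hence "real p powi (int (?m e) - int (?m (a + c)))
      \<le> real p powi (max (int (?m e) - int (?m a)) (int (?m e) - int (?m c)))"
    using p1 by (intro power_int_increasing) auto
  also have "\<dots> \<le> max (real p powi (int (?m e) - int (?m a))) (real p powi (int (?m e) - int (?m c)))"
    by (simp add: max_def)
  finally show ?thesis
    using padic_abs_fraction[OF p nz(3) e] padic_abs_fraction[OF p nz(1) e]
      padic_abs_fraction[OF p nz(2) e] unfolding xyc
    by (simp add: xa yc)
qed (auto simp: le_max_iff_disj)

lemma padic_abs_add_le:
  assumes "prime p" shows "padic_abs p (x + y) \<le> padic_abs p x + padic_abs p y"
  using padic_abs_add[OF assms, of x y] padic_abs_nonneg[of p x] padic_abs_nonneg[of p y]
  by linarith

lemma padic_abs_diff_commute: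
  assumes "prime p" shows "padic_abs p (x - y) = padic_abs p (y - x)"
  using padic_abs_minus[OF assms, of "x - y"] by simp

lemma padic_abs_reverse_triangle:
  assumes "prime p" shows "\<bar>padic_abs p x - padic_abs p y\<bar> \<le> padic_abs p (x - y)"
  using padic_abs_add_le[OF assms, of "x - y" y] padic_abs_add_le[OF assms, of "y - x" x]
    padic_abs_diff_commute[OF assms, of x y] by simp

definition padic_cauchy :: "nat \<Rightarrow> (nat \<Rightarrow> rat) \<Rightarrow> bool" where
  "padic_cauchy p X \<longleftrightarrow> (\<forall>e>0. \<exists>M. \<forall>m\<ge>M. \<forall>n\<ge>M. padic_abs p (X m - X n) < e)"

definition padic_null :: "nat \<Rightarrow> (nat \<Rightarrow> rat) \<Rightarrow> bool" where
  "padic_null p X \<longleftrightarrow> (\<lambda>n. padic_abs p (X n)) \<longlonglongrightarrow> 0"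

text \<open>
  \<open>\<rat>\<^sub>p\<close> is the completion of \<open>\<rat>\<close>, that is, \<open>p\<close>-adic Cauchy sequences modulo null sequences, and
  a Cauchy sequence represents an element of \<open>\<int>\<^sub>p\<close> iff its terms eventually have absolute value at
  most 1. Since types cannot depend on \<open>p\<close>, the restricted product over all primes is formed in one
  quotient: \<open>x p\<close> is a Cauchy sequence representing the \<open>p\<close>-component, and the values of \<open>x\<close>
  at non-primes are ignored.
\<close>

definition padic_integral :: "nat \<Rightarrow> (nat \<Rightarrow> rat) \<Rightarrow> bool" where
  "padic_integral p X \<longleftrightarrow> (\<forall>\<^sub>F n in sequentially. padic_abs p (X n) \<le> 1)"

definition adele_seq :: "(nat \<Rightarrow> nat \<Rightarrow> rat) \<Rightarrow> bool" where
  "adele_seq x \<longleftrightarrow> (\<forall>p. prime p \<longrightarrow> padic_cauchy p (x p)) \<and>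
     finite {p. prime p \<and> \<not> padic_integral p (x p)}"

definition adele_rel :: "(nat \<Rightarrow> nat \<Rightarrow> rat) \<Rightarrow> (nat \<Rightarrow> nat \<Rightarrow> rat) \<Rightarrow> bool" where
  "adele_rel x y \<longleftrightarrow> adele_seq x \<and> adele_seq y \<and>
     (\<forall>p. prime p \<longrightarrow> padic_null p (\<lambda>n. x p n - y p n))"

lemma padic_nullI:
  assumes "\<forall>\<^sub>F n in sequentially. padic_abs p (X n) \<le> f n" "f \<longlonglongrightarrow> 0"
  shows "padic_null p X"
  unfolding padic_null_def
  by (rule Lim_null_comparison[OF _ assms(2)]) (use assms(1) in simp)

lemma padic_null_add:
  assumes "prime p" "padic_null p X" "padic_null p Y"
  shows "padic_null p (\<lambda>n. X n + Y n)"
proof (rule padic_nullI)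
  show "\<forall>\<^sub>F n in sequentially. padic_abs p (X n + Y n) \<le> padic_abs p (X n) + padic_abs p (Y n)"
    by (simp add: padic_abs_add_le[OF assms(1)])
  show "(\<lambda>n. padic_abs p (X n) + padic_abs p (Y n)) \<longlonglongrightarrow> 0"
    using tendsto_add[OF assms(2,3)[unfolded padic_null_def]] by simp
qed

lemma padic_null_minus:
  assumes "prime p" "padic_null p X" shows "padic_null p (\<lambda>n. - X n)"
  using assms by (simp add: padic_null_def padic_abs_minus)

lemma padic_null_zero [simp]: "padic_null p (\<lambda>n. 0)"
  by (simp add: padic_null_def)

lemma padic_cauchy_bounded:
  assumes p: "prime p" and X: "padic_cauchy p X"
  obtains B where "B > 0" "\<forall>\<^sub>F n in sequentially. padic_abs p (X n) \<le> B"
proof -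
  obtain M where M: "\<And>m n. m \<ge> M \<Longrightarrow> n \<ge> M \<Longrightarrow> padic_abs p (X m - X n) < 1"
    using X unfolding padic_cauchy_def by (metis zero_less_one)
  have "padic_abs p (X n) \<le> 1 + padic_abs p (X M)" if "n \<ge> M" for n
    using padic_abs_add_le[OF p, of "X n - X M" "X M"] M[OF that, of M] by simp
  hence "\<forall>\<^sub>F n in sequentially. padic_abs p (X n) \<le> 1 + padic_abs p (X M)"
    unfolding eventually_sequentially by blast
  thus ?thesis using that[of "1 + padic_abs p (X M)"]
    using padic_abs_nonneg[of p "X M"] by linarith
qed

lemma padic_null_mult:
  assumes p: "prime p" and "padic_cauchy p X" "padic_null p Y"
  shows "padic_null p (\<lambda>n. X n * Y n)"
proof -
  obtain B where B: "B > 0" "\<forall>\<^sub>F n in sequentially. padic_abs p (X n) \<le> B"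
    using padic_cauchy_bounded assms by blast
  show ?thesis
  proof (rule padic_nullI)
    show "\<forall>\<^sub>F n in sequentially. padic_abs p (X n * Y n) \<le> B * padic_abs p (Y n)"
      using B(2) by eventually_elim (auto simp: padic_abs_mult[OF p] intro: mult_right_mono)
    show "(\<lambda>n. B * padic_abs p (Y n)) \<longlonglongrightarrow> 0"
      using assms(3) tendsto_mult_right_zero unfolding padic_null_def by blast
  qed
qed

lemma padic_cauchy_add:
  assumes p: "prime p" and "padic_cauchy p X" "padic_cauchy p Y"
  shows "padic_cauchy p (\<lambda>n. X n + Y n)"
  unfolding padic_cauchy_def
proof (intro allI impI)
  fix e :: real assume e: "e > 0"
  obtain M where M: "\<And>m n. m \<ge> M \<Longrightarrow> n \<ge> M \<Longrightarrow> padic_abs p (X m - X n) < e"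
    using assms(2) e unfolding padic_cauchy_def by meson
  obtain N where N: "\<And>m n. m \<ge> N \<Longrightarrow> n \<ge> N \<Longrightarrow> padic_abs p (Y m - Y n) < e"
    using assms(3) e unfolding padic_cauchy_def by meson
  show "\<exists>M. \<forall>m\<ge>M. \<forall>n\<ge>M. padic_abs p (X m + Y m - (X n + Y n)) < e"
  proof (intro exI allI impI)
    fix m n assume "max M N \<le> m" "max M N \<le> n"
    hence "padic_abs p (X m - X n) < e" "padic_abs p (Y m - Y n) < e" using M N by auto
    moreover have "X m + Y m - (X n + Y n) = (X m - X n) + (Y m - Y n)" by simp
    ultimately show "padic_abs p (X m + Y m - (X n + Y n)) < e"
      using padic_abs_add[OF p, of "X m - X n" "Y m - Y n"] by (smt (verit))
  qed
qed

lemma padic_cauchy_minus: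
  assumes "prime p" "padic_cauchy p X" shows "padic_cauchy p (\<lambda>n. - X n)"
  using assms(2) padic_abs_diff_commute[OF assms(1)] by (simp add: padic_cauchy_def)

lemma padic_cauchy_const [simp]: "padic_cauchy p (\<lambda>n. c)"
  by (simp add: padic_cauchy_def)

lemma padic_cauchy_mult:
  assumes p: "prime p" and X: "padic_cauchy p X" and Y: "padic_cauchy p Y"
  shows "padic_cauchy p (\<lambda>n. X n * Y n)"
  unfolding padic_cauchy_def
proof (intro allI impI)
  fix e :: real assume e: "e > 0"
  obtain B where B: "B > 0" "\<forall>\<^sub>F n in sequentially. padic_abs p (X n) \<le> B"
    using padic_cauchy_bounded p X by blast
  obtain C where C: "C > 0" "\<forall>\<^sub>F n in sequentially. padic_abs p (Y n) \<le> C"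
    using padic_cauchy_bounded p Y by blast
  obtain B' C' where BC': "\<And>n. n \<ge> B' \<Longrightarrow> padic_abs p (X n) \<le> B"
      "\<And>n. n \<ge> C' \<Longrightarrow> padic_abs p (Y n) \<le> C"
    using B(2) C(2) unfolding eventually_sequentially by blast
  obtain M where M: "\<And>m n. m \<ge> M \<Longrightarrow> n \<ge> M \<Longrightarrow> padic_abs p (X m - X n) < e / C"
    using X e C(1) unfolding padic_cauchy_def by (meson divide_pos_pos)
  obtain N where N: "\<And>m n. m \<ge> N \<Longrightarrow> n \<ge> N \<Longrightarrow> padic_abs p (Y m - Y n) < e / B"
    using Y e B(1) unfolding padic_cauchy_def by (meson divide_pos_pos)
  show "\<exists>M. \<forall>m\<ge>M. \<forall>n\<ge>M. padic_abs p (X m * Y m - X n * Y n) < e"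
  proof (intro exI allI impI)
    fix m n assume mn: "Max {B', C', M, N} \<le> m" "Max {B', C', M, N} \<le> n"
    have "padic_abs p (X m * (Y m - Y n)) \<le> B * padic_abs p (Y m - Y n)"
      using BC'(1)[of m] mn by (simp add: padic_abs_mult[OF p] mult_right_mono)
    also have "\<dots> < B * (e / B)" by (rule mult_strict_left_mono) (use N mn B in auto)
    finally have 1: "padic_abs p (X m * (Y m - Y n)) < e" using B by simp
    have "padic_abs p ((X m - X n) * Y n) \<le> padic_abs p (X m - X n) * C"
      using BC'(2)[of n] mn by (simp add: padic_abs_mult[OF p] mult_left_mono)
    also have "\<dots> < e / C * C" by (rule mult_strict_right_mono) (use M mn C in auto)
    finally have 2: "padic_abs p ((X m - X n) * Y n) < e" using C by simp
    have "X m * Y m - X n * Y n = X m * (Y m - Y n) + (X m - X n) * Y n"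
      by (simp add: algebra_simps)
    thus "padic_abs p (X m * Y m - X n * Y n) < e"
      using padic_abs_add[OF p, of "X m * (Y m - Y n)" "(X m - X n) * Y n"] 1 2
      by (smt (verit))
  qed
qed

lemma padic_integral_add:
  assumes p: "prime p" and X: "padic_integral p X" and Y: "padic_integral p Y"
  shows "padic_integral p (\<lambda>n. X n + Y n)"
  unfolding padic_integral_def
  using X[unfolded padic_integral_def] Y[unfolded padic_integral_def]
proof eventually_elim
  case (elim n)
  thus ?case using padic_abs_add[OF p, of "X n" "Y n"] by linarith
qed

lemma padic_integral_mult:
  assumes p: "prime p" and X: "padic_integral p X" and Y: "padic_integral p Y"
  shows "padic_integral p (\<lambda>n. X n * Y n)"
  unfolding padic_integral_def
  using X[unfolded padic_integral_def] Y[unfolded padic_integral_def]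
proof eventually_elim
  case (elim n)
  thus ?case by (simp add: padic_abs_mult[OF p] mult_le_one)
qed

lemma adele_seq_add:
  assumes "adele_seq x" "adele_seq y" shows "adele_seq (\<lambda>p n. x p n + y p n)"
  unfolding adele_seq_def
proof
  show "\<forall>p. prime p \<longrightarrow> padic_cauchy p (\<lambda>n. x p n + y p n)"
    using assms by (auto simp: adele_seq_def intro: padic_cauchy_add)
  have "{p. prime p \<and> \<not> padic_integral p (\<lambda>n. x p n + y p n)} \<subseteq>
      {p. prime p \<and> \<not> padic_integral p (x p)} \<union> {p. prime p \<and> \<not> padic_integral p (y p)}"
    using padic_integral_add by auto
  thus "finite {p. prime p \<and> \<not> padic_integral p (\<lambda>n. x p n + y p n)}"
    by (rule finite_subset) (use assms in \<open>auto simp: adele_seq_def\<close>)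
qed

lemma adele_seq_mult:
  assumes "adele_seq x" "adele_seq y" shows "adele_seq (\<lambda>p n. x p n * y p n)"
  unfolding adele_seq_def
proof
  show "\<forall>p. prime p \<longrightarrow> padic_cauchy p (\<lambda>n. x p n * y p n)"
    using assms by (auto simp: adele_seq_def intro: padic_cauchy_mult)
  have "{p. prime p \<and> \<not> padic_integral p (\<lambda>n. x p n * y p n)} \<subseteq>
      {p. prime p \<and> \<not> padic_integral p (x p)} \<union> {p. prime p \<and> \<not> padic_integral p (y p)}"
    using padic_integral_mult by auto
  thus "finite {p. prime p \<and> \<not> padic_integral p (\<lambda>n. x p n * y p n)}"
    by (rule finite_subset) (use assms in \<open>auto simp: adele_seq_def\<close>)
qed

lemma adele_seq_minus:
  assumes "adele_seq x" shows "adele_seq (\<lambda>p n. - x p n)"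
proof -
  have "{p. prime p \<and> \<not> padic_integral p (\<lambda>n. - x p n)} =
      {p. prime p \<and> \<not> padic_integral p (x p)}"
    by (auto simp: padic_integral_def padic_abs_minus)
  thus ?thesis using assms by (auto simp: adele_seq_def intro: padic_cauchy_minus)
qed

lemma adele_seq_const: "adele_seq (\<lambda>p n. q)"
proof -
  obtain a b where q: "q = of_int a / of_int b" "b \<noteq> (0::int)" by (rule rat_fraction)
  have "padic_integral p (\<lambda>n. q)" if p: "prime p" and b: "\<not> int p dvd b" for p
  proof -
    have "padic_abs p (1 / of_int b) = 1"
      using padic_abs_fraction[OF p, of 1 b] q(2) b by (simp add: not_dvd_imp_multiplicity_0)
    moreover have "q = of_int a * (1 / of_int b)" using q by simp
    ultimately have "padic_abs p q \<le> 1"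
      using padic_abs_mult[OF p, of "of_int a" "1 / of_int b"] padic_abs_le_1_of_int[OF p, of a]
      by simp
    thus ?thesis by (simp add: padic_integral_def)
  qed
  hence "{p. prime p \<and> \<not> padic_integral p (\<lambda>n. q)} \<subseteq> nat ` {c. c dvd b}"
    by (metis (mono_tags, lifting) image_eqI mem_Collect_eq nat_int subsetI)
  moreover have "finite (nat ` {c. c dvd b})" using q(2) by (intro finite_imageI) auto
  ultimately show ?thesis unfolding adele_seq_def by (auto intro: finite_subset)
qed

quotient_type finite_adele = "nat \<Rightarrow> nat \<Rightarrow> rat" / partial: adele_rel
proof (rule part_equivpI)
  show "\<exists>x. adele_rel x x"
    by (rule exI[of _ "\<lambda>p n. 0"]) (auto simp: adele_rel_def adele_seq_const)
  show "symp adele_rel"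
  proof (rule sympI)
    fix x y assume xy: "adele_rel x y"
    have "padic_null p (\<lambda>n. y p n - x p n)" if "prime p" for p
      using padic_null_minus[OF that, of "\<lambda>n. x p n - y p n"] xy that
      by (simp add: adele_rel_def)
    thus "adele_rel y x" using xy by (auto simp: adele_rel_def)
  qed
  show "transp adele_rel"
  proof (rule transpI)
    fix x y z assume xyz: "adele_rel x y" "adele_rel y z"
    have "padic_null p (\<lambda>n. x p n - z p n)" if "prime p" for p
      using padic_null_add[OF that, of "\<lambda>n. x p n - y p n" "\<lambda>n. y p n - z p n"] xyz that
      by (simp add: adele_rel_def)
    thus "adele_rel x z" using xyz by (auto simp: adele_rel_def)
  qed
qed

instantiation finite_adele :: comm_ring_1
begin

lift_definition zero_finite_adele :: finite_adele is "\<lambda>p n. 0"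
  by (simp add: adele_rel_def adele_seq_const)

lift_definition one_finite_adele :: finite_adele is "\<lambda>p n. 1"
  by (simp add: adele_rel_def adele_seq_const)

lift_definition plus_finite_adele :: "finite_adele \<Rightarrow> finite_adele \<Rightarrow> finite_adele"
  is "\<lambda>x y p n. x p n + y p n"
proof -
  fix x x' y y' assume xy: "adele_rel x x'" "adele_rel y y'"
  have "padic_null p (\<lambda>n. x p n + y p n - (x' p n + y' p n))" if "prime p" for p
    using padic_null_add[OF that, of "\<lambda>n. x p n - x' p n" "\<lambda>n. y p n - y' p n"] xy that
    by (simp add: adele_rel_def algebra_simps)
  thus "adele_rel (\<lambda>p n. x p n + y p n) (\<lambda>p n. x' p n + y' p n)"
    using xy by (auto simp: adele_rel_def intro: adele_seq_add)
qed

lift_definition uminus_finite_adele :: "finite_adele \<Rightarrow> finite_adele" is "\<lambda>x p n. - x p n"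
proof -
  fix x x' assume x: "adele_rel x x'"
  have "padic_null p (\<lambda>n. - x p n - - x' p n)" if "prime p" for p
    using padic_null_minus[OF that, of "\<lambda>n. x p n - x' p n"] x that
    by (simp add: adele_rel_def algebra_simps)
  thus "adele_rel (\<lambda>p n. - x p n) (\<lambda>p n. - x' p n)"
    using x by (auto simp: adele_rel_def intro: adele_seq_minus)
qed

definition minus_finite_adele :: "finite_adele \<Rightarrow> finite_adele \<Rightarrow> finite_adele" where
  "minus_finite_adele x y = x + - y"

lift_definition times_finite_adele :: "finite_adele \<Rightarrow> finite_adele \<Rightarrow> finite_adele"
  is "\<lambda>x y p n. x p n * y p n"
proof -
  fix x x' y y' assume xy: "adele_rel x x'" "adele_rel y y'"
  have "padic_null p (\<lambda>n. x p n * y p n - x' p n * y' p n)" if p: "prime p" for p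
  proof -
    have 1: "padic_null p (\<lambda>n. x p n * (y p n - y' p n))"
      by (rule padic_null_mult) (use xy p in \<open>auto simp: adele_rel_def adele_seq_def\<close>)
    have 2: "padic_null p (\<lambda>n. y' p n * (x p n - x' p n))"
      by (rule padic_null_mult) (use xy p in \<open>auto simp: adele_rel_def adele_seq_def\<close>)
    show ?thesis using padic_null_add[OF p 1 2] by (simp add: algebra_simps)
  qed
  thus "adele_rel (\<lambda>p n. x p n * y p n) (\<lambda>p n. x' p n * y' p n)"
    using xy by (auto simp: adele_rel_def intro: adele_seq_mult)
qed

instance
proof
  fix a b c :: finite_adele
  note eqs = adele_rel_def adele_seq_add adele_seq_mult adele_seq_minus adele_seq_const algebra_simps
  show "a + b + c = a + (b + c)" by transfer (simp add: eqs)
  show "a + b = b + a" by transfer (simp add: eqs)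
  show "0 + a = a" by transfer (simp add: eqs)
  show "- a + a = 0" by transfer (simp add: eqs)
  show "a - b = a + - b" by (simp add: minus_finite_adele_def)
  show "a * b * c = a * (b * c)" by transfer (simp add: eqs)
  show "a * b = b * a" by transfer (simp add: eqs)
  show "1 * a = a" by transfer (simp add: eqs)
  show "(a + b) * c = a * c + b * c" by transfer (simp add: eqs)
  show "(0::finite_adele) \<noteq> 1"
  proof (transfer, rule notI)
    assume "adele_rel (\<lambda>p n. 0) (\<lambda>p n. 1)"
    hence "padic_null 2 (\<lambda>n. - 1)" by (simp add: adele_rel_def)
    hence "padic_abs 2 (- 1) = 0" by (simp add: padic_null_def LIMSEQ_const_iff)
    thus False by (simp add: padic_abs_def)
  qed
qed

end

text \<open>The absolute value of the \<open>p\<close>-component, for \<open>p\<close> prime.\<close>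

lift_definition adele_abs :: "nat \<Rightarrow> finite_adele \<Rightarrow> real"
  is "\<lambda>p x. if prime p then lim (\<lambda>n. padic_abs p (x p n)) else 0"
proof -
  fix p x y assume xy: "adele_rel x y"
  have "lim (\<lambda>n. padic_abs p (x p n)) = lim (\<lambda>n. padic_abs p (y p n))" if p: "prime p"
  proof -
    have "(\<lambda>n. padic_abs p (x p n) - padic_abs p (y p n)) \<longlonglongrightarrow> 0"
      by (rule Lim_null_comparison[where g = "\<lambda>n. padic_abs p (x p n - y p n)"])
        (use xy p padic_abs_reverse_triangle[OF p] in
          \<open>auto simp: adele_rel_def padic_null_def intro!: always_eventually\<close>)
    hence "(\<lambda>n. padic_abs p (x p n)) \<longlonglongrightarrow> l \<longleftrightarrow> (\<lambda>n. padic_abs p (y p n)) \<longlonglongrightarrow> l" for l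
      by (rule Lim_transform_eq)
    thus ?thesis by (simp add: lim_def)
  qed
  thus "(if prime p then lim (\<lambda>n. padic_abs p (x p n)) else 0) =
        (if prime p then lim (\<lambda>n. padic_abs p (y p n)) else 0)" by simp
qed

lift_definition adele_of_rat :: "rat \<Rightarrow> finite_adele" is "\<lambda>q p n. q"
  by (simp add: adele_rel_def adele_seq_const)

definition Zhat :: "finite_adele set" where
  "Zhat = {x. \<forall>p. prime p \<longrightarrow> adele_abs p x \<le> 1}"

text \<open>
  The restricted product topology: the boxes \<open>\<Prod>\<^sub>p (x\<^sub>p + p\<^sup>k\<^sup>(\<^sup>p\<^sup>)\<int>\<^sub>p)\<close> with \<open>k(p) = 0\<close> for
  almost all \<open>p\<close> form a neighbourhood basis at \<open>x\<close>.
\<close>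

instantiation finite_adele :: topological_space
begin

definition open_finite_adele :: "finite_adele set \<Rightarrow> bool" where
  "open_finite_adele U \<longleftrightarrow> (\<forall>x\<in>U. \<exists>r. (\<forall>p. r p > 0) \<and> finite {p. r p \<noteq> 1} \<and>
     {y. \<forall>p. prime p \<longrightarrow> adele_abs p (y - x) \<le> r p} \<subseteq> U)"

instance
proof
  show "open (UNIV :: finite_adele set)"
    unfolding open_finite_adele_def by (auto intro!: exI[of _ "\<lambda>p. 1"])
next
  fix S T :: "finite_adele set" assume S: "open S" and T: "open T"
  show "open (S \<inter> T)"
    unfolding open_finite_adele_def
  proof
    fix x assume x: "x \<in> S \<inter> T"
    obtain r where r: "\<forall>p. r p > 0" "finite {p. r p \<noteq> 1}"
      "{y. \<forall>p. prime p \<longrightarrow> adele_abs p (y - x) \<le> r p} \<subseteq> S"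
      using S x unfolding open_finite_adele_def by blast
    obtain s where s: "\<forall>p. s p > 0" "finite {p. s p \<noteq> 1}"
      "{y. \<forall>p. prime p \<longrightarrow> adele_abs p (y - x) \<le> s p} \<subseteq> T"
      using T x unfolding open_finite_adele_def by blast
    have "{p. min (r p) (s p) \<noteq> 1} \<subseteq> {p. r p \<noteq> 1} \<union> {p. s p \<noteq> 1}" by (auto simp: min_def)
    hence "finite {p. min (r p) (s p) \<noteq> 1}" by (rule finite_subset) (use r s in auto)
    moreover have "{y. \<forall>p. prime p \<longrightarrow> adele_abs p (y - x) \<le> min (r p) (s p)} \<subseteq> S \<inter> T"
      using r(3) s(3) by auto
    ultimately show "\<exists>r. (\<forall>p. r p > 0) \<and> finite {p. r p \<noteq> 1} \<and>
        {y. \<forall>p. prime p \<longrightarrow> adele_abs p (y - x) \<le> r p} \<subseteq> S \<inter> T"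
      using r(1) s(1) by (intro exI[of _ "\<lambda>p. min (r p) (s p)"]) auto
  qed
next
  fix K :: "finite_adele set set" assume K: "\<forall>S\<in>K. open S"
  show "open (\<Union>K)"
    unfolding open_finite_adele_def
  proof
    fix x assume "x \<in> \<Union>K"
    then obtain S where S: "S \<in> K" "x \<in> S" by blast
    then obtain r where r: "\<forall>p. r p > 0" "finite {p. r p \<noteq> 1}"
      "{y. \<forall>p. prime p \<longrightarrow> adele_abs p (y - x) \<le> r p} \<subseteq> S"
      using K unfolding open_finite_adele_def by blast
    show "\<exists>r. (\<forall>p. r p > 0) \<and> finite {p. r p \<noteq> 1} \<and>
        {y. \<forall>p. prime p \<longrightarrow> adele_abs p (y - x) \<le> r p} \<subseteq> \<Union>K"
      by (rule exI[of _ r]) (use r S in auto)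
  qed
qed

end


section \<open>Characters of the finite adeles\<close>

definition adele_characters :: "(finite_adele \<Rightarrow> complex) set" where
  "adele_characters = {\<psi>. continuous_on UNIV \<psi> \<and>
     (\<forall>x y. \<psi> (x + y) = \<psi> x * \<psi> y) \<and> (\<forall>x. cmod (\<psi> x) = 1)}"

text \<open>The dual group, with the compact-open topology.\<close>

definition adele_dual_topology :: "(finite_adele \<Rightarrow> complex) topology" where
  "adele_dual_topology = subtopology
     (topology_generated_by {{\<psi>. \<psi> ` K \<subseteq> U} | K U. compact K \<and> open U}) adele_characters"

definition Zhat_annihilator :: "(finite_adele \<Rightarrow> complex) set" where
  "Zhat_annihilator = {\<psi> \<in> adele_characters. \<forall>x\<in>Zhat. \<psi> x = 1}"

text \<open>
  The map \<open>y \<mapsto> chi(\<cdot> y)\<close> is automatically a homomorphism for the pointwise product of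
  characters, so an isomorphism of topological groups is the same as a homeomorphism here.
\<close>

definition self_dual_character :: "(finite_adele \<Rightarrow> complex) \<Rightarrow> bool" where
  "self_dual_character chi \<longleftrightarrow> chi \<in> adele_characters \<and>
     homeomorphic_map euclidean adele_dual_topology (\<lambda>y x. chi (x * y)) \<and>
     (\<lambda>y x. chi (x * y)) ` Zhat = Zhat_annihilator"


section \<open>Bounded operators on square-summable functions\<close>

text \<open>
  Vectors of \<open>\<ell>\<^sup>2(X)\<close> vanish outside \<open>X\<close>; operators on \<open>\<ell>\<^sup>2(X)\<close> are extensional functions, so
  that equal operators are equal as functions.
\<close>

definition ell2 :: "'i set \<Rightarrow> ('i \<Rightarrow> complex) set" where
  "ell2 X = {\<xi>. (\<forall>i. i \<notin> X \<longrightarrow> \<xi> i = 0) \<and> (\<lambda>i. (cmod (\<xi> i))\<^sup>2) summable_on X}"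

definition ell2_inner :: "'i set \<Rightarrow> ('i \<Rightarrow> complex) \<Rightarrow> ('i \<Rightarrow> complex) \<Rightarrow> complex" where
  "ell2_inner X \<xi> \<eta> = (\<Sum>\<^sub>\<infinity>i\<in>X. \<xi> i * cnj (\<eta> i))"

definition ell2_norm :: "'i set \<Rightarrow> ('i \<Rightarrow> complex) \<Rightarrow> real" where
  "ell2_norm X \<xi> = sqrt (\<Sum>\<^sub>\<infinity>i\<in>X. (cmod (\<xi> i))\<^sup>2)"

type_synonym 'i operator = "('i \<Rightarrow> complex) \<Rightarrow> ('i \<Rightarrow> complex)"

definition bounded_ops :: "'i set \<Rightarrow> 'i operator set" where
  "bounded_ops X = {T \<in> ell2 X \<rightarrow>\<^sub>E ell2 X.
     (\<forall>\<xi>\<in>ell2 X. \<forall>\<eta>\<in>ell2 X. T (\<lambda>i. \<xi> i + \<eta> i) = (\<lambda>i. T \<xi> i + T \<eta> i)) \<and>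
     (\<forall>c. \<forall>\<xi>\<in>ell2 X. T (\<lambda>i. c * \<xi> i) = (\<lambda>i. c * T \<xi> i)) \<and>
     (\<exists>K. \<forall>\<xi>\<in>ell2 X. ell2_norm X (T \<xi>) \<le> K * ell2_norm X \<xi>)}"

definition op_add :: "'i set \<Rightarrow> 'i operator \<Rightarrow> 'i operator \<Rightarrow> 'i operator" where
  "op_add X T U = (\<lambda>\<xi>\<in>ell2 X. \<lambda>i. T \<xi> i + U \<xi> i)"

definition op_scale :: "'i set \<Rightarrow> complex \<Rightarrow> 'i operator \<Rightarrow> 'i operator" where
  "op_scale X c T = (\<lambda>\<xi>\<in>ell2 X. \<lambda>i. c * T \<xi> i)"

definition is_adjoint :: "'i set \<Rightarrow> 'i operator \<Rightarrow> 'i operator \<Rightarrow> bool" where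
  "is_adjoint X T U \<longleftrightarrow>
     (\<forall>\<xi>\<in>ell2 X. \<forall>\<eta>\<in>ell2 X. ell2_inner X (T \<xi>) \<eta> = ell2_inner X \<xi> (U \<eta>))"

text \<open>Closure in \<open>B(\<ell>\<^sup>2(X))\<close> for the operator norm.\<close>

definition op_closure :: "'i set \<Rightarrow> 'i operator set \<Rightarrow> 'i operator set" where
  "op_closure X \<A> = {T \<in> bounded_ops X. \<forall>e>0. \<exists>U\<in>\<A>. \<forall>\<xi>\<in>ell2 X.
     ell2_norm X (\<lambda>i. T \<xi> i - U \<xi> i) \<le> e * ell2_norm X \<xi>}"

text \<open>Representations on \<open>\<ell>\<^sup>2(Y)\<close> of a C*-algebra \<open>\<A>\<close> of operators on \<open>\<ell>\<^sup>2(X)\<close>.\<close>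

definition star_representation ::
  "'i set \<Rightarrow> 'i operator set \<Rightarrow> 'j set \<Rightarrow> ('i operator \<Rightarrow> 'j operator) \<Rightarrow> bool" where
  "star_representation X \<A> Y \<rho> \<longleftrightarrow>
     \<rho> \<in> \<A> \<rightarrow> bounded_ops Y \<and>
     (\<forall>T\<in>\<A>. \<forall>U\<in>\<A>. \<rho> (op_add X T U) = op_add Y (\<rho> T) (\<rho> U)) \<and>
     (\<forall>c. \<forall>T\<in>\<A>. \<rho> (op_scale X c T) = op_scale Y c (\<rho> T)) \<and>
     (\<forall>T\<in>\<A>. \<forall>U\<in>\<A>. \<rho> (compose (ell2 X) T U) = compose (ell2 Y) (\<rho> T) (\<rho> U)) \<and>
     (\<forall>T\<in>\<A>. \<forall>U\<in>\<A>. is_adjoint X T U \<longrightarrow> is_adjoint Y (\<rho> T) (\<rho> U))"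

definition faithful_representation ::
  "'i set \<Rightarrow> 'i operator set \<Rightarrow> 'j set \<Rightarrow> ('i operator \<Rightarrow> 'j operator) \<Rightarrow> bool" where
  "faithful_representation X \<A> Y \<rho> \<longleftrightarrow> star_representation X \<A> Y \<rho> \<and> inj_on \<rho> \<A>"


section \<open>Hecke algebras and their regular representations\<close>

text \<open>\<open>right_cosets N H X\<close> is \<open>H\<backslash>X\<close>, for a subset \<open>X\<close> of \<open>N\<close> with \<open>H X = X\<close>.\<close>

definition right_cosets :: "('a, 'b) monoid_scheme \<Rightarrow> 'a set \<Rightarrow> 'a set \<Rightarrow> 'a set set" where
  "right_cosets N H X = (\<lambda>x. H #>\<^bsub>N\<^esub> x) ` X"

definition double_coset :: "('a, 'b) monoid_scheme \<Rightarrow> 'a set \<Rightarrow> 'a \<Rightarrow> 'a set" where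
  "double_coset N H x = {h \<otimes>\<^bsub>N\<^esub> x \<otimes>\<^bsub>N\<^esub> k | h k. h \<in> H \<and> k \<in> H}"

text \<open>
  Functions on \<open>N\<close> are extended by zero outside the carrier. Convolution and involution on the
  Hecke algebra correspond under the regular representation to product and adjoint of operators.
\<close>

definition hecke_algebra :: "('a, 'b) monoid_scheme \<Rightarrow> 'a set \<Rightarrow> ('a \<Rightarrow> complex) set" where
  "hecke_algebra N H = {f.
     (\<forall>x. x \<notin> carrier N \<longrightarrow> f x = 0) \<and>
     (\<forall>x\<in>carrier N. \<forall>h\<in>H. \<forall>k\<in>H. f (h \<otimes>\<^bsub>N\<^esub> x \<otimes>\<^bsub>N\<^esub> k) = f x) \<and>
     finite {double_coset N H x | x. x \<in> carrier N \<and> f x \<noteq> 0}}"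

definition hecke_char :: "('a, 'b) monoid_scheme \<Rightarrow> 'a set \<Rightarrow> 'a \<Rightarrow> ('a \<Rightarrow> complex)" where
  "hecke_char N H x = indicator (double_coset N H x)"

definition coset_rep :: "'a set \<Rightarrow> 'a" where
  "coset_rep C = (SOME x. x \<in> C)"

text \<open>
  The operator \<open>(\<lambda>(f)\<xi>)(x) = \<Sum>\<^bsub>y \<in> H\<backslash>X\<^esub> f(x y\<^sup>-\<^sup>1) \<xi>(y)\<close> on \<open>\<ell>\<^sup>2(H\<backslash>X)\<close>. For \<open>f\<close> in the Hecke algebra
  the summand depends only on the cosets of \<open>x\<close> and \<open>y\<close>. We take \<open>X = N\<close> for the regular
  representation of the Hecke algebra of \<open>(N, H)\<close>, and a semigroup \<open>X\<close> with \<open>H \<subseteq> X\<close> for that of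
  the subalgebra of functions supported on \<open>X\<close>.
\<close>

definition regular_rep ::
  "('a, 'b) monoid_scheme \<Rightarrow> 'a set \<Rightarrow> 'a set \<Rightarrow> ('a \<Rightarrow> complex) \<Rightarrow> 'a set operator" where
  "regular_rep N H X f = (\<lambda>\<xi>\<in>ell2 (right_cosets N H X). \<lambda>C.
     if C \<in> right_cosets N H X
     then \<Sum>\<^sub>\<infinity>D\<in>right_cosets N H X.
            f (coset_rep C \<otimes>\<^bsub>N\<^esub> inv\<^bsub>N\<^esub> (coset_rep D)) * \<xi> D
     else 0)"

definition reduced_hecke_cstar :: "('a, 'b) monoid_scheme \<Rightarrow> 'a set \<Rightarrow> 'a set operator set" where
  "reduced_hecke_cstar N H = op_closure (right_cosets N H (carrier N))
     (regular_rep N H (carrier N) ` hecke_algebra N H)"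


section \<open>The Hecke pair and the representations\<close>

type_synonym rat_mat = "rat^2^2"

definition Mat2Z :: "rat_mat set" where
  "Mat2Z = {m. \<forall>i j. m $ i $ j \<in> \<int>}"

definition GL2Qpos :: "rat_mat monoid" where
  "GL2Qpos = \<lparr>carrier = {g. det g > 0}, monoid.mult = (**), one = mat 1\<rparr>"

definition SL2Z :: "rat_mat set" where
  "SL2Z = {g \<in> Mat2Z. det g = 1}"

definition Mat2Zpos :: "rat_mat set" where
  "Mat2Zpos = {s \<in> Mat2Z. det s > 0}"

definition alpha :: "rat_mat \<Rightarrow> rat_mat \<Rightarrow> rat_mat" where
  "alpha g m = m ** matrix_inv g"

definition P_group :: "(rat_mat \<times> rat_mat) monoid" where
  "P_group = \<lparr>carrier = UNIV \<times> carrier GL2Qpos,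
     monoid.mult = (\<lambda>(m, g) (n, h). (m + alpha g n, g ** h)), one = (0, mat 1)\<rparr>"

definition P0 :: "(rat_mat \<times> rat_mat) set" where
  "P0 = Mat2Z \<times> SL2Z"

definition mat_in_P :: "rat_mat \<Rightarrow> rat_mat \<times> rat_mat" where
  "mat_in_P m = (m, mat 1)"

definition GL_in_P :: "rat_mat \<Rightarrow> rat_mat \<times> rat_mat" where
  "GL_in_P g = (0, g)"

definition Mat2Q_mod_Mat2Z :: "rat_mat set set" where
  "Mat2Q_mod_Mat2Z = UNIV // {(m, n). m - n \<in> Mat2Z}"

definition GL2Zhat :: "(finite_adele^2^2) set" where
  "GL2Zhat = {w. (\<forall>i j. w $ i $ j \<in> Zhat) \<and>
     (\<exists>v. (\<forall>i j. v $ i $ j \<in> Zhat) \<and> w ** v = mat 1 \<and> v ** w = mat 1)}"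

text \<open>The restriction to \<open>Mat\<^sub>2(\<rat>)\<close> of the character \<open>a \<mapsto> chi(Tr(a w))\<close>.\<close>

definition char_twist :: "(finite_adele \<Rightarrow> complex) \<Rightarrow> finite_adele^2^2 \<Rightarrow> rat_mat \<Rightarrow> complex" where
  "char_twist chi w m = chi (trace (map_matrix adele_of_rat m ** w))"

abbreviation Gamma_mod_S :: "rat_mat set set" where
  "Gamma_mod_S \<equiv> right_cosets GL2Qpos SL2Z Mat2Zpos"

text \<open>
  For \<open>f\<close> in the Hecke algebra of \<open>(P, P\<^sub>0)\<close> the inner sum depends only on the cosets of \<open>t\<close> and
  \<open>s\<close>, although its individual terms change when \<open>s\<close> is replaced by another representative.
\<close>

definition pi_rep ::
  "(finite_adele \<Rightarrow> complex) \<Rightarrow> finite_adele^2^2 \<Rightarrow> (rat_mat \<times> rat_mat \<Rightarrow> complex) \<Rightarrow>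
   rat_mat set operator" where
  "pi_rep chi w f = (\<lambda>\<xi>\<in>ell2 Gamma_mod_S. \<lambda>C.
     if C \<in> Gamma_mod_S
     then let t = coset_rep C in
       \<Sum>\<^sub>\<infinity>D\<in>Gamma_mod_S. let s = coset_rep D in
         \<Sum>\<^sub>\<infinity>M\<in>Mat2Q_mod_Mat2Z. let m = coset_rep M in
           of_rat (det (t ** matrix_inv s)) * cnj (char_twist chi w (m ** s)) *
           f (GL_in_P (t ** matrix_inv s) \<otimes>\<^bsub>P_group\<^esub> mat_in_P (- m)) * \<xi> D
     else 0)"

end

theory Submission
  imports Defs
begin

text \<open>
  Among the left \<open>P\<^sub>0\<close>-invariant functions on \<open>P\<close>, the eigenfunctions of the right translations by
  \<open>Mat\<^sub>2(\<rat>)\<close> with character conjugate to \<open>\<chi>\<^sup>w\<close> correspond to the functions on \<open>\<Gamma>\<close>-cosets in \<open>S\<close>, and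
  \<open>f\<close> acts on them as \<open>\<pi>\<^sub>w(f)\<close>. They are not square-summable, but restricting them to the \<open>(m, g)\<close>
  with \<open>m g \<in> N\<^sup>-\<^sup>1 Mat\<^sub>2(\<int>)\<close> is compatible with \<open>\<lambda>(f)\<close> as soon as \<open>N\<close> is divisible enough. Since
  \<open>Mat\<^sub>2(\<int>) g\<close> has index \<open>N\<^sup>4 det(g)\<^sup>2\<close> in \<open>N\<^sup>-\<^sup>1 Mat\<^sub>2(\<int>)\<close>, dividing by \<open>N\<^sup>2 det(g)\<close> gives an isometry
  intertwining \<open>\<pi>\<^sub>w(f)\<close> and \<open>\<lambda>(f)\<close>, so the norm of \<open>\<pi>\<^sub>w(f)\<close> is at most that of \<open>\<lambda>(f)\<close>.

  Conversely, a finitely supported vector is an orthogonal sum of its components under the right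
  translations by a finite quotient of \<open>N\<^sup>-\<^sup>1 Mat\<^sub>2(\<int>)\<close>. All characters of that quotient have the form
  \<open>u \<mapsto> \<chi>(Tr(u a w))\<close> with \<open>a\<close> in \<open>GL\<^sub>2\<^sup>+(\<rat>)\<close>, so every component is a right translate by \<open>a\<close> of a cut-off
  eigenfunction for \<open>\<chi>\<^sup>w\<close>. Hence both norms agree, and \<open>\<lambda>(f) \<mapsto> \<pi>\<^sub>w(f)\<close> extends to the closure.
\<close>

section \<open>Square-summable functions\<close>

text \<open>The cut-off is compatible with \<open>f\<close> because \<open>f\<close> lives on
  finitely many double cosets and so has one denominator: when \<open>h\<close> has bounded
  denominator, \<open>f\<close> couples \<open>(m, g)\<close> and \<open>(n, h)\<close> only if
  \<open>m g - n h\<close> has bounded denominator, and \<open>m g\<close> is the coordinate to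
  which a right translation by \<open>v\<close> adds \<open>v\<close>. How large \<open>N\<close>
  must be depends on \<open>f\<close>. The construction therefore yields no single isometry
  intertwining the whole algebra, but an equality of norms for each \<open>f\<close>: one inequality
  lets the map extend continuously to the closure, the other makes the extension injective. Both
  inequalities rest on the fact that left convolution commutes with right translations. In the
  second one the translation by \<open>a\<close> leads back to the given character: since
  \<open>(v, 1) (0, a) = (0, a) (v a, 1)\<close>, it replaces the character
  \<open>u \<mapsto> psi u\<close> by \<open>u \<mapsto> psi (u a)\<close>. Self-duality enters
  through two nondegeneracy statements for the trace pairing on rational matrices, one for each
  side.\<close>

lemma ell2_eq_0: "\<xi> \<in> ell2 X \<Longrightarrow> i \<notin> X \<Longrightarrow> \<xi> i = 0"
  by (simp add: ell2_def)

lemma ell2_norm_nonneg [simp]: "0 \<le> ell2_norm X \<xi>"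
  unfolding ell2_norm_def by (intro real_sqrt_ge_zero infsum_nonneg) simp

lemma ell2_norm_power2: "(ell2_norm X \<xi>)\<^sup>2 = (\<Sum>\<^sub>\<infinity>i\<in>X. (cmod (\<xi> i))\<^sup>2)"
  unfolding ell2_norm_def by (simp add: infsum_nonneg)

text \<open>Norms are suprema over finite subsets, so membership and norm bounds reduce to
  \<open>L2_set\<close>, for which the triangle and Cauchy-Schwarz inequalities are at hand.\<close>

lemma
  assumes "\<And>i. i \<notin> X \<Longrightarrow> \<xi> i = 0"
    and le: "\<And>F. finite F \<Longrightarrow> F \<subseteq> X \<Longrightarrow> L2_set (\<lambda>i. cmod (\<xi> i)) F \<le> c"
  shows ell2_bddI: "\<xi> \<in> ell2 X" and ell2_norm_leI: "ell2_norm X \<xi> \<le> c"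
proof -
  have c: "0 \<le> c" using le[of "{}"] by simp
  have sq: "(\<Sum>i\<in>F. (cmod (\<xi> i))\<^sup>2) \<le> c\<^sup>2" if "finite F" "F \<subseteq> X" for F
    using le[OF that] c unfolding L2_set_def by (metis real_sqrt_le_iff real_sqrt_pow2 real_sqrt_unique)
  have sm: "(\<lambda>i. (cmod (\<xi> i))\<^sup>2) summable_on X"
    by (rule nonneg_bdd_above_summable_on) (auto intro!: bdd_aboveI2[where M = "c\<^sup>2"] sq)
  thus "\<xi> \<in> ell2 X" using assms(1) by (simp add: ell2_def)
  have "(\<Sum>\<^sub>\<infinity>i\<in>X. (cmod (\<xi> i))\<^sup>2) \<le> c\<^sup>2"
    by (rule infsum_le_finite_sums[OF sm sq])
  thus "ell2_norm X \<xi> \<le> c" unfolding ell2_norm_def using c by (intro real_le_lsqrt) auto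
qed

lemma L2_set_le_ell2_norm:
  assumes "\<xi> \<in> ell2 X" "finite F" "F \<subseteq> X"
  shows "L2_set (\<lambda>i. cmod (\<xi> i)) F \<le> ell2_norm X \<xi>"
  unfolding ell2_norm_def L2_set_def
  by (intro real_sqrt_le_mono finite_sum_le_infsum) (use assms in \<open>auto simp: ell2_def\<close>)

lemma cmod_le_ell2_norm:
  assumes "\<xi> \<in> ell2 X" shows "cmod (\<xi> i) \<le> ell2_norm X \<xi>"
proof (cases "i \<in> X")
  case True
  thus ?thesis using L2_set_le_ell2_norm[OF assms, of "{i}"] by simp
qed (use assms in \<open>simp add: ell2_eq_0\<close>)

lemma
  assumes "\<xi> \<in> ell2 X" "\<eta> \<in> ell2 X"
  shows ell2_add: "(\<lambda>i. \<xi> i + \<eta> i) \<in> ell2 X"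
    and ell2_norm_triangle: "ell2_norm X (\<lambda>i. \<xi> i + \<eta> i) \<le> ell2_norm X \<xi> + ell2_norm X \<eta>"
proof -
  have "L2_set (\<lambda>i. cmod (\<xi> i + \<eta> i)) F \<le> ell2_norm X \<xi> + ell2_norm X \<eta>"
    if "finite F" "F \<subseteq> X" for F
  proof -
    have "L2_set (\<lambda>i. cmod (\<xi> i + \<eta> i)) F \<le> L2_set (\<lambda>i. cmod (\<xi> i) + cmod (\<eta> i)) F"
      by (rule L2_set_mono) (auto intro: norm_triangle_ineq)
    also have "\<dots> \<le> L2_set (\<lambda>i. cmod (\<xi> i)) F + L2_set (\<lambda>i. cmod (\<eta> i)) F"
      by (rule L2_set_triangle_ineq)
    finally show ?thesis
      using L2_set_le_ell2_norm[OF assms(1) that] L2_set_le_ell2_norm[OF assms(2) that] by linarith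
  qed
  note le = this
  have out: "\<xi> i + \<eta> i = 0" if "i \<notin> X" for i
    using assms that by (simp add: ell2_eq_0)
  show "(\<lambda>i. \<xi> i + \<eta> i) \<in> ell2 X" by (rule ell2_bddI[OF out le])
  show "ell2_norm X (\<lambda>i. \<xi> i + \<eta> i) \<le> ell2_norm X \<xi> + ell2_norm X \<eta>"
    by (rule ell2_norm_leI[OF out le])
qed

lemma ell2_scale:
  assumes "\<xi> \<in> ell2 X" shows "(\<lambda>i. c * \<xi> i) \<in> ell2 X"
  using assms by (auto simp: ell2_def norm_mult power_mult_distrib intro: summable_on_cmult_right)

lemma ell2_norm_scale: "ell2_norm X (\<lambda>i. c * \<xi> i) = cmod c * ell2_norm X \<xi>"
  unfolding ell2_norm_def
  by (simp add: norm_mult power_mult_distrib infsum_cmult_right' real_sqrt_mult)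

lemma ell2_diff:
  assumes "\<xi> \<in> ell2 X" "\<eta> \<in> ell2 X" shows "(\<lambda>i. \<xi> i - \<eta> i) \<in> ell2 X"
  using ell2_add[OF assms(1) ell2_scale[OF assms(2), of "-1"]] by simp

lemma ell2_norm_minus_commute: "ell2_norm X (\<lambda>i. \<xi> i - \<eta> i) = ell2_norm X (\<lambda>i. \<eta> i - \<xi> i)"
  by (simp add: ell2_norm_def norm_minus_commute)

lemma ell2_norm_triangle_diff:
  assumes "\<xi> \<in> ell2 X" "\<eta> \<in> ell2 X"
  shows "ell2_norm X \<xi> \<le> ell2_norm X \<eta> + ell2_norm X (\<lambda>i. \<xi> i - \<eta> i)"
  using ell2_norm_triangle[OF assms(2) ell2_diff[OF assms]] by simp

lemma ell2_norm_triangle_via: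
  assumes "\<xi> \<in> ell2 X" "\<eta> \<in> ell2 X" "\<zeta> \<in> ell2 X"
  shows "ell2_norm X (\<lambda>i. \<xi> i - \<eta> i) \<le>
    ell2_norm X (\<lambda>i. \<xi> i - \<zeta> i) + ell2_norm X (\<lambda>i. \<zeta> i - \<eta> i)"
  using ell2_norm_triangle[OF ell2_diff[OF assms(1,3)] ell2_diff[OF assms(3,2)]] by simp

lemma ell2_norm_le_0_eqI:
  assumes "\<xi> \<in> ell2 X" "\<eta> \<in> ell2 X" "ell2_norm X (\<lambda>i. \<xi> i - \<eta> i) \<le> 0"
  shows "\<xi> = \<eta>"
proof
  fix i
  have "cmod (\<xi> i - \<eta> i) \<le> 0"
    using cmod_le_ell2_norm[OF ell2_diff[OF assms(1,2)], of i] assms(3) by linarith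
  thus "\<xi> i = \<eta> i" by simp
qed

lemma
  assumes "\<xi> \<in> ell2 X" "\<eta> \<in> ell2 X"
  shows ell2_inner_summable: "(\<lambda>i. \<xi> i * cnj (\<eta> i)) summable_on X"
    and ell2_Cauchy_Schwarz: "cmod (ell2_inner X \<xi> \<eta>) \<le> ell2_norm X \<xi> * ell2_norm X \<eta>"
proof -
  have le: "(\<Sum>i\<in>F. norm (\<xi> i * cnj (\<eta> i))) \<le> ell2_norm X \<xi> * ell2_norm X \<eta>"
    if F: "finite F" "F \<subseteq> X" for F
  proof -
    have "(\<Sum>i\<in>F. norm (\<xi> i * cnj (\<eta> i))) \<le> L2_set (\<lambda>i. cmod (\<xi> i)) F * L2_set (\<lambda>i. cmod (\<eta> i)) F"
      using L2_set_mult_ineq[of "\<lambda>i. cmod (\<xi> i)" "\<lambda>i. cmod (\<eta> i)" F] by (simp add: norm_mult)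
    also have "\<dots> \<le> ell2_norm X \<xi> * ell2_norm X \<eta>"
      using L2_set_le_ell2_norm F assms by (intro mult_mono) auto
    finally show ?thesis .
  qed
  have abs: "(\<lambda>i. norm (\<xi> i * cnj (\<eta> i))) summable_on X"
    by (rule nonneg_bdd_above_summable_on)
      (auto intro!: bdd_aboveI2[where M = "ell2_norm X \<xi> * ell2_norm X \<eta>"] le)
  thus "(\<lambda>i. \<xi> i * cnj (\<eta> i)) summable_on X" by (rule abs_summable_summable)
  have "cmod (ell2_inner X \<xi> \<eta>) \<le> (\<Sum>\<^sub>\<infinity>i\<in>X. norm (\<xi> i * cnj (\<eta> i)))"
    unfolding ell2_inner_def by (rule norm_infsum_bound[OF abs])
  also have "\<dots> \<le> ell2_norm X \<xi> * ell2_norm X \<eta>"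
    by (rule infsum_le_finite_sums[OF abs le])
  finally show "cmod (ell2_inner X \<xi> \<eta>) \<le> ell2_norm X \<xi> * ell2_norm X \<eta>" .
qed

lemma ell2_inner_self:
  assumes "\<xi> \<in> ell2 X"
  shows "ell2_inner X \<xi> \<xi> = of_real ((ell2_norm X \<xi>)\<^sup>2)"
proof -
  have "(\<lambda>i. \<xi> i * cnj (\<xi> i)) = (\<lambda>i. of_real ((cmod (\<xi> i))\<^sup>2))"
    by (simp add: complex_norm_square fun_eq_iff del: of_real_power)
  moreover have "(\<lambda>i. (cmod (\<xi> i))\<^sup>2) summable_on X"
    using assms by (simp add: ell2_def)
  note infsumI[OF has_sum_of_real[OF has_sum_infsum[OF this]]]
  ultimately show ?thesis unfolding ell2_norm_power2 ell2_inner_def by simp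
qed

lemma ell2_inner_diff_left:
  assumes "\<xi> \<in> ell2 X" "\<xi>' \<in> ell2 X" "\<eta> \<in> ell2 X"
  shows "ell2_inner X (\<lambda>i. \<xi> i - \<xi>' i) \<eta> = ell2_inner X \<xi> \<eta> - ell2_inner X \<xi>' \<eta>"
  using infsum_add[OF ell2_inner_summable[OF assms(1,3)]
      summable_on_uminus[THEN iffD2, OF ell2_inner_summable[OF assms(2,3)]]]
  by (simp add: ell2_inner_def algebra_simps infsum_uminus)

lemma ell2_inner_commute: "ell2_inner X \<eta> \<xi> = cnj (ell2_inner X \<xi> \<eta>)"
  unfolding ell2_inner_def by (simp add: mult.commute flip: infsum_cnj)

lemma ell2_inner_diff_right:
  assumes "\<xi> \<in> ell2 X" "\<eta> \<in> ell2 X" "\<eta>' \<in> ell2 X"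
  shows "ell2_inner X \<xi> (\<lambda>i. \<eta> i - \<eta>' i) = ell2_inner X \<xi> \<eta> - ell2_inner X \<xi> \<eta>'"
  using arg_cong[OF ell2_inner_diff_left[OF assms(2,3,1)], of cnj]
  by (simp flip: ell2_inner_commute)

section \<open>Extension of a norm-preserving family of operators\<close>

text \<open>For nonnegative \<open>e\<close> this says that \<open>T - U\<close> has operator norm
  at most \<open>e\<close>. Speaking of admissible bounds, as \<open>op_closure\<close> does, takes
  the place of an operator norm.\<close>

definition op_dist_le :: "'i set \<Rightarrow> 'i operator \<Rightarrow> 'i operator \<Rightarrow> real \<Rightarrow> bool" where
  "op_dist_le X T U e \<longleftrightarrow>
     (\<forall>\<xi>\<in>ell2 X. ell2_norm X (\<lambda>i. T \<xi> i - U \<xi> i) \<le> e * ell2_norm X \<xi>)"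

lemma bounded_opsD:
  assumes "T \<in> bounded_ops X"
  shows bounded_ops_ell2: "\<xi> \<in> ell2 X \<Longrightarrow> T \<xi> \<in> ell2 X"
    and bounded_ops_add: "\<xi> \<in> ell2 X \<Longrightarrow> \<eta> \<in> ell2 X \<Longrightarrow> T (\<lambda>i. \<xi> i + \<eta> i) = (\<lambda>i. T \<xi> i + T \<eta> i)"
    and bounded_ops_scale: "\<xi> \<in> ell2 X \<Longrightarrow> T (\<lambda>i. c * \<xi> i) = (\<lambda>i. c * T \<xi> i)"
    and bounded_ops_undefined: "\<xi> \<notin> ell2 X \<Longrightarrow> T \<xi> = undefined"
  using assms by (auto simp: bounded_ops_def)

lemma bounded_ops_bound:
  assumes "T \<in> bounded_ops X"
  obtains K where "K > 0" "\<And>\<xi>. \<xi> \<in> ell2 X \<Longrightarrow> ell2_norm X (T \<xi>) \<le> K * ell2_norm X \<xi>"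
proof -
  obtain K where K: "\<forall>\<xi>\<in>ell2 X. ell2_norm X (T \<xi>) \<le> K * ell2_norm X \<xi>"
    using assms by (auto simp: bounded_ops_def)
  have "ell2_norm X (T \<xi>) \<le> (\<bar>K\<bar> + 1) * ell2_norm X \<xi>" if "\<xi> \<in> ell2 X" for \<xi>
  proof -
    have "K * ell2_norm X \<xi> \<le> (\<bar>K\<bar> + 1) * ell2_norm X \<xi>" by (intro mult_right_mono) auto
    thus ?thesis using K that by fastforce
  qed
  thus ?thesis using that[of "\<bar>K\<bar> + 1"] by auto
qed

lemma bounded_opsI:
  assumes "\<And>\<xi>. \<xi> \<in> ell2 X \<Longrightarrow> T \<xi> \<in> ell2 X" "\<And>\<xi>. \<xi> \<notin> ell2 X \<Longrightarrow> T \<xi> = undefined"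
    "\<And>\<xi> \<eta>. \<xi> \<in> ell2 X \<Longrightarrow> \<eta> \<in> ell2 X \<Longrightarrow> T (\<lambda>i. \<xi> i + \<eta> i) = (\<lambda>i. T \<xi> i + T \<eta> i)"
    "\<And>c \<xi>. \<xi> \<in> ell2 X \<Longrightarrow> T (\<lambda>i. c * \<xi> i) = (\<lambda>i. c * T \<xi> i)"
    "\<And>\<xi>. \<xi> \<in> ell2 X \<Longrightarrow> ell2_norm X (T \<xi>) \<le> K * ell2_norm X \<xi>"
  shows "T \<in> bounded_ops X"
  unfolding bounded_ops_def mem_Collect_eq using assms by (intro conjI exI[of _ K]) auto

lemma bounded_ops_eqI:
  assumes "T \<in> bounded_ops X" "U \<in> bounded_ops X" "\<And>\<xi>. \<xi> \<in> ell2 X \<Longrightarrow> T \<xi> = U \<xi>"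
  shows "T = U"
  using assms bounded_ops_undefined by (metis ext)

lemma bounded_ops_eq_if_dist:
  assumes T: "T \<in> bounded_ops X" and U: "U \<in> bounded_ops X"
    and le: "\<And>e. e > 0 \<Longrightarrow> op_dist_le X T U e"
  shows "T = U"
proof (rule bounded_ops_eqI[OF T U])
  fix \<xi> assume xi: "\<xi> \<in> ell2 X"
  have "ell2_norm X (\<lambda>i. T \<xi> i - U \<xi> i) \<le> 0 + d" if d: "d > 0" for d
  proof -
    \<comment> \<open>The summand 1 keeps the denominator positive when \<open>\<xi>\<close> has
      norm 0.\<close>
    define e where "e = d / (ell2_norm X \<xi> + 1)"
    have p: "ell2_norm X \<xi> + 1 > 0" using ell2_norm_nonneg[of X \<xi>] by linarith
    have e: "e > 0" using d p by (simp add: e_def)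
    have "ell2_norm X (\<lambda>i. T \<xi> i - U \<xi> i) \<le> e * ell2_norm X \<xi>"
      using le[OF e] xi by (simp add: op_dist_le_def)
    also have "\<dots> \<le> e * (ell2_norm X \<xi> + 1)" using e by (intro mult_left_mono) auto
    also have "\<dots> = d" using p by (simp add: e_def)
    finally show ?thesis by simp
  qed
  hence "ell2_norm X (\<lambda>i. T \<xi> i - U \<xi> i) \<le> 0" by (rule field_le_epsilon)
  thus "T \<xi> = U \<xi>" using ell2_norm_le_0_eqI bounded_ops_ell2 T U xi by blast
qed

lemma op_dist_le_sym: "op_dist_le X T U e \<Longrightarrow> op_dist_le X U T e"
  unfolding op_dist_le_def by (subst ell2_norm_minus_commute)

lemma op_dist_le_mono:
  assumes "op_dist_le X T U e" "e \<le> e'" shows "op_dist_le X T U e'"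
  unfolding op_dist_le_def
proof
  fix \<xi> assume "\<xi> \<in> ell2 X"
  hence "ell2_norm X (\<lambda>i. T \<xi> i - U \<xi> i) \<le> e * ell2_norm X \<xi>"
    using assms by (simp add: op_dist_le_def)
  also have "\<dots> \<le> e' * ell2_norm X \<xi>" using assms by (intro mult_right_mono) auto
  finally show "ell2_norm X (\<lambda>i. T \<xi> i - U \<xi> i) \<le> e' * ell2_norm X \<xi>" .
qed

lemma op_dist_le_trans:
  assumes "T \<in> bounded_ops X" "U \<in> bounded_ops X" "V \<in> bounded_ops X"
    "op_dist_le X T U d" "op_dist_le X U V e"
  shows "op_dist_le X T V (d + e)"
  unfolding op_dist_le_def
proof
  fix \<xi> assume xi: "\<xi> \<in> ell2 X"
  have "ell2_norm X (\<lambda>i. T \<xi> i - V \<xi> i) \<le>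
      ell2_norm X (\<lambda>i. T \<xi> i - U \<xi> i) + ell2_norm X (\<lambda>i. U \<xi> i - V \<xi> i)"
    using bounded_ops_ell2 assms(1-3) xi by (intro ell2_norm_triangle_via) auto
  also have "\<dots> \<le> d * ell2_norm X \<xi> + e * ell2_norm X \<xi>"
    using assms(4,5) xi by (intro add_mono) (auto simp: op_dist_le_def)
  finally show "ell2_norm X (\<lambda>i. T \<xi> i - V \<xi> i) \<le> (d + e) * ell2_norm X \<xi>"
    by (simp add: distrib_right)
qed

section \<open>Continuity of the operations on bounded operators\<close>

lemma op_add_bounded:
  assumes T: "T \<in> bounded_ops X" and U: "U \<in> bounded_ops X"
  shows "op_add X T U \<in> bounded_ops X"
proof -
  obtain K where K: "\<And>\<xi>. \<xi> \<in> ell2 X \<Longrightarrow> ell2_norm X (T \<xi>) \<le> K * ell2_norm X \<xi>"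
    using bounded_ops_bound[OF T] by blast
  obtain L where L: "\<And>\<xi>. \<xi> \<in> ell2 X \<Longrightarrow> ell2_norm X (U \<xi>) \<le> L * ell2_norm X \<xi>"
    using bounded_ops_bound[OF U] by blast
  show ?thesis
  proof (rule bounded_opsI[where K = "K + L"])
    fix \<xi> assume xi: "\<xi> \<in> ell2 X"
    show "ell2_norm X (op_add X T U \<xi>) \<le> (K + L) * ell2_norm X \<xi>"
      using ell2_norm_triangle[of "T \<xi>" X "U \<xi>"] K[OF xi] L[OF xi] bounded_ops_ell2 T U xi
      by (fastforce simp: op_add_def distrib_right)
  qed (use T U in \<open>auto simp: op_add_def ell2_add ell2_scale bounded_opsD algebra_simps\<close>)
qed

lemma op_scale_bounded:
  assumes T: "T \<in> bounded_ops X"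
  shows "op_scale X c T \<in> bounded_ops X"
proof -
  obtain K where K: "\<And>\<xi>. \<xi> \<in> ell2 X \<Longrightarrow> ell2_norm X (T \<xi>) \<le> K * ell2_norm X \<xi>"
    using bounded_ops_bound[OF T] by blast
  show ?thesis
  proof (rule bounded_opsI[where K = "cmod c * K"])
    fix \<xi> assume xi: "\<xi> \<in> ell2 X"
    show "ell2_norm X (op_scale X c T \<xi>) \<le> cmod c * K * ell2_norm X \<xi>"
      using mult_left_mono[OF K[OF xi], of "cmod c"] xi
      by (simp add: op_scale_def ell2_norm_scale mult.assoc)
  qed (use T in \<open>auto simp: op_scale_def ell2_add ell2_scale bounded_opsD algebra_simps\<close>)
qed

lemma compose_bounded:
  assumes T: "T \<in> bounded_ops X" and U: "U \<in> bounded_ops X"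
  shows "compose (ell2 X) T U \<in> bounded_ops X"
proof -
  obtain K where K: "K > 0" "\<And>\<xi>. \<xi> \<in> ell2 X \<Longrightarrow> ell2_norm X (T \<xi>) \<le> K * ell2_norm X \<xi>"
    using bounded_ops_bound[OF T] by blast
  obtain L where L: "\<And>\<xi>. \<xi> \<in> ell2 X \<Longrightarrow> ell2_norm X (U \<xi>) \<le> L * ell2_norm X \<xi>"
    using bounded_ops_bound[OF U] by blast
  show ?thesis
  proof (rule bounded_opsI[where K = "K * L"])
    fix \<xi> assume xi: "\<xi> \<in> ell2 X"
    show "ell2_norm X (compose (ell2 X) T U \<xi>) \<le> K * L * ell2_norm X \<xi>"
      using order_trans[OF K(2)[OF bounded_ops_ell2[OF U xi]] mult_left_mono[OF L[OF xi]]] K(1) xi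
      by (simp add: compose_def mult.assoc)
  qed (use T U in \<open>auto simp: compose_def ell2_add ell2_scale bounded_opsD\<close>)
qed

lemma op_dist_le_add:
  assumes "T \<in> bounded_ops X" "T' \<in> bounded_ops X" "U \<in> bounded_ops X" "U' \<in> bounded_ops X"
    "op_dist_le X T T' d" "op_dist_le X U U' e"
  shows "op_dist_le X (op_add X T U) (op_add X T' U') (d + e)"
  unfolding op_dist_le_def
proof
  fix \<xi> assume xi: "\<xi> \<in> ell2 X"
  have "ell2_norm X (\<lambda>i. (T \<xi> i - T' \<xi> i) + (U \<xi> i - U' \<xi> i)) \<le>
      ell2_norm X (\<lambda>i. T \<xi> i - T' \<xi> i) + ell2_norm X (\<lambda>i. U \<xi> i - U' \<xi> i)"
    using bounded_ops_ell2 assms(1-4) xi by (intro ell2_norm_triangle ell2_diff) auto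
  also have "\<dots> \<le> d * ell2_norm X \<xi> + e * ell2_norm X \<xi>"
    using assms(5,6) xi by (intro add_mono) (auto simp: op_dist_le_def)
  finally show "ell2_norm X (\<lambda>i. op_add X T U \<xi> i - op_add X T' U' \<xi> i) \<le> (d + e) * ell2_norm X \<xi>"
    using xi by (simp add: op_add_def algebra_simps)
qed

lemma op_dist_le_scale:
  assumes "op_dist_le X T T' d"
  shows "op_dist_le X (op_scale X c T) (op_scale X c T') (cmod c * d)"
  unfolding op_dist_le_def
proof
  fix \<xi> assume xi: "\<xi> \<in> ell2 X"
  have "cmod c * ell2_norm X (\<lambda>i. T \<xi> i - T' \<xi> i) \<le> cmod c * (d * ell2_norm X \<xi>)"
    using assms xi by (intro mult_left_mono) (auto simp: op_dist_le_def)
  thus "ell2_norm X (\<lambda>i. op_scale X c T \<xi> i - op_scale X c T' \<xi> i) \<le> cmod c * d * ell2_norm X \<xi>"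
    using xi ell2_norm_scale[of X c "\<lambda>i. T \<xi> i - T' \<xi> i"]
    by (simp add: op_scale_def algebra_simps)
qed

text \<open>\<open>T U - T' U' = T (U - U') + (T - T') U'\<close>: the first summand costs
  \<open>K * e\<close>, the second \<open>d\<close> times the bound \<open>L + e\<close> for
  \<open>U'\<close>.\<close>

lemma op_dist_le_compose:
  assumes T: "T \<in> bounded_ops X" "T' \<in> bounded_ops X" and U: "U \<in> bounded_ops X" "U' \<in> bounded_ops X"
    and d: "op_dist_le X T T' d" and e: "op_dist_le X U U' e" and nn: "0 \<le> d" "0 \<le> e"
    and K: "\<And>\<xi>. \<xi> \<in> ell2 X \<Longrightarrow> ell2_norm X (T \<xi>) \<le> K * ell2_norm X \<xi>" "0 \<le> K"
    and L: "\<And>\<xi>. \<xi> \<in> ell2 X \<Longrightarrow> ell2_norm X (U \<xi>) \<le> L * ell2_norm X \<xi>"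
  shows "op_dist_le X (compose (ell2 X) T U) (compose (ell2 X) T' U') (K * e + d * (L + e))"
  unfolding op_dist_le_def
proof
  fix \<xi> assume xi: "\<xi> \<in> ell2 X"
  note mem = bounded_ops_ell2[OF U(1) xi] bounded_ops_ell2[OF U(2) xi]
  define \<zeta> where "\<zeta> = (\<lambda>i. U \<xi> i - U' \<xi> i)"
  have z: "\<zeta> \<in> ell2 X" unfolding \<zeta>_def by (rule ell2_diff[OF mem])
  have z_le: "ell2_norm X \<zeta> \<le> e * ell2_norm X \<xi>"
    using e xi by (simp add: op_dist_le_def \<zeta>_def)
  have "T (U \<xi>) = T (\<lambda>i. \<zeta> i + U' \<xi> i)" by (simp add: \<zeta>_def)
  hence 1: "T (U \<xi>) = (\<lambda>i. T \<zeta> i + T (U' \<xi>) i)" using bounded_ops_add[OF T(1) z mem(2)] by simp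
  have n: "ell2_norm X (U' \<xi>) \<le> (L + e) * ell2_norm X \<xi>"
    using ell2_norm_triangle_diff[OF mem(2,1)] L[OF xi] z_le
    by (simp add: \<zeta>_def ell2_norm_minus_commute[of X "U' \<xi>"] distrib_right)
  have "ell2_norm X (\<lambda>i. T \<zeta> i + (T (U' \<xi>) i - T' (U' \<xi>) i)) \<le>
     ell2_norm X (T \<zeta>) + ell2_norm X (\<lambda>i. T (U' \<xi>) i - T' (U' \<xi>) i)"
    using T mem z by (intro ell2_norm_triangle ell2_diff) (auto intro: bounded_ops_ell2)
  also have "ell2_norm X (T \<zeta>) \<le> K * (e * ell2_norm X \<xi>)"
    using K(1)[OF z] mult_left_mono[OF z_le K(2)] by linarith
  also have "ell2_norm X (\<lambda>i. T (U' \<xi>) i - T' (U' \<xi>) i) \<le> d * ell2_norm X (U' \<xi>)"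
    using d mem(2) by (simp add: op_dist_le_def)
  also have "\<dots> \<le> d * ((L + e) * ell2_norm X \<xi>)" by (rule mult_left_mono[OF n nn(1)])
  finally show "ell2_norm X (\<lambda>i. compose (ell2 X) T U \<xi> i - compose (ell2 X) T' U' \<xi> i)
      \<le> (K * e + d * (L + e)) * ell2_norm X \<xi>"
    using xi 1 by (simp add: compose_def algebra_simps)
qed

text \<open>Testing against \<open>\<zeta> = U \<xi> - U' \<xi>\<close> itself moves the difference
  to the other side: the squared norm of \<open>\<zeta>\<close> is the inner product of
  \<open>(T - T') \<zeta>\<close> with \<open>\<xi>\<close>, hence at most \<open>d\<close> times
  the product of the norms of \<open>\<zeta>\<close> and \<open>\<xi>\<close>.\<close>

lemma op_dist_le_adjoint:
  assumes T: "T \<in> bounded_ops X" "T' \<in> bounded_ops X" and U: "U \<in> bounded_ops X" "U' \<in> bounded_ops X"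
    and a: "is_adjoint X T U" "is_adjoint X T' U'"
    and d: "op_dist_le X T T' d" and d0: "0 \<le> d"
  shows "op_dist_le X U U' d"
  unfolding op_dist_le_def
proof
  fix \<xi> assume xi: "\<xi> \<in> ell2 X"
  define \<zeta> where "\<zeta> = (\<lambda>i. U \<xi> i - U' \<xi> i)"
  note mem = bounded_ops_ell2[OF U(1) xi] bounded_ops_ell2[OF U(2) xi]
  have z: "\<zeta> \<in> ell2 X" unfolding \<zeta>_def by (rule ell2_diff[OF mem])
  note mem' = bounded_ops_ell2[OF T(1) z] bounded_ops_ell2[OF T(2) z]
  have "of_real ((ell2_norm X \<zeta>)\<^sup>2) = ell2_inner X \<zeta> \<zeta>" using z by (simp add: ell2_inner_self)
  also have "\<dots> = ell2_inner X \<zeta> (U \<xi>) - ell2_inner X \<zeta> (U' \<xi>)"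
    using ell2_inner_diff_right[OF z mem] by (simp add: \<zeta>_def)
  also have "\<dots> = ell2_inner X (T \<zeta>) \<xi> - ell2_inner X (T' \<zeta>) \<xi>"
    using a z xi by (simp add: is_adjoint_def)
  also have "\<dots> = ell2_inner X (\<lambda>i. T \<zeta> i - T' \<zeta> i) \<xi>"
    using ell2_inner_diff_left[OF mem' xi] by simp
  finally have "(ell2_norm X \<zeta>)\<^sup>2 = cmod (ell2_inner X (\<lambda>i. T \<zeta> i - T' \<zeta> i) \<xi>)"
    by (metis norm_of_real abs_power2)
  also have "\<dots> \<le> ell2_norm X (\<lambda>i. T \<zeta> i - T' \<zeta> i) * ell2_norm X \<xi>"
    by (rule ell2_Cauchy_Schwarz[OF ell2_diff[OF mem'] xi])
  also have "\<dots> \<le> (d * ell2_norm X \<zeta>) * ell2_norm X \<xi>"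
    using d z by (intro mult_right_mono) (auto simp: op_dist_le_def)
  finally have "ell2_norm X \<zeta> * ell2_norm X \<zeta> \<le> ell2_norm X \<zeta> * (d * ell2_norm X \<xi>)"
    by (simp add: power2_eq_square mult_ac)
  hence "ell2_norm X \<zeta> \<le> d * ell2_norm X \<xi>"
    using ell2_norm_nonneg[of X \<zeta>] d0 ell2_norm_nonneg[of X \<xi>]
    by (metis mult_le_cancel_left_pos mult_nonneg_nonneg order.order_iff_strict)
  thus "ell2_norm X (\<lambda>i. U \<xi> i - U' \<xi> i) \<le> d * ell2_norm X \<xi>" by (simp add: \<zeta>_def)
qed

lemma ell2_norm_zero [simp]: "ell2_norm X (\<lambda>i. 0) = 0"
  by (simp add: ell2_norm_def)

text \<open>The closure properties are existential, so that \<open>H\<close> carries no operations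
  of its own and only the pairs of \<open>lam f\<close> and \<open>pi f\<close> matter.
  \<open>norm_preserving\<close> expresses equality of operator norms as equality of the sets of
  admissible bounds.\<close>

locale norm_preserving_family =
  fixes X :: "'i set" and Y :: "'j set" and H :: "'f set"
    and lam :: "'f \<Rightarrow> 'i operator" and pi :: "'f \<Rightarrow> 'j operator"
  assumes lam: "f \<in> H \<Longrightarrow> lam f \<in> bounded_ops X"
    and pi: "f \<in> H \<Longrightarrow> pi f \<in> bounded_ops Y"
    and add: "f \<in> H \<Longrightarrow> g \<in> H \<Longrightarrow>
      \<exists>h\<in>H. lam h = op_add X (lam f) (lam g) \<and> pi h = op_add Y (pi f) (pi g)"
    and scale: "f \<in> H \<Longrightarrow> \<exists>h\<in>H. lam h = op_scale X c (lam f) \<and> pi h = op_scale Y c (pi f)"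
    and compose: "f \<in> H \<Longrightarrow> g \<in> H \<Longrightarrow>
      \<exists>h\<in>H. lam h = compose (ell2 X) (lam f) (lam g) \<and> pi h = compose (ell2 Y) (pi f) (pi g)"
    and adjoint: "f \<in> H \<Longrightarrow> \<exists>h\<in>H. is_adjoint X (lam f) (lam h) \<and> is_adjoint Y (pi f) (pi h)"
    and norm_preserving: "f \<in> H \<Longrightarrow> 0 \<le> K \<Longrightarrow>
      (\<forall>\<xi>\<in>ell2 X. ell2_norm X (lam f \<xi>) \<le> K * ell2_norm X \<xi>) \<longleftrightarrow>
      (\<forall>\<eta>\<in>ell2 Y. ell2_norm Y (pi f \<eta>) \<le> K * ell2_norm Y \<eta>)"
begin

text \<open>The closure of the graph of \<open>lam f \<mapsto> pi f\<close>. The extension is read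
  off from this relation once it is seen to be the graph of an injective map on the closure of the
  image of \<open>lam\<close>.\<close>

definition common_limit :: "'i operator \<Rightarrow> 'j operator \<Rightarrow> bool" where
  "common_limit T R \<longleftrightarrow> T \<in> bounded_ops X \<and> R \<in> bounded_ops Y \<and>
     (\<forall>e>0. \<exists>f\<in>H. op_dist_le X T (lam f) e \<and> op_dist_le Y R (pi f) e)"

text \<open>This is \<open>norm_preserving\<close> for an \<open>h\<close> in \<open>H\<close> that
  represents the difference of \<open>f\<close> and \<open>g\<close>.\<close>

lemma dist_preserving:
  assumes "f \<in> H" "g \<in> H" "0 \<le> e"
  shows "op_dist_le X (lam f) (lam g) e \<longleftrightarrow> op_dist_le Y (pi f) (pi g) e"
proof -
  obtain g' where g': "g' \<in> H" "lam g' = op_scale X (-1) (lam g)" "pi g' = op_scale Y (-1) (pi g)"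
    using scale[OF assms(2)] by blast
  obtain h where h: "h \<in> H" "lam h = op_add X (lam f) (lam g')" "pi h = op_add Y (pi f) (pi g')"
    using add[OF assms(1) g'(1)] by blast
  show ?thesis using norm_preserving[OF h(1) assms(3)]
    by (simp add: h g' op_add_def op_scale_def op_dist_le_def)
qed

lemma common_limit_self: "f \<in> H \<Longrightarrow> common_limit (lam f) (pi f)"
  unfolding common_limit_def using lam pi
  by (auto intro!: bexI[of _ f] simp: op_dist_le_def)

text \<open>From left to right this makes the extension well defined, from right to left
  injective.\<close>

lemma common_limit_unique:
  assumes "common_limit T R" "common_limit T' R'"
  shows "T = T' \<longleftrightarrow> R = R'"
proof -
  note mem = assms[unfolded common_limit_def, THEN conjunct1]
    assms[unfolded common_limit_def, THEN conjunct2, THEN conjunct1]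
  have near: "\<exists>f\<in>H. \<exists>g\<in>H. op_dist_le X T (lam f) e \<and> op_dist_le Y R (pi f) e \<and>
      op_dist_le X T' (lam g) e \<and> op_dist_le Y R' (pi g) e" if "e > 0" for e
    using assms that unfolding common_limit_def by meson
  show ?thesis
  proof
    assume eq: "T = T'"
    show "R = R'"
    proof (rule bounded_ops_eq_if_dist[OF mem(3,4)])
      fix e :: real assume e: "e > 0"
      \<comment> \<open>On the path from \<open>R\<close> over \<open>pi f\<close> and
        \<open>pi g\<close> to \<open>R'\<close> the outer steps cost \<open>e/4\<close> each and
        the middle one \<open>e/4 + e/4\<close>, because \<open>lam f\<close> and
        \<open>lam g\<close> are both near \<open>T = T'\<close>.\<close>
      then obtain f g where fg: "f \<in> H" "g \<in> H" "op_dist_le X T (lam f) (e/4)"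
        "op_dist_le Y R (pi f) (e/4)" "op_dist_le X T' (lam g) (e/4)" "op_dist_le Y R' (pi g) (e/4)"
        using near[of "e/4"] by auto
      have "op_dist_le X (lam f) (lam g) (e/4 + e/4)"
        using op_dist_le_trans[OF lam[OF fg(1)] mem(1) lam[OF fg(2)] op_dist_le_sym[OF fg(3)]] fg(5) eq
        by blast
      hence "op_dist_le Y (pi f) (pi g) (e/4 + e/4)" using dist_preserving fg e by auto
      hence "op_dist_le Y R (pi g) (e/4 + (e/4 + e/4))"
        using op_dist_le_trans[OF mem(3) pi[OF fg(1)] pi[OF fg(2)] fg(4)] by blast
      from op_dist_le_trans[OF mem(3) pi[OF fg(2)] mem(4) this op_dist_le_sym[OF fg(6)]]
      show "op_dist_le Y R R' e" by (rule op_dist_le_mono) simp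
    qed
  next
    assume eq: "R = R'"
    show "T = T'"
    proof (rule bounded_ops_eq_if_dist[OF mem(1,2)])
      fix e :: real assume e: "e > 0"
      then obtain f g where fg: "f \<in> H" "g \<in> H" "op_dist_le X T (lam f) (e/4)"
        "op_dist_le Y R (pi f) (e/4)" "op_dist_le X T' (lam g) (e/4)" "op_dist_le Y R' (pi g) (e/4)"
        using near[of "e/4"] by auto
      have "op_dist_le Y (pi f) (pi g) (e/4 + e/4)"
        using op_dist_le_trans[OF pi[OF fg(1)] mem(3) pi[OF fg(2)] op_dist_le_sym[OF fg(4)]] fg(6) eq
        by blast
      hence "op_dist_le X (lam f) (lam g) (e/4 + e/4)" using dist_preserving fg e by auto
      hence "op_dist_le X T (lam g) (e/4 + (e/4 + e/4))"
        using op_dist_le_trans[OF mem(1) lam[OF fg(1)] lam[OF fg(2)] fg(3)] by blast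
      from op_dist_le_trans[OF mem(1) lam[OF fg(2)] mem(2) this op_dist_le_sym[OF fg(5)]]
      show "op_dist_le X T T' e" by (rule op_dist_le_mono) simp
    qed
  qed
qed

lemma common_limit_add:
  assumes "common_limit T R" "common_limit T' R'"
  shows "common_limit (op_add X T T') (op_add Y R R')"
proof -
  note mem = assms[unfolded common_limit_def, THEN conjunct1]
    assms[unfolded common_limit_def, THEN conjunct2, THEN conjunct1]
  have "\<exists>h\<in>H. op_dist_le X (op_add X T T') (lam h) e \<and> op_dist_le Y (op_add Y R R') (pi h) e"
    if e: "e > 0" for e
  proof -
    obtain f where f: "f \<in> H" "op_dist_le X T (lam f) (e/2)" "op_dist_le Y R (pi f) (e/2)"
      using assms(1) e unfolding common_limit_def by (meson half_gt_zero)
    obtain g where g: "g \<in> H" "op_dist_le X T' (lam g) (e/2)" "op_dist_le Y R' (pi g) (e/2)"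
      using assms(2) e unfolding common_limit_def by (meson half_gt_zero)
    obtain h where h: "h \<in> H" "lam h = op_add X (lam f) (lam g)" "pi h = op_add Y (pi f) (pi g)"
      using add[OF f(1) g(1)] by blast
    show ?thesis
      using op_dist_le_add[OF mem(1) lam[OF f(1)] mem(2) lam[OF g(1)] f(2) g(2)]
        op_dist_le_add[OF mem(3) pi[OF f(1)] mem(4) pi[OF g(1)] f(3) g(3)] h by (auto intro!: bexI[of _ h])
  qed
  thus ?thesis using mem by (auto simp: common_limit_def op_add_bounded)
qed

lemma common_limit_scale:
  assumes "common_limit T R"
  shows "common_limit (op_scale X c T) (op_scale Y c R)"
proof -
  note mem = assms[unfolded common_limit_def, THEN conjunct1]
    assms[unfolded common_limit_def, THEN conjunct2, THEN conjunct1]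
  have "\<exists>h\<in>H. op_dist_le X (op_scale X c T) (lam h) e \<and> op_dist_le Y (op_scale Y c R) (pi h) e"
    if e: "e > 0" for e
  proof -
    define d where "d = e / (cmod c + 1)"
    have p: "cmod c + 1 > 0" using norm_ge_zero[of c] by linarith
    have d: "d > 0" using e p by (simp add: d_def)
    have cd: "cmod c * d \<le> e" using e p by (simp add: d_def field_simps)
    obtain f where f: "f \<in> H" "op_dist_le X T (lam f) d" "op_dist_le Y R (pi f) d"
      using assms(1) d unfolding common_limit_def by meson
    obtain h where h: "h \<in> H" "lam h = op_scale X c (lam f)" "pi h = op_scale Y c (pi f)"
      using scale[OF f(1)] by blast
    show ?thesis
      using op_dist_le_mono[OF op_dist_le_scale[OF f(2)] cd]
        op_dist_le_mono[OF op_dist_le_scale[OF f(3)] cd] h by metis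
  qed
  thus ?thesis using mem by (auto simp: common_limit_def op_scale_bounded)
qed

lemma common_limit_compose:
  assumes "common_limit T R" "common_limit T' R'"
  shows "common_limit (FuncSet.compose (ell2 X) T T') (FuncSet.compose (ell2 Y) R R')"
proof -
  note mem = assms[unfolded common_limit_def, THEN conjunct1]
    assms[unfolded common_limit_def, THEN conjunct2, THEN conjunct1]
  obtain K1 where K1: "K1 > 0" "\<And>\<xi>. \<xi> \<in> ell2 X \<Longrightarrow> ell2_norm X (T \<xi>) \<le> K1 * ell2_norm X \<xi>"
    using bounded_ops_bound[OF mem(1)] by blast
  obtain K2 where K2: "K2 > 0" "\<And>\<xi>. \<xi> \<in> ell2 X \<Longrightarrow> ell2_norm X (T' \<xi>) \<le> K2 * ell2_norm X \<xi>"
    using bounded_ops_bound[OF mem(2)] by blast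
  obtain K3 where K3: "K3 > 0" "\<And>\<xi>. \<xi> \<in> ell2 Y \<Longrightarrow> ell2_norm Y (R \<xi>) \<le> K3 * ell2_norm Y \<xi>"
    using bounded_ops_bound[OF mem(3)] by blast
  obtain K4 where K4: "K4 > 0" "\<And>\<xi>. \<xi> \<in> ell2 Y \<Longrightarrow> ell2_norm Y (R' \<xi>) \<le> K4 * ell2_norm Y \<xi>"
    using bounded_ops_bound[OF mem(4)] by blast
  define K where "K = K1 + K2 + K3 + K4 + 1"
  have K: "K > 0" "K1 \<le> K" "K2 \<le> K" "K3 \<le> K" "K4 \<le> K" using K1(1) K2(1) K3(1) K4(1)
    by (auto simp: K_def)
  have bd: "ell2_norm X (T \<xi>) \<le> K * ell2_norm X \<xi>" "ell2_norm X (T' \<xi>) \<le> K * ell2_norm X \<xi>"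
    if "\<xi> \<in> ell2 X" for \<xi>
    using K1(2)[OF that] K2(2)[OF that] mult_right_mono[OF K(2), of "ell2_norm X \<xi>"]
      mult_right_mono[OF K(3), of "ell2_norm X \<xi>"] by auto
  have bd': "ell2_norm Y (R \<eta>) \<le> K * ell2_norm Y \<eta>" "ell2_norm Y (R' \<eta>) \<le> K * ell2_norm Y \<eta>"
    if "\<eta> \<in> ell2 Y" for \<eta>
    using K3(2)[OF that] K4(2)[OF that] mult_right_mono[OF K(4), of "ell2_norm Y \<eta>"]
      mult_right_mono[OF K(5), of "ell2_norm Y \<eta>"] by auto
  have "\<exists>h\<in>H. op_dist_le X (FuncSet.compose (ell2 X) T T') (lam h) e \<and>
      op_dist_le Y (FuncSet.compose (ell2 Y) R R') (pi h) e"
    if e: "e > 0" for e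
  proof -
    define d where "d = min 1 (e / (2 * K + 1))"
    have d: "d > 0" "d \<le> 1" using e K by (auto simp: d_def)
    have "K * d + d * (K + d) \<le> K * d + d * (K + 1)"
      using d by (intro add_left_mono mult_left_mono) auto
    also have "\<dots> = d * (2 * K + 1)" by (simp add: algebra_simps)
    also have "\<dots> \<le> e / (2 * K + 1) * (2 * K + 1)"
      using K by (intro mult_right_mono) (auto simp: d_def)
    also have "\<dots> = e" using K by simp
    finally have Kd: "K * d + d * (K + d) \<le> e" .
    obtain f where f: "f \<in> H" "op_dist_le X T (lam f) d" "op_dist_le Y R (pi f) d"
      using assms(1) d unfolding common_limit_def by meson
    obtain g where g: "g \<in> H" "op_dist_le X T' (lam g) d" "op_dist_le Y R' (pi g) d"
      using assms(2) d unfolding common_limit_def by meson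
    obtain h where h: "h \<in> H" "lam h = FuncSet.compose (ell2 X) (lam f) (lam g)"
      "pi h = FuncSet.compose (ell2 Y) (pi f) (pi g)"
      using compose[OF f(1) g(1)] by blast
    have d0: "0 \<le> d" and K0: "0 \<le> K" using d K by auto
    have "op_dist_le X (FuncSet.compose (ell2 X) T T') (lam h) (K * d + d * (K + d))"
      unfolding h(2) by (rule op_dist_le_compose[OF mem(1) lam[OF f(1)] mem(2) lam[OF g(1)] f(2) g(2)
          d0 d0 bd(1) K0 bd(2)])
    moreover have "op_dist_le Y (FuncSet.compose (ell2 Y) R R') (pi h) (K * d + d * (K + d))"
      unfolding h(3) by (rule op_dist_le_compose[OF mem(3) pi[OF f(1)] mem(4) pi[OF g(1)] f(3) g(3)
          d0 d0 bd'(1) K0 bd'(2)])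
    ultimately show ?thesis
      by (intro bexI[OF _ h(1)] conjI) (auto elim!: op_dist_le_mono intro: Kd)
  qed
  thus ?thesis using mem by (auto simp: common_limit_def compose_bounded)
qed

text \<open>An approximation \<open>g\<close> of \<open>T'\<close> need not be adjoint to the
  approximation \<open>f\<close> of \<open>T\<close>. So an adjoint \<open>h\<close> of
  \<open>f\<close> is compared with \<open>g\<close> on \<open>X\<close>, where
  \<open>op_dist_le_adjoint\<close> puts \<open>lam h\<close> near \<open>T'\<close>; carried over
  to \<open>Y\<close>, the comparison puts \<open>pi h\<close> near \<open>R'\<close>.\<close>

lemma common_limit_adjoint:
  assumes lim: "common_limit T R" "common_limit T' R'" and adj: "is_adjoint X T T'"
  shows "is_adjoint Y R R'"
proof -
  note mem = lim[unfolded common_limit_def, THEN conjunct1]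
    lim[unfolded common_limit_def, THEN conjunct2, THEN conjunct1]
  show ?thesis
    unfolding is_adjoint_def
  proof (intro ballI)
    fix \<xi> \<eta> assume xi: "\<xi> \<in> ell2 Y" and eta: "\<eta> \<in> ell2 Y"
    define B where "B = ell2_norm Y \<xi> * ell2_norm Y \<eta>"
    have B: "B \<ge> 0" by (simp add: B_def)
    have "cmod (ell2_inner Y (R \<xi>) \<eta> - ell2_inner Y \<xi> (R' \<eta>)) \<le> 0 + e" if e: "e > 0" for e
    proof -
      \<comment> \<open>\<open>R\<close> is within \<open>d\<close> of \<open>pi f\<close> and
        \<open>R'\<close> within \<open>3 * d\<close> of \<open>pi h\<close>, so the two inner
        products differ by at most \<open>4 * d * B\<close>.\<close>
      define d where "d = e / (4 * (B + 1))"
      have d: "d > 0" using e B by (simp add: d_def)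
      have dB: "4 * d * B \<le> e" using e B by (simp add: d_def field_simps mult_left_mono)
      obtain f where f: "f \<in> H" "op_dist_le X T (lam f) d" "op_dist_le Y R (pi f) d"
        using lim(1) d unfolding common_limit_def by meson
      obtain g where g: "g \<in> H" "op_dist_le X T' (lam g) d" "op_dist_le Y R' (pi g) d"
        using lim(2) d unfolding common_limit_def by meson
      obtain h where h: "h \<in> H" "is_adjoint X (lam f) (lam h)" "is_adjoint Y (pi f) (pi h)"
        using adjoint[OF f(1)] by blast
      have "op_dist_le X T' (lam h) d"
        using op_dist_le_adjoint[OF mem(1) lam[OF f(1)] mem(2) lam[OF h(1)] adj h(2) f(2)] d by simp
      from op_dist_le_trans[OF lam[OF g(1)] mem(2) lam[OF h(1)] op_dist_le_sym[OF g(2)] this]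
      have "op_dist_le Y (pi g) (pi h) (d + d)"
        using dist_preserving[OF g(1) h(1), of "d + d"] d by simp
      from op_dist_le_trans[OF mem(4) pi[OF g(1)] pi[OF h(1)] g(3) this]
      have R'h: "op_dist_le Y R' (pi h) (3 * d)" by simp
      note ops = bounded_ops_ell2[OF mem(3) xi] bounded_ops_ell2[OF pi[OF f(1)] xi]
        bounded_ops_ell2[OF mem(4) eta] bounded_ops_ell2[OF pi[OF h(1)] eta]
      have 1: "cmod (ell2_inner Y (\<lambda>i. R \<xi> i - pi f \<xi> i) \<eta>) \<le> d * B"
      proof -
        have "cmod (ell2_inner Y (\<lambda>i. R \<xi> i - pi f \<xi> i) \<eta>) \<le>
            ell2_norm Y (\<lambda>i. R \<xi> i - pi f \<xi> i) * ell2_norm Y \<eta>"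
          by (rule ell2_Cauchy_Schwarz[OF ell2_diff[OF ops(1,2)] eta])
        also have "\<dots> \<le> (d * ell2_norm Y \<xi>) * ell2_norm Y \<eta>"
          using f(3) xi by (intro mult_right_mono) (auto simp: op_dist_le_def)
        finally show ?thesis by (simp add: B_def)
      qed
      have 2: "cmod (ell2_inner Y \<xi> (\<lambda>i. R' \<eta> i - pi h \<eta> i)) \<le> 3 * d * B"
      proof -
        have "cmod (ell2_inner Y \<xi> (\<lambda>i. R' \<eta> i - pi h \<eta> i)) \<le>
            ell2_norm Y \<xi> * ell2_norm Y (\<lambda>i. R' \<eta> i - pi h \<eta> i)"
          by (rule ell2_Cauchy_Schwarz[OF xi ell2_diff[OF ops(3,4)]])
        also have "\<dots> \<le> ell2_norm Y \<xi> * (3 * d * ell2_norm Y \<eta>)"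
          using R'h eta by (intro mult_left_mono) (auto simp: op_dist_le_def)
        finally show ?thesis by (simp add: B_def mult_ac)
      qed
      have "ell2_inner Y (pi f \<xi>) \<eta> = ell2_inner Y \<xi> (pi h \<eta>)"
        using h(3) xi eta by (simp add: is_adjoint_def)
      hence "ell2_inner Y (R \<xi>) \<eta> - ell2_inner Y \<xi> (R' \<eta>) =
          ell2_inner Y (\<lambda>i. R \<xi> i - pi f \<xi> i) \<eta> - ell2_inner Y \<xi> (\<lambda>i. R' \<eta> i - pi h \<eta> i)"
        using ell2_inner_diff_left[OF ops(1,2) eta] ell2_inner_diff_right[OF xi ops(3,4)] by simp
      also have "cmod \<dots> \<le> d * B + 3 * d * B"
        using norm_triangle_ineq4[of "ell2_inner Y (\<lambda>i. R \<xi> i - pi f \<xi> i) \<eta>"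
            "ell2_inner Y \<xi> (\<lambda>i. R' \<eta> i - pi h \<eta> i)"] 1 2 by linarith
      also have "\<dots> \<le> e" using dB by (simp add: algebra_simps)
      finally show ?thesis by simp
    qed
    hence "cmod (ell2_inner Y (R \<xi>) \<eta> - ell2_inner Y \<xi> (R' \<eta>)) \<le> 0" by (rule field_le_epsilon)
    thus "ell2_inner Y (R \<xi>) \<eta> = ell2_inner Y \<xi> (R' \<eta>)" by simp
  qed
qed

text \<open>
  The limit operator is taken entrywise; bounds pass to the limit because norms are suprema of
  norms over finite sets.
\<close>

lemma common_limit_exists:
  assumes "T \<in> op_closure X (lam ` H)"
  shows "\<exists>R. common_limit T R"
proof -
  have T: "T \<in> bounded_ops X"
    and "\<And>e. e > 0 \<Longrightarrow> \<exists>f\<in>H. op_dist_le X T (lam f) e"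
    using assms by (auto simp: op_closure_def op_dist_le_def)
  hence "\<exists>f. \<forall>n. f n \<in> H \<and> op_dist_le X T (lam (f n)) (1 / real (Suc n))"
    by (intro choice allI) (metis of_nat_0_less_iff zero_less_Suc zero_less_divide_1_iff)
  then obtain f where f: "\<And>n. f n \<in> H" "\<And>n. op_dist_le X T (lam (f n)) (1 / real (Suc n))"
    by blast
  have dist: "op_dist_le Y (pi (f m)) (pi (f n)) (2 / real (Suc N))" if "N \<le> m" "N \<le> n" for m n N
  proof -
    have "1 / real (Suc m) + 1 / real (Suc n) \<le> 1 / real (Suc N) + 1 / real (Suc N)"
      using that by (intro add_mono divide_left_mono) auto
    hence "op_dist_le X (lam (f m)) (lam (f n)) (2 / real (Suc N))"
      using op_dist_le_trans[OF lam[OF f(1)] T lam[OF f(1)] op_dist_le_sym[OF f(2)] f(2), of m n]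
      by (elim op_dist_le_mono) simp
    thus ?thesis using dist_preserving[OF f(1) f(1)] by simp
  qed
  have conv: "convergent (\<lambda>n. pi (f n) \<eta> i)" if eta: "\<eta> \<in> ell2 Y" for \<eta> i
  proof (rule Cauchy_convergent, rule metric_CauchyI)
    fix e :: real assume e: "e > 0"
    define B where "B = ell2_norm Y \<eta> + 1"
    have B: "B > 0" using ell2_norm_nonneg[of Y \<eta>] unfolding B_def by linarith
    obtain N where N: "2 * B / e < real N" using reals_Archimedean2 by blast
    have "dist (pi (f m) \<eta> i) (pi (f n) \<eta> i) < e" if "m \<ge> N" "n \<ge> N" for m n
    proof -
      have "cmod (pi (f m) \<eta> i - pi (f n) \<eta> i) \<le> ell2_norm Y (\<lambda>i. pi (f m) \<eta> i - pi (f n) \<eta> i)"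
        by (rule cmod_le_ell2_norm[OF ell2_diff[OF bounded_ops_ell2[OF pi[OF f(1)] eta]
              bounded_ops_ell2[OF pi[OF f(1)] eta]]])
      also have "\<dots> \<le> 2 / real (Suc N) * ell2_norm Y \<eta>"
        using dist[OF that] eta unfolding op_dist_le_def by blast
      also have "\<dots> \<le> 2 / real (Suc N) * B" by (intro mult_left_mono) (auto simp: B_def)
      also have "\<dots> < e" using N e B by (simp add: field_simps)
      finally show ?thesis by (simp add: dist_norm)
    qed
    thus "\<exists>N. \<forall>m\<ge>N. \<forall>n\<ge>N. dist (pi (f m) \<eta> i) (pi (f n) \<eta> i) < e" by blast
  qed
  define R where "R = (\<lambda>\<eta>\<in>ell2 Y. \<lambda>i. lim (\<lambda>n. pi (f n) \<eta> i))"
  have R_lim: "(\<lambda>n. pi (f n) \<eta> i) \<longlonglongrightarrow> R \<eta> i" if "\<eta> \<in> ell2 Y" for \<eta> i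
    using conv[OF that] that by (simp add: R_def convergent_LIMSEQ_iff)
  have fin: "L2_set (\<lambda>i. cmod (R \<eta> i - pi (f N) \<eta> i)) F \<le> 2 / real (Suc N) * ell2_norm Y \<eta>"
    if eta: "\<eta> \<in> ell2 Y" and F: "finite F" "F \<subseteq> Y" for \<eta> F N
  proof (rule tendsto_upperbound)
    show "(\<lambda>n. L2_set (\<lambda>i. cmod (pi (f n) \<eta> i - pi (f N) \<eta> i)) F) \<longlonglongrightarrow>
        L2_set (\<lambda>i. cmod (R \<eta> i - pi (f N) \<eta> i)) F"
      unfolding L2_set_def
      by (intro tendsto_real_sqrt tendsto_sum tendsto_power tendsto_norm tendsto_diff R_lim[OF eta]
          tendsto_const)
    show "\<forall>\<^sub>F n in sequentially. L2_set (\<lambda>i. cmod (pi (f n) \<eta> i - pi (f N) \<eta> i)) F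
        \<le> 2 / real (Suc N) * ell2_norm Y \<eta>"
      unfolding eventually_sequentially
    proof (intro exI allI impI)
      fix n assume n: "n \<ge> N"
      have "L2_set (\<lambda>i. cmod (pi (f n) \<eta> i - pi (f N) \<eta> i)) F
          \<le> ell2_norm Y (\<lambda>i. pi (f n) \<eta> i - pi (f N) \<eta> i)"
        by (rule L2_set_le_ell2_norm[OF ell2_diff F])
          (auto intro: bounded_ops_ell2[OF pi[OF f(1)] eta])
      also have "\<dots> \<le> 2 / real (Suc N) * ell2_norm Y \<eta>"
        using dist[OF n order_refl] eta unfolding op_dist_le_def by blast
      finally show "L2_set (\<lambda>i. cmod (pi (f n) \<eta> i - pi (f N) \<eta> i)) F
        \<le> 2 / real (Suc N) * ell2_norm Y \<eta>" .
    qed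
  qed simp
  have R_out: "R \<eta> i = 0" if "\<eta> \<in> ell2 Y" "i \<notin> Y" for \<eta> i
    using R_lim[OF that(1), of i] ell2_eq_0[OF bounded_ops_ell2[OF pi[OF f(1)] that(1)] that(2)]
    by (simp add: LIMSEQ_const_iff)
  have R_diff: "(\<lambda>i. R \<eta> i - pi (f N) \<eta> i) \<in> ell2 Y"
      "ell2_norm Y (\<lambda>i. R \<eta> i - pi (f N) \<eta> i) \<le> 2 / real (Suc N) * ell2_norm Y \<eta>"
    if eta: "\<eta> \<in> ell2 Y" for \<eta> N
    using ell2_eq_0[OF bounded_ops_ell2[OF pi[OF f(1)] eta]] R_out[OF eta] fin[OF eta]
    by (auto intro!: ell2_bddI ell2_norm_leI)
  have R_mem: "R \<eta> \<in> ell2 Y" if "\<eta> \<in> ell2 Y" for \<eta>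
    using ell2_add[OF R_diff(1)[OF that, of 0] bounded_ops_ell2[OF pi[OF f(1)] that, of 0]] by simp
  obtain K where K: "K > 0" "\<And>\<eta>. \<eta> \<in> ell2 Y \<Longrightarrow> ell2_norm Y (pi (f 0) \<eta>) \<le> K * ell2_norm Y \<eta>"
    using bounded_ops_bound[OF pi[OF f(1)]] by blast
  have R: "R \<in> bounded_ops Y"
  \<comment> \<open>\<open>K\<close> bounds \<open>pi (f 0)\<close>, and \<open>R\<close> is within
    \<open>2 / Suc 0\<close> of it.\<close>
  proof (rule bounded_opsI[where K = "K + 2"])
    fix \<xi> \<eta> assume xe: "\<xi> \<in> ell2 Y" "\<eta> \<in> ell2 Y"
    show "R (\<lambda>i. \<xi> i + \<eta> i) = (\<lambda>i. R \<xi> i + R \<eta> i)"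
    proof
      fix i
      have "(\<lambda>n. pi (f n) (\<lambda>i. \<xi> i + \<eta> i) i) \<longlonglongrightarrow> R \<xi> i + R \<eta> i"
        unfolding bounded_ops_add[OF pi[OF f(1)] xe] by (rule tendsto_add[OF R_lim[OF xe(1)] R_lim[OF xe(2)]])
      thus "R (\<lambda>i. \<xi> i + \<eta> i) i = R \<xi> i + R \<eta> i"
        using R_lim[OF ell2_add[OF xe]] LIMSEQ_unique by blast
    qed
  next
    fix c \<eta> assume eta: "\<eta> \<in> ell2 Y"
    show "R (\<lambda>i. c * \<eta> i) = (\<lambda>i. c * R \<eta> i)"
    proof
      fix i
      have "(\<lambda>n. pi (f n) (\<lambda>i. c * \<eta> i) i) \<longlonglongrightarrow> c * R \<eta> i"
        unfolding bounded_ops_scale[OF pi[OF f(1)] eta] by (rule tendsto_mult[OF tendsto_const R_lim[OF eta]])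
      thus "R (\<lambda>i. c * \<eta> i) i = c * R \<eta> i"
        using R_lim[OF ell2_scale[OF eta]] LIMSEQ_unique by blast
    qed
  next
    fix \<eta> assume eta: "\<eta> \<in> ell2 Y"
    show "ell2_norm Y (R \<eta>) \<le> (K + 2) * ell2_norm Y \<eta>"
      using ell2_norm_triangle_diff[OF R_mem[OF eta] bounded_ops_ell2[OF pi[OF f(1)] eta], of 0]
        K(2)[OF eta] R_diff(2)[OF eta, of 0] by (simp add: distrib_right)
  qed (use R_mem in \<open>auto simp: R_def\<close>)
  have "\<exists>g\<in>H. op_dist_le X T (lam g) e \<and> op_dist_le Y R (pi g) e" if e: "e > 0" for e
  proof -
    obtain N where "2 / e < real N" using reals_Archimedean2 by blast
    hence "2 / real (Suc N) \<le> e" using e by (simp add: field_simps)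
    moreover have "1 / real (Suc N) \<le> 2 / real (Suc N)" by (simp add: divide_right_mono)
    ultimately have "op_dist_le X T (lam (f N)) e"
      using op_dist_le_mono[OF f(2)[of N]] by (meson order_trans)
    moreover have "op_dist_le Y R (pi (f N)) (2 / real (Suc N))"
      using R_diff(2) by (simp add: op_dist_le_def)
    ultimately show ?thesis
      using op_dist_le_mono[OF _ \<open>2 / real (Suc N) \<le> e\<close>] by (intro bexI[OF _ f(1)[of N]]) simp
  qed
  thus ?thesis using T R by (auto simp: common_limit_def)
qed

theorem faithful_extension:
  "\<exists>\<rho>. faithful_representation X (op_closure X (lam ` H)) Y \<rho> \<and> (\<forall>f\<in>H. \<rho> (lam f) = pi f)"
proof -
  define \<rho> where "\<rho> = (\<lambda>T. SOME R. common_limit T R)"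
  have lim: "common_limit T (\<rho> T)" if "T \<in> op_closure X (lam ` H)" for T
    unfolding \<rho>_def using common_limit_exists[OF that] by (rule someI_ex)
  have eq: "\<rho> T = R" if "common_limit T R" for T R
    using someI[of "common_limit T", OF that] that common_limit_unique unfolding \<rho>_def by blast
  have "inj_on \<rho> (op_closure X (lam ` H))"
    by (rule inj_onI) (use lim common_limit_unique in blast)
  moreover have "star_representation X (op_closure X (lam ` H)) Y \<rho>"
    unfolding star_representation_def
  proof (intro conjI allI ballI impI)
    show "\<rho> \<in> op_closure X (lam ` H) \<rightarrow> bounded_ops Y"
      using lim by (auto simp: common_limit_def)
  next
    fix T U assume "T \<in> op_closure X (lam ` H)" "U \<in> op_closure X (lam ` H)" "is_adjoint X T U"
    thus "is_adjoint Y (\<rho> T) (\<rho> U)" using common_limit_adjoint lim by blast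
  qed (auto intro!: eq common_limit_add common_limit_scale common_limit_compose lim)
  ultimately show ?thesis
    using common_limit_self eq by (auto simp: faithful_representation_def)
qed

end

section \<open>Operators with finite rows and columns\<close>

definition kernel_op :: "'i set \<Rightarrow> ('i \<Rightarrow> 'i \<Rightarrow> complex) \<Rightarrow> 'i operator" where
  "kernel_op X K = (\<lambda>\<xi>\<in>ell2 X. \<lambda>i. if i \<in> X then \<Sum>\<^sub>\<infinity>j\<in>X. K i j * \<xi> j else 0)"

text \<open>Hypotheses of a finite Schur test, with the same \<open>r\<close> for rows and columns.
  Kernels of Hecke operators satisfy them, see \<open>hecke_finite_kernel\<close>.\<close>

locale finite_kernel =
  fixes X :: "'i set" and K :: "'i \<Rightarrow> 'i \<Rightarrow> complex" and r :: nat and B :: real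
  assumes row: "i \<in> X \<Longrightarrow> finite {j\<in>X. K i j \<noteq> 0}"
    and row_card: "i \<in> X \<Longrightarrow> card {j\<in>X. K i j \<noteq> 0} \<le> r"
    and col: "j \<in> X \<Longrightarrow> finite {i\<in>X. K i j \<noteq> 0}"
    and col_card: "j \<in> X \<Longrightarrow> card {i\<in>X. K i j \<noteq> 0} \<le> r"
    and entry: "i \<in> X \<Longrightarrow> j \<in> X \<Longrightarrow> cmod (K i j) \<le> B"
begin

lemma row_summable: "i \<in> X \<Longrightarrow> (\<lambda>j. K i j * \<xi> j) summable_on X"
  by (rule finite_nonzero_values_imp_summable_on, rule finite_subset[OF _ row]) auto

lemma row_sum:
  "i \<in> X \<Longrightarrow> (\<Sum>\<^sub>\<infinity>j\<in>X. K i j * \<xi> j) = (\<Sum>j\<in>{j\<in>X. K i j \<noteq> 0}. K i j * \<xi> j)"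
  by (subst infsum_finite[symmetric]) (auto intro!: row infsum_cong_neutral)

lemma row_sum_power2_le:
  assumes "i \<in> X"
  shows "(cmod (\<Sum>\<^sub>\<infinity>j\<in>X. K i j * \<xi> j))\<^sup>2 \<le>
    B\<^sup>2 * r * (\<Sum>j\<in>{j\<in>X. K i j \<noteq> 0}. (cmod (\<xi> j))\<^sup>2)"
proof -
  let ?J = "{j\<in>X. K i j \<noteq> 0}"
  have B: "0 \<le> B" using entry[OF assms assms] norm_ge_zero[of "K i i"] by linarith
  have "cmod (\<Sum>\<^sub>\<infinity>j\<in>X. K i j * \<xi> j) \<le> (\<Sum>j\<in>?J. cmod (K i j * \<xi> j))"
    unfolding row_sum[OF assms] by (rule norm_sum)
  also have "\<dots> \<le> (\<Sum>j\<in>?J. B * cmod (\<xi> j))"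
    using entry[OF assms] by (auto intro!: sum_mono mult_right_mono simp: norm_mult)
  finally have "(cmod (\<Sum>\<^sub>\<infinity>j\<in>X. K i j * \<xi> j))\<^sup>2 \<le> (\<Sum>j\<in>?J. B * cmod (\<xi> j))\<^sup>2"
    by (intro power_mono) auto
  also have "\<dots> = B\<^sup>2 * (\<Sum>j\<in>?J. cmod (\<xi> j))\<^sup>2"
    by (simp add: power_mult_distrib flip: sum_distrib_left)
  also have "\<dots> \<le> B\<^sup>2 * ((\<Sum>j\<in>?J. (cmod (\<xi> j))\<^sup>2) * card ?J)"
    by (intro mult_left_mono sum_squared_le_sum_of_squares row assms) auto
  also have "\<dots> \<le> B\<^sup>2 * ((\<Sum>j\<in>?J. (cmod (\<xi> j))\<^sup>2) * r)"
    using row_card[OF assms] by (intro mult_left_mono sum_nonneg) auto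
  finally show ?thesis by (simp add: mult_ac)
qed

text \<open>Cauchy-Schwarz in each row gives one factor \<open>r\<close>; after exchanging the sums
  every \<open>\<xi> j\<close> is met by at most \<open>r\<close> rows, which gives the other, and
  the square root leaves \<open>\<bar>B\<bar> * r\<close>. The absolute value covers empty
  \<open>X\<close>, where \<open>entry\<close> does not make \<open>B\<close> nonnegative.\<close>

lemma
  assumes xi: "\<xi> \<in> ell2 X"
  shows kernel_op_mem: "kernel_op X K \<xi> \<in> ell2 X"
    and kernel_op_norm_le: "ell2_norm X (kernel_op X K \<xi>) \<le> \<bar>B\<bar> * r * ell2_norm X \<xi>"
proof -
  have le: "L2_set (\<lambda>i. cmod (kernel_op X K \<xi> i)) F \<le> \<bar>B\<bar> * r * ell2_norm X \<xi>"
    if F: "finite F" "F \<subseteq> X" for F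
  proof -
    define J where "J = (\<Union>i\<in>F. {j\<in>X. K i j \<noteq> 0})"
    have J: "finite J" "J \<subseteq> X" using F row by (auto simp: J_def)
    have "(\<Sum>i\<in>F. (cmod (kernel_op X K \<xi> i))\<^sup>2) \<le>
        (\<Sum>i\<in>F. B\<^sup>2 * r * (\<Sum>j\<in>{j\<in>X. K i j \<noteq> 0}. (cmod (\<xi> j))\<^sup>2))"
      using row_sum_power2_le[of _ \<xi>] F xi by (auto intro!: sum_mono simp: kernel_op_def)
    also have "\<dots> = B\<^sup>2 * r * (\<Sum>i\<in>F. \<Sum>j\<in>J. if K i j \<noteq> 0 then (cmod (\<xi> j))\<^sup>2 else 0)"
      unfolding sum_distrib_left[symmetric]
    proof (rule arg_cong[where f = "\<lambda>s. B\<^sup>2 * r * s"], rule sum.cong[OF refl])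
      fix i assume "i \<in> F"
      hence "{j\<in>X. K i j \<noteq> 0} = {j\<in>J. K i j \<noteq> 0}" using J by (auto simp: J_def)
      thus "(\<Sum>j\<in>{j\<in>X. K i j \<noteq> 0}. (cmod (\<xi> j))\<^sup>2) =
          (\<Sum>j\<in>J. if K i j \<noteq> 0 then (cmod (\<xi> j))\<^sup>2 else 0)"
        using J(1) by (simp add: sum.inter_filter)
    qed
    also have "\<dots> = B\<^sup>2 * r * (\<Sum>j\<in>J. real (card {i\<in>F. K i j \<noteq> 0}) * (cmod (\<xi> j))\<^sup>2)"
      using F(1) by (subst sum.swap) (simp add: sum.inter_filter[symmetric])
    also have "\<dots> \<le> B\<^sup>2 * r * (\<Sum>j\<in>J. real r * (cmod (\<xi> j))\<^sup>2)"
    proof (intro mult_left_mono sum_mono mult_right_mono)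
      fix j assume "j \<in> J"
      hence j: "j \<in> X" using J by auto
      have "card {i\<in>F. K i j \<noteq> 0} \<le> card {i\<in>X. K i j \<noteq> 0}"
        using F by (intro card_mono col j) auto
      thus "real (card {i\<in>F. K i j \<noteq> 0}) \<le> real r" using col_card[OF j] by simp
    qed auto
    also have "\<dots> = B\<^sup>2 * (real r)\<^sup>2 * (\<Sum>j\<in>J. (cmod (\<xi> j))\<^sup>2)"
      by (simp add: power2_eq_square mult_ac flip: sum_distrib_left)
    finally have "(\<Sum>i\<in>F. (cmod (kernel_op X K \<xi> i))\<^sup>2) \<le>
        (\<bar>B\<bar> * r * L2_set (\<lambda>j. cmod (\<xi> j)) J)\<^sup>2"
      by (simp add: L2_set_def power_mult_distrib sum_nonneg)
    hence "L2_set (\<lambda>i. cmod (kernel_op X K \<xi> i)) F \<le> \<bar>B\<bar> * r * L2_set (\<lambda>j. cmod (\<xi> j)) J"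
      unfolding L2_set_def[of _ F] by (intro real_le_lsqrt) auto
    also have "\<dots> \<le> \<bar>B\<bar> * r * ell2_norm X \<xi>"
      by (intro mult_left_mono L2_set_le_ell2_norm xi J) auto
    finally show ?thesis .
  qed
  have out: "kernel_op X K \<xi> i = 0" if "i \<notin> X" for i
    using xi that by (simp add: kernel_op_def)
  show "kernel_op X K \<xi> \<in> ell2 X" by (rule ell2_bddI[OF out le])
  show "ell2_norm X (kernel_op X K \<xi>) \<le> \<bar>B\<bar> * r * ell2_norm X \<xi>" by (rule ell2_norm_leI[OF out le])
qed

lemma kernel_op_bounded: "kernel_op X K \<in> bounded_ops X"
proof (rule bounded_opsI[where K = "\<bar>B\<bar> * r"])
  fix \<xi> \<eta> assume "\<xi> \<in> ell2 X" "\<eta> \<in> ell2 X"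
  thus "kernel_op X K (\<lambda>i. \<xi> i + \<eta> i) = (\<lambda>i. kernel_op X K \<xi> i + kernel_op X K \<eta> i)"
    using infsum_add[OF row_summable row_summable]
    by (auto simp: kernel_op_def ell2_add fun_eq_iff distrib_left)
next
  fix c \<xi> assume "\<xi> \<in> ell2 X"
  thus "kernel_op X K (\<lambda>i. c * \<xi> i) = (\<lambda>i. c * kernel_op X K \<xi> i)"
    by (auto simp: kernel_op_def ell2_scale fun_eq_iff mult.left_commute[of _ c] infsum_cmult_right')
qed (auto simp: kernel_op_mem intro: kernel_op_norm_le, simp add: kernel_op_def)

text \<open>Every entry of \<open>kernel_op X K \<xi>\<close> depends on finitely many entries of \<open>\<xi>\<close>.\<close>

lemma kernel_op_norm_le_if_finite_support:
  assumes c: "0 \<le> c"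
    and le: "\<And>\<xi>. \<xi> \<in> ell2 X \<Longrightarrow> finite {i. \<xi> i \<noteq> 0} \<Longrightarrow>
      ell2_norm X (kernel_op X K \<xi>) \<le> c * ell2_norm X \<xi>"
    and xi: "\<xi> \<in> ell2 X"
  shows "ell2_norm X (kernel_op X K \<xi>) \<le> c * ell2_norm X \<xi>"
proof (rule ell2_norm_leI)
  show "kernel_op X K \<xi> i = 0" if "i \<notin> X" for i
    using xi that by (simp add: kernel_op_def)
  fix F assume F: "finite F" "F \<subseteq> X"
  define J where "J = (\<Union>i\<in>F. {j\<in>X. K i j \<noteq> 0})"
  have J: "finite J" "J \<subseteq> X" using F row by (auto simp: J_def)
  define \<zeta> where "\<zeta> = (\<lambda>j. if j \<in> J then \<xi> j else 0)"
  have z_le: "L2_set (\<lambda>i. cmod (\<zeta> i)) F' \<le> ell2_norm X \<xi>" if "finite F'" "F' \<subseteq> X" for F'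
  proof -
    have "L2_set (\<lambda>i. cmod (\<zeta> i)) F' \<le> L2_set (\<lambda>i. cmod (\<xi> i)) F'"
      by (rule L2_set_mono) (auto simp: \<zeta>_def)
    thus ?thesis using L2_set_le_ell2_norm[OF xi that] by linarith
  qed
  have z_out: "\<zeta> i = 0" if "i \<notin> X" for i using that J by (auto simp: \<zeta>_def)
  have z: "\<zeta> \<in> ell2 X" by (rule ell2_bddI[OF z_out z_le])
  have z_norm: "ell2_norm X \<zeta> \<le> ell2_norm X \<xi>" by (rule ell2_norm_leI[OF z_out z_le])
  have "kernel_op X K \<xi> i = kernel_op X K \<zeta> i" if "i \<in> F" for i
  proof -
    have "(\<Sum>\<^sub>\<infinity>j\<in>X. K i j * \<xi> j) = (\<Sum>\<^sub>\<infinity>j\<in>X. K i j * \<zeta> j)"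
      by (rule infsum_cong) (use that in \<open>auto simp: \<zeta>_def J_def\<close>)
    thus ?thesis using xi z by (simp add: kernel_op_def)
  qed
  hence "L2_set (\<lambda>i. cmod (kernel_op X K \<xi> i)) F = L2_set (\<lambda>i. cmod (kernel_op X K \<zeta> i)) F"
    by (intro L2_set_cong) auto
  also have "\<dots> \<le> ell2_norm X (kernel_op X K \<zeta>)"
    by (rule L2_set_le_ell2_norm[OF kernel_op_mem[OF z] F])
  also have "\<dots> \<le> c * ell2_norm X \<zeta>"
    by (rule le[OF z], rule finite_subset[OF _ J(1)]) (auto simp: \<zeta>_def)
  also have "\<dots> \<le> c * ell2_norm X \<xi>" using z_norm c by (rule mult_left_mono)
  finally show "L2_set (\<lambda>i. cmod (kernel_op X K \<xi> i)) F \<le> c * ell2_norm X \<xi>" .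
qed

text \<open>The two sums may be exchanged because of absolute summability on
  \<open>X \<times> X\<close>: where \<open>K i j\<close> is nonzero, the term is at most
  \<open>B\<close> times the sum of the squared moduli of \<open>\<eta> i\<close> and
  \<open>\<xi> j\<close>, and bounded rows and columns make each of these two majorants
  summable.\<close>

lemma kernel_op_adjoint: "is_adjoint X (kernel_op X K) (kernel_op X (\<lambda>i j. cnj (K j i)))"
  unfolding is_adjoint_def
proof (intro ballI)
  fix \<xi> \<eta> assume xi: "\<xi> \<in> ell2 X" and eta: "\<eta> \<in> ell2 X"
  have rows: "(\<lambda>(i, j). if K i j = 0 then 0 else B * (cmod (\<eta> i))\<^sup>2) summable_on X \<times> X"
    if eta: "\<eta> \<in> ell2 X" and "\<And>i. i \<in> X \<Longrightarrow> finite {j\<in>X. K i j \<noteq> 0}"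
      "\<And>i. i \<in> X \<Longrightarrow> card {j\<in>X. K i j \<noteq> 0} \<le> r"
      "\<And>i j. i \<in> X \<Longrightarrow> j \<in> X \<Longrightarrow> cmod (K i j) \<le> B" for \<eta> and K :: "'i \<Rightarrow> 'i \<Rightarrow> complex"
  proof (rule summable_on_SigmaI)
    have B: "0 \<le> B" if "i \<in> X" for i
      using \<open>\<And>i j. i \<in> X \<Longrightarrow> j \<in> X \<Longrightarrow> cmod (K i j) \<le> B\<close>[OF that that] norm_ge_zero[of "K i i"] by linarith
    show "((\<lambda>j. case (i, j) of (i, j) \<Rightarrow> if K i j = 0 then 0 else B * (cmod (\<eta> i))\<^sup>2) has_sum
        (\<Sum>j\<in>{j\<in>X. K i j \<noteq> 0}. B * (cmod (\<eta> i))\<^sup>2)) X" if "i \<in> X" for i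
      by (rule has_sum_finite_neutralI[where B = "{j\<in>X. K i j \<noteq> 0}"])
        (use \<open>\<And>i. i \<in> X \<Longrightarrow> finite {j\<in>X. K i j \<noteq> 0}\<close>[OF that] in auto)
    show "(\<lambda>i. \<Sum>j\<in>{j\<in>X. K i j \<noteq> 0}. B * (cmod (\<eta> i))\<^sup>2) summable_on X"
    proof (rule summable_on_comparison_test)
      show "(\<lambda>i. real r * B * (cmod (\<eta> i))\<^sup>2) summable_on X"
        using eta by (intro summable_on_cmult_right) (simp add: ell2_def)
      show "(\<Sum>j\<in>{j\<in>X. K i j \<noteq> 0}. B * (cmod (\<eta> i))\<^sup>2) \<le> real r * B * (cmod (\<eta> i))\<^sup>2"
        if "i \<in> X" for i
        using \<open>\<And>i. i \<in> X \<Longrightarrow> card {j\<in>X. K i j \<noteq> 0} \<le> r\<close>[OF that] B[OF that]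
        by (simp add: mult.assoc mult_right_mono)
    qed (auto intro!: sum_nonneg mult_nonneg_nonneg B)
    show "0 \<le> (case (i, j) of (i, j) \<Rightarrow> if K i j = 0 then 0 else B * (cmod (\<eta> i))\<^sup>2)"
      if "i \<in> X" for i j using B[OF that] by simp
  qed
  have 1: "(\<lambda>(i, j). if K i j = 0 then 0 else B * (cmod (\<eta> i))\<^sup>2) summable_on X \<times> X"
    by (rule rows[OF eta row row_card entry])
  have "(\<lambda>(j, i). if K i j = 0 then 0 else B * (cmod (\<xi> j))\<^sup>2) summable_on X \<times> X"
    by (rule rows[OF xi, where K = "\<lambda>j i. K i j"]) (auto intro: col col_card entry)
  hence 2: "(\<lambda>(i, j). if K i j = 0 then 0 else B * (cmod (\<xi> j))\<^sup>2) summable_on X \<times> X"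
    by (subst (asm) summable_on_swap) simp
  have "(\<lambda>p. norm (case p of (i, j) \<Rightarrow> K i j * \<xi> j * cnj (\<eta> i))) summable_on X \<times> X"
  proof (rule Infinite_Sum.abs_summable_on_comparison_test'[OF summable_on_add[OF 1 2]])
    fix p assume "p \<in> X \<times> X"
    then obtain i j where p: "p = (i, j)" "i \<in> X" "j \<in> X" by blast
    have "cmod (K i j) * (cmod (\<xi> j) * cmod (\<eta> i)) \<le> B * ((cmod (\<eta> i))\<^sup>2 + (cmod (\<xi> j))\<^sup>2)"
    proof (rule mult_mono)
      show "cmod (\<xi> j) * cmod (\<eta> i) \<le> (cmod (\<eta> i))\<^sup>2 + (cmod (\<xi> j))\<^sup>2"
        using sum_squares_bound[of "cmod (\<xi> j)" "cmod (\<eta> i)"]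
          mult_nonneg_nonneg[OF norm_ge_zero norm_ge_zero, of "\<xi> j" "\<eta> i"] by linarith
    qed (use entry[OF p(2,3)] order_trans[OF norm_ge_zero entry[OF p(2,3)]] in auto)
    thus "norm (case p of (i, j) \<Rightarrow> K i j * \<xi> j * cnj (\<eta> i)) \<le>
      (case p of (i, j) \<Rightarrow> if K i j = 0 then 0 else B * (cmod (\<eta> i))\<^sup>2) +
      (case p of (i, j) \<Rightarrow> if K i j = 0 then 0 else B * (cmod (\<xi> j))\<^sup>2)"
      by (simp add: p(1) norm_mult distrib_left mult.assoc)
  qed
  hence sm: "(\<lambda>(i, j). K i j * \<xi> j * cnj (\<eta> i)) summable_on X \<times> X"
    by (rule abs_summable_summable)
  have "ell2_inner X (kernel_op X K \<xi>) \<eta> = (\<Sum>\<^sub>\<infinity>i\<in>X. \<Sum>\<^sub>\<infinity>j\<in>X. K i j * \<xi> j * cnj (\<eta> i))"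
    unfolding ell2_inner_def
    by (rule infsum_cong) (use xi in \<open>simp add: kernel_op_def infsum_cmult_left'\<close>)
  also have "\<dots> = (\<Sum>\<^sub>\<infinity>j\<in>X. \<Sum>\<^sub>\<infinity>i\<in>X. K i j * \<xi> j * cnj (\<eta> i))"
    by (rule infsum_swap_banach[OF sm])
  also have "\<dots> = ell2_inner X \<xi> (kernel_op X (\<lambda>i j. cnj (K j i)) \<eta>)"
    unfolding ell2_inner_def
    by (rule infsum_cong)
      (use eta in \<open>simp add: kernel_op_def mult_ac flip: infsum_cnj infsum_cmult_right'\<close>)
  finally show "ell2_inner X (kernel_op X K \<xi>) \<eta> =
      ell2_inner X \<xi> (kernel_op X (\<lambda>i j. cnj (K j i)) \<eta>)" .
qed

end

section \<open>Hecke pairs\<close>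

locale subgroup_pair = group G for G (structure) +
  fixes H :: "'a set"
  assumes sub: "subgroup H G"
begin

abbreviation "RC \<equiv> right_cosets G H (carrier G)"

lemma H_carrier [simp]: "h \<in> H \<Longrightarrow> h \<in> carrier G"
  by (rule subgroup.mem_carrier[OF sub])

lemma inv_cancel [simp]:
  assumes "x \<in> carrier G" "y \<in> carrier G"
  shows "inv x \<otimes> (x \<otimes> y) = y" "x \<otimes> (inv x \<otimes> y) = y"
  using assms m_assoc[of "inv x" x y] m_assoc[of x "inv x" y] by auto

lemma RC_I [simp]: "x \<in> carrier G \<Longrightarrow> H #> x \<in> RC"
  by (simp add: right_cosets_def)

lemma coset_rep_in:
  assumes "C \<in> RC" shows "coset_rep C \<in> C"
proof -
  obtain x where "x \<in> carrier G" "C = H #> x" using assms by (auto simp: right_cosets_def)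
  hence "x \<in> C" using rcos_self[OF _ sub] by simp
  thus ?thesis unfolding coset_rep_def by (rule someI)
qed

lemma coset_rep_carrier [simp]: "C \<in> RC \<Longrightarrow> coset_rep C \<in> carrier G"
  using coset_rep_in r_coset_subset_G[OF subgroup.subset[OF sub]]
  by (fastforce simp: right_cosets_def)

lemma coset_of_coset_rep [simp]:
  assumes "C \<in> RC" shows "H #> coset_rep C = C"
proof -
  obtain x where "x \<in> carrier G" "C = H #> x" using assms by (auto simp: right_cosets_def)
  thus ?thesis using repr_independence[OF _ _ sub, of "coset_rep C" x] coset_rep_in[OF assms] by simp
qed

lemma coset_absorb:
  assumes "h \<in> H" "x \<in> carrier G" shows "H #> (h \<otimes> x) = H #> x"
  using repr_independence[OF rcosI[OF assms(1) subgroup.subset[OF sub] assms(2)] assms(2) sub] by simp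

lemma coset_eqE:
  assumes "H #> x = H #> y" "x \<in> carrier G" "y \<in> carrier G"
  obtains h where "h \<in> H" "x = h \<otimes> y"
proof -
  have "x \<in> H #> y" using rcos_self[OF assms(2) sub] assms(1) by simp
  thus ?thesis using that by (auto simp: r_coset_def)
qed

lemma coset_rep_of_coset:
  assumes "x \<in> carrier G"
  obtains h where "h \<in> H" "coset_rep (H #> x) = h \<otimes> x"
  by (rule coset_eqE[of "coset_rep (H #> x)" x]) (use assms in auto)

text \<open>Vectors on the right cosets are handled as left invariant functions on the group. This
  removes the dependence on the choice made by \<open>coset_rep\<close> and makes right translations
  easy to write.\<close>

definition left_invariant :: "('a \<Rightarrow> 'c) \<Rightarrow> bool" where
  "left_invariant F \<longleftrightarrow> (\<forall>h\<in>H. \<forall>x\<in>carrier G. F (h \<otimes> x) = F x)"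

lemma left_invariant_coset_rep:
  assumes "left_invariant F" "x \<in> carrier G"
  shows "F (coset_rep (H #> x)) = F x"
  by (rule coset_rep_of_coset[OF assms(2)]) (use assms in \<open>simp add: left_invariant_def\<close>)

lemma left_invariant_translate:
  assumes "left_invariant F" "y \<in> carrier G"
  shows "left_invariant (\<lambda>x. F (x \<otimes> y))"
  using assms by (simp add: left_invariant_def m_assoc)

lemma translate_bij:
  assumes y: "y \<in> carrier G"
  shows "bij_betw (\<lambda>C. C #> y) RC RC"
proof (rule bij_betw_byWitness[where f' = "\<lambda>C. C #> inv y"])
  have *: "H #> x #> z = H #> (x \<otimes> z)" if "x \<in> carrier G" "z \<in> carrier G" for x z
    using coset_mult_assoc[OF subgroup.subset[OF sub] that] .
  show "\<forall>C\<in>RC. C #> y #> inv y = C" "\<forall>C\<in>RC. C #> inv y #> y = C"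
    using y by (auto simp: right_cosets_def * m_assoc)
  show "(\<lambda>C. C #> y) ` RC \<subseteq> RC" "(\<lambda>C. C #> inv y) ` RC \<subseteq> RC"
    using y by (auto simp: right_cosets_def *)
qed

lemma coset_rep_translate:
  assumes "left_invariant F" "C \<in> RC" "y \<in> carrier G"
  shows "F (coset_rep (C #> y)) = F (coset_rep C \<otimes> y)"
proof -
  have "C #> y = H #> (coset_rep C \<otimes> y)"
    using coset_mult_assoc[OF subgroup.subset[OF sub] coset_rep_carrier[OF assms(2)] assms(3)] assms(2)
    by simp
  thus ?thesis
    using left_invariant_coset_rep[OF assms(1) m_closed[OF coset_rep_carrier[OF assms(2)] assms(3)]]
    by simp
qed

text \<open>Right translation by \<open>y\<close> permutes the right cosets, and left invariance
  makes the choice of representatives harmless. Hence right translations preserve the norm of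
  square-summable functions, see \<open>on_cosets_translate\<close>.\<close>

lemma infsum_translate:
  assumes F: "left_invariant F" and y: "y \<in> carrier G"
  shows "(\<Sum>\<^sub>\<infinity>C\<in>RC. F (coset_rep C \<otimes> y)) = (\<Sum>\<^sub>\<infinity>C\<in>RC. F (coset_rep C))"
proof -
  have "(\<Sum>\<^sub>\<infinity>C\<in>RC. F (coset_rep C)) = (\<Sum>\<^sub>\<infinity>C\<in>RC. F (coset_rep (C #> y)))"
    using infsum_reindex_bij_betw[OF translate_bij[OF y], of "\<lambda>C. F (coset_rep C)"] by simp
  also have "\<dots> = (\<Sum>\<^sub>\<infinity>C\<in>RC. F (coset_rep C \<otimes> y))"
    by (rule infsum_cong) (simp add: coset_rep_translate[OF F _ y])
  finally show ?thesis by simp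
qed

lemma summable_translate:
  assumes F: "left_invariant F" and y: "y \<in> carrier G"
  shows "(\<lambda>C. F (coset_rep C \<otimes> y)) summable_on RC \<longleftrightarrow> (\<lambda>C. F (coset_rep C)) summable_on RC"
proof -
  have "(\<lambda>C. F (coset_rep C)) summable_on RC \<longleftrightarrow> (\<lambda>C. F (coset_rep (C #> y))) summable_on RC"
    using summable_on_reindex_bij_betw[OF translate_bij[OF y], of "\<lambda>C. F (coset_rep C)"] by simp
  also have "\<dots> \<longleftrightarrow> (\<lambda>C. F (coset_rep C \<otimes> y)) summable_on RC"
    by (rule summable_on_cong) (simp add: coset_rep_translate[OF F _ y])
  finally show ?thesis by simp
qed

end

locale hecke_pair = subgroup_pair +
  assumes finite_double_coset: "x \<in> carrier G \<Longrightarrow> finite ((\<lambda>y. H #> y) ` double_coset G H x)"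
begin

abbreviation "supp f \<equiv> {x. f x \<noteq> (0::complex)}"

lemma hecke_supp: "f \<in> hecke_algebra G H \<Longrightarrow> f x \<noteq> 0 \<Longrightarrow> x \<in> carrier G"
  by (auto simp: hecke_algebra_def)

lemma hecke_biinvariant:
  "f \<in> hecke_algebra G H \<Longrightarrow> x \<in> carrier G \<Longrightarrow> h \<in> H \<Longrightarrow> k \<in> H \<Longrightarrow> f (h \<otimes> x \<otimes> k) = f x"
  by (simp add: hecke_algebra_def)

lemma hecke_left_invariant: "f \<in> hecke_algebra G H \<Longrightarrow> left_invariant f"
  using hecke_biinvariant[of f _ _ \<one>] subgroup.one_closed[OF sub] by (simp add: left_invariant_def)

lemma hecke_right_invariant:
  "f \<in> hecke_algebra G H \<Longrightarrow> x \<in> carrier G \<Longrightarrow> k \<in> H \<Longrightarrow> f (x \<otimes> k) = f x"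
  using hecke_biinvariant[of f x \<one> k] subgroup.one_closed[OF sub] by simp

lemma self_in_double_coset: "x \<in> carrier G \<Longrightarrow> x \<in> double_coset G H x"
  using subgroup.one_closed[OF sub] by (force simp: double_coset_def)

lemma finite_supp_cosets:
  assumes f: "f \<in> hecke_algebra G H"
  shows "finite ((\<lambda>x. H #> x) ` supp f)"
proof -
  let ?D = "{double_coset G H x | x. x \<in> carrier G \<and> f x \<noteq> 0}"
  have "finite ?D" using f by (simp add: hecke_algebra_def)
  hence "finite (\<Union>D\<in>?D. (\<lambda>x. H #> x) ` D)" using finite_double_coset by auto
  moreover have "(\<lambda>x. H #> x) ` supp f \<subseteq> (\<Union>D\<in>?D. (\<lambda>x. H #> x) ` D)"
  proof (rule image_subsetI)
    fix x assume "x \<in> supp f"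
    hence x: "x \<in> carrier G" "f x \<noteq> 0" using hecke_supp[OF f] by auto
    show "H #> x \<in> (\<Union>D\<in>?D. (\<lambda>x. H #> x) ` D)"
      by (rule UN_I[of "double_coset G H x"]) (use x self_in_double_coset[OF x(1)] in auto)
  qed
  ultimately show ?thesis by (rule finite_subset[rotated])
qed

section \<open>The involution, and finiteness of rows and columns\<close>

definition hecke_star :: "('a \<Rightarrow> complex) \<Rightarrow> 'a \<Rightarrow> complex" where
  "hecke_star f x = (if x \<in> carrier G then cnj (f (inv x)) else 0)"

lemma double_coset_inv:
  assumes "x \<in> carrier G"
  shows "double_coset G H (inv x) = (\<lambda>y. inv y) ` double_coset G H x"
proof -
  have *: "(\<lambda>y. inv y) ` double_coset G H z \<subseteq> double_coset G H (inv z)" if z: "z \<in> carrier G" for z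
  proof
    fix y assume "y \<in> (\<lambda>y. inv y) ` double_coset G H z"
    then obtain h k where hk: "h \<in> H" "k \<in> H" "y = inv (h \<otimes> z \<otimes> k)"
      by (auto simp: double_coset_def)
    hence "y = inv k \<otimes> inv z \<otimes> inv h" using z by (simp add: inv_mult_group m_assoc)
    thus "y \<in> double_coset G H (inv z)"
      unfolding double_coset_def mem_Collect_eq
      using subgroup.m_inv_closed[OF sub hk(1)] subgroup.m_inv_closed[OF sub hk(2)] by (intro exI conjI)
  qed
  have "double_coset G H (inv x) \<subseteq> (\<lambda>y. inv y) ` double_coset G H x"
  proof
    fix y assume y: "y \<in> double_coset G H (inv x)"
    hence yc: "y \<in> carrier G" using assms by (auto simp: double_coset_def)
    have "inv y \<in> double_coset G H x" using subsetD[OF *[of "inv x"] imageI[OF y]] assms by simp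
    thus "y \<in> (\<lambda>y. inv y) ` double_coset G H x" by (rule image_eqI[rotated]) (simp add: yc)
  qed
  thus ?thesis using *[OF assms] by auto
qed

lemma hecke_star_in:
  assumes f: "f \<in> hecke_algebra G H" shows "hecke_star f \<in> hecke_algebra G H"
  unfolding hecke_algebra_def mem_Collect_eq
proof (intro conjI ballI allI impI)
  fix x h k assume x: "x \<in> carrier G" and hk: "h \<in> H" "k \<in> H"
  have "inv (h \<otimes> x \<otimes> k) = inv k \<otimes> inv x \<otimes> inv h"
    using x hk by (simp add: inv_mult_group m_assoc)
  thus "hecke_star f (h \<otimes> x \<otimes> k) = hecke_star f x"
    using hecke_biinvariant[OF f, of "inv x" "inv k" "inv h"] x hk subgroup.m_inv_closed[OF sub]
    by (simp add: hecke_star_def)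
next
  have "{double_coset G H x |x. x \<in> carrier G \<and> hecke_star f x \<noteq> 0} \<subseteq>
      (\<lambda>D. (\<lambda>y. inv y) ` D) ` {double_coset G H x | x. x \<in> carrier G \<and> f x \<noteq> 0}"
  proof clarify
    fix x assume x: "x \<in> carrier G" "hecke_star f x \<noteq> 0"
    hence "f (inv x) \<noteq> 0" by (auto simp: hecke_star_def)
    moreover have "double_coset G H x = (\<lambda>y. inv y) ` double_coset G H (inv x)"
      using double_coset_inv[of "inv x"] x by simp
    ultimately show "double_coset G H x \<in>
        (\<lambda>D. (\<lambda>y. inv y) ` D) ` {double_coset G H x | x. x \<in> carrier G \<and> f x \<noteq> 0}"
      by (intro image_eqI[of _ _ "double_coset G H (inv x)"] CollectI exI[of _ "inv x"]) (use x in auto)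
  qed
  thus "finite {double_coset G H x |x. x \<in> carrier G \<and> hecke_star f x \<noteq> 0}"
    by (rule finite_subset) (use f in \<open>simp add: hecke_algebra_def\<close>)
qed (auto simp: hecke_star_def)

text \<open>Inversion maps double cosets to double cosets, so this is
  \<open>finite_supp_cosets\<close> for \<open>hecke_star f\<close>. It controls the rows of the
  kernel, while \<open>finite_supp_cosets\<close> controls the columns.\<close>

lemma finite_supp_inv_cosets:
  assumes f: "f \<in> hecke_algebra G H"
  shows "finite ((\<lambda>x. H #> inv x) ` supp f)"
proof -
  have "(\<lambda>x. H #> inv x) ` supp f \<subseteq> (\<lambda>x. H #> x) ` supp (hecke_star f)"
  proof (rule image_subsetI)
    fix x assume "x \<in> supp f"
    hence "x \<in> carrier G" "f x \<noteq> 0" using hecke_supp[OF f] by auto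
    thus "H #> inv x \<in> (\<lambda>x. H #> x) ` supp (hecke_star f)"
      by (intro imageI) (simp add: hecke_star_def)
  qed
  thus ?thesis using finite_supp_cosets[OF hecke_star_in[OF f]] by (rule finite_subset)
qed

abbreviation "hecke_kernel f \<equiv> (\<lambda>C D. f (coset_rep C \<otimes> inv (coset_rep D)))"

lemma row_subset:
  assumes f: "f \<in> hecke_algebra G H" and x: "x \<in> carrier G"
  shows "{D\<in>RC. f (x \<otimes> inv (coset_rep D)) \<noteq> 0} \<subseteq> (\<lambda>C. C #> x) ` (\<lambda>x. H #> inv x) ` supp f"
proof
  fix D assume D: "D \<in> {D\<in>RC. f (x \<otimes> inv (coset_rep D)) \<noteq> 0}"
  define z where "z = x \<otimes> inv (coset_rep D)"
  have c: "coset_rep D \<in> carrier G" "z \<in> carrier G" using D x by (auto simp: z_def)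
  have "inv z \<otimes> x = coset_rep D"
    using c x by (simp add: z_def inv_mult_group m_assoc)
  hence "D = H #> inv z #> x"
    using D c x coset_mult_assoc[OF subgroup.subset[OF sub], of "inv z" x] by simp
  thus "D \<in> (\<lambda>C. C #> x) ` (\<lambda>x. H #> inv x) ` supp f"
    by (rule image_eqI, intro imageI) (use D in \<open>simp add: z_def\<close>)
qed

lemma col_subset:
  assumes f: "f \<in> hecke_algebra G H" and y: "y \<in> carrier G"
  shows "{C\<in>RC. f (coset_rep C \<otimes> inv y) \<noteq> 0} \<subseteq> (\<lambda>C. C #> y) ` (\<lambda>x. H #> x) ` supp f"
proof
  fix C assume C: "C \<in> {C\<in>RC. f (coset_rep C \<otimes> inv y) \<noteq> 0}"
  define z where "z = coset_rep C \<otimes> inv y"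
  have c: "coset_rep C \<in> carrier G" "z \<in> carrier G" using C y by (auto simp: z_def)
  have "z \<otimes> y = coset_rep C" using c y by (simp add: z_def m_assoc)
  hence "C = H #> z #> y"
    using C c y coset_mult_assoc[OF subgroup.subset[OF sub], of z y] by simp
  thus "C \<in> (\<lambda>C. C #> y) ` (\<lambda>x. H #> x) ` supp f"
    by (rule image_eqI, intro imageI) (use C in \<open>simp add: z_def\<close>)
qed

lemma finite_row:
  "f \<in> hecke_algebra G H \<Longrightarrow> x \<in> carrier G \<Longrightarrow> finite {D\<in>RC. f (x \<otimes> inv (coset_rep D)) \<noteq> 0}"
  by (rule finite_subset[OF row_subset]) (auto intro: finite_supp_inv_cosets)

lemma hecke_finite_kernel:
  assumes f: "f \<in> hecke_algebra G H"
  shows "\<exists>r B. finite_kernel RC (hecke_kernel f) r B"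
proof -
  define r where "r = max (card ((\<lambda>x. H #> inv x) ` supp f)) (card ((\<lambda>x. H #> x) ` supp f))"
  \<comment> \<open>By left invariance \<open>f\<close> has at most one nonzero value for each coset
    meeting its support; 0 stands for the entries outside the support and makes \<open>V\<close>
    nonempty.\<close>
  define V where "V = insert 0 ((\<lambda>C. cmod (f (coset_rep C))) ` (\<lambda>x. H #> x) ` supp f)"
  have V: "finite V" unfolding V_def using finite_supp_cosets[OF f] by auto
  show ?thesis
  proof (intro exI[of _ r] exI[of _ "Max V"], unfold_locales)
    fix C assume C: "C \<in> RC"
    show "finite {D \<in> RC. hecke_kernel f C D \<noteq> 0}" using finite_row[OF f] C by simp
    have "card {D \<in> RC. hecke_kernel f C D \<noteq> 0} \<le>
        card ((\<lambda>D. D #> coset_rep C) ` (\<lambda>x. H #> inv x) ` supp f)"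
      using C by (intro card_mono row_subset f finite_imageI finite_supp_inv_cosets) auto
    also have "\<dots> \<le> card ((\<lambda>x. H #> inv x) ` supp f)"
      by (intro card_image_le finite_supp_inv_cosets f)
    finally show "card {D \<in> RC. hecke_kernel f C D \<noteq> 0} \<le> r" by (simp add: r_def)
    show "finite {D \<in> RC. hecke_kernel f D C \<noteq> 0}"
      by (rule finite_subset[OF col_subset[OF f]]) (use C finite_supp_cosets[OF f] in auto)
    have "card {D \<in> RC. hecke_kernel f D C \<noteq> 0} \<le>
        card ((\<lambda>D. D #> coset_rep C) ` (\<lambda>x. H #> x) ` supp f)"
      using C by (intro card_mono col_subset f finite_imageI finite_supp_cosets) auto
    also have "\<dots> \<le> card ((\<lambda>x. H #> x) ` supp f)"
      by (intro card_image_le finite_supp_cosets f)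
    finally show "card {D \<in> RC. hecke_kernel f D C \<noteq> 0} \<le> r" by (simp add: r_def)
  next
    fix C D assume CD: "C \<in> RC" "D \<in> RC"
    define z where "z = coset_rep C \<otimes> inv (coset_rep D)"
    have "f z = f (coset_rep (H #> z))"
      using left_invariant_coset_rep[OF hecke_left_invariant[OF f]] CD by (simp add: z_def)
    hence "cmod (f z) \<in> V"
      by (cases "f z = 0") (auto simp: V_def intro!: image_eqI[of _ _ "H #> z"])
    thus "cmod (hecke_kernel f C D) \<le> Max V" using V by (simp add: z_def)
  qed
qed

lemma regular_rep_eq: "regular_rep G H (carrier G) f = kernel_op RC (hecke_kernel f)"
  by (simp add: regular_rep_def kernel_op_def)

lemma regular_rep_bounded:
  "f \<in> hecke_algebra G H \<Longrightarrow> regular_rep G H (carrier G) f \<in> bounded_ops RC"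
  unfolding regular_rep_eq using hecke_finite_kernel finite_kernel.kernel_op_bounded by fast

lemma regular_rep_adjoint:
  assumes f: "f \<in> hecke_algebra G H"
  shows "is_adjoint RC (regular_rep G H (carrier G) f) (regular_rep G H (carrier G) (hecke_star f))"
proof -
  obtain r B where "finite_kernel RC (hecke_kernel f) r B" using hecke_finite_kernel[OF f] by blast
  note finite_kernel.kernel_op_adjoint[OF this]
  moreover have "kernel_op RC (hecke_kernel (hecke_star f)) =
      kernel_op RC (\<lambda>C D. cnj (hecke_kernel f D C))"
    unfolding kernel_op_def
    by (intro restrict_ext ext if_cong refl infsum_cong)
      (simp add: hecke_star_def inv_mult_group)
  ultimately show ?thesis by (simp add: regular_rep_eq)
qed

text \<open>
  Rows are finite, so this makes sense for every \<open>F\<close>. It is needed below for eigenfunctions of right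
  translations, which are not square-summable.
\<close>

definition conv :: "('a \<Rightarrow> complex) \<Rightarrow> ('a \<Rightarrow> complex) \<Rightarrow> 'a \<Rightarrow> complex" where
  "conv f F x = (if x \<in> carrier G
     then \<Sum>\<^sub>\<infinity>D\<in>RC. f (x \<otimes> inv (coset_rep D)) * F (coset_rep D) else 0)"

lemma conv_summable:
  assumes "f \<in> hecke_algebra G H" "x \<in> carrier G"
  shows "(\<lambda>D. f (x \<otimes> inv (coset_rep D)) * F (coset_rep D)) summable_on RC"
  by (rule finite_nonzero_values_imp_summable_on, rule finite_subset[OF _ finite_row[OF assms]]) auto

lemma left_invariant_conv:
  assumes "f \<in> hecke_algebra G H" shows "left_invariant (conv f F)"
  using hecke_left_invariant[OF assms] unfolding left_invariant_def conv_def
  by (auto simp: m_assoc intro!: infsum_cong)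

lemma left_invariant_integrand:
  assumes f: "f \<in> hecke_algebra G H" and F: "left_invariant F" and x: "x \<in> carrier G"
  shows "left_invariant (\<lambda>y. f (x \<otimes> inv y) * F y)"
  unfolding left_invariant_def
proof (intro ballI)
  fix h y assume hy: "h \<in> H" "y \<in> carrier G"
  have "f (x \<otimes> inv (h \<otimes> y)) = f (x \<otimes> inv y \<otimes> inv h)"
    using hy x by (simp add: inv_mult_group m_assoc)
  also have "\<dots> = f (x \<otimes> inv y)"
    using hecke_right_invariant[OF f] hy x subgroup.m_inv_closed[OF sub] by simp
  finally show "f (x \<otimes> inv (h \<otimes> y)) * F (h \<otimes> y) = f (x \<otimes> inv y) * F y"
    using F hy by (simp add: left_invariant_def)
qed

text \<open>Left convolution commutes with right translations: when the summation over cosets is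
  translated by \<open>y\<close>, the two factors \<open>y\<close> in the argument of
  \<open>f\<close> cancel.\<close>

lemma conv_translate:
  assumes f: "f \<in> hecke_algebra G H" and F: "left_invariant F"
    and x: "x \<in> carrier G" and y: "y \<in> carrier G"
  shows "conv f (\<lambda>z. F (z \<otimes> y)) x = conv f F (x \<otimes> y)"
proof -
  have "conv f F (x \<otimes> y) =
      (\<Sum>\<^sub>\<infinity>D\<in>RC. f (x \<otimes> y \<otimes> inv (coset_rep D \<otimes> y)) * F (coset_rep D \<otimes> y))"
    using infsum_translate[OF left_invariant_integrand[OF f F, of "x \<otimes> y"] y] x y
    by (simp add: conv_def)
  also have "\<dots> = conv f (\<lambda>z. F (z \<otimes> y)) x"
    unfolding conv_def using x y by (auto intro!: infsum_cong simp: inv_mult_group m_assoc)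
  finally show ?thesis by simp
qed

text \<open>Rows are finite, so the double sum has finitely many nonzero terms and may be exchanged
  even for an \<open>F\<close> that is not square-summable. The inner sum then becomes
  \<open>conv f g\<close> by \<open>conv_translate\<close>.\<close>

lemma conv_conv:
  assumes f: "f \<in> hecke_algebra G H" and g: "g \<in> hecke_algebra G H" and F: "left_invariant F"
  shows "conv f (conv g F) = conv (conv f g) F"
proof
  fix x
  show "conv f (conv g F) x = conv (conv f g) F x"
  proof (cases "x \<in> carrier G")
    case x: True
    let ?t = "\<lambda>D E. f (x \<otimes> inv (coset_rep D)) *
      (g (coset_rep D \<otimes> inv (coset_rep E)) * F (coset_rep E))"
    let ?S = "SIGMA D:{D\<in>RC. f (x \<otimes> inv (coset_rep D)) \<noteq> 0}.
      {E\<in>RC. g (coset_rep D \<otimes> inv (coset_rep E)) \<noteq> 0}"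
    have "finite ?S" using finite_row[OF f x] finite_row[OF g] by (intro finite_SigmaI) auto
    hence "finite {p \<in> RC \<times> RC. (\<lambda>(D, E). ?t D E) p \<noteq> 0}" by (rule finite_subset[rotated]) auto
    hence sm: "(\<lambda>(D, E). ?t D E) summable_on RC \<times> RC"
      by (rule finite_nonzero_values_imp_summable_on)
    have "conv f (conv g F) x = (\<Sum>\<^sub>\<infinity>D\<in>RC. \<Sum>\<^sub>\<infinity>E\<in>RC. ?t D E)"
      using x by (auto simp: conv_def infsum_cmult_right' intro!: infsum_cong)
    also have "\<dots> = (\<Sum>\<^sub>\<infinity>E\<in>RC. \<Sum>\<^sub>\<infinity>D\<in>RC. ?t D E)"
      by (rule infsum_swap_banach[OF sm])
    also have "\<dots> = (\<Sum>\<^sub>\<infinity>E\<in>RC. conv f g (x \<otimes> inv (coset_rep E)) * F (coset_rep E))"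
    proof (rule infsum_cong)
      fix E assume E: "E \<in> RC"
      have "conv f g (x \<otimes> inv (coset_rep E)) = conv f (\<lambda>z. g (z \<otimes> inv (coset_rep E))) x"
        using conv_translate[OF f hecke_left_invariant[OF g] x] E by simp
      thus "(\<Sum>\<^sub>\<infinity>D\<in>RC. ?t D E) = conv f g (x \<otimes> inv (coset_rep E)) * F (coset_rep E)"
        using x by (simp add: conv_def infsum_cmult_left' flip: mult.assoc)
    qed
    finally show ?thesis using x by (simp add: conv_def[of "conv f g"])
  qed (simp add: conv_def)
qed

lemma conv_in:
  assumes f: "f \<in> hecke_algebra G H" and g: "g \<in> hecke_algebra G H"
  shows "conv f g \<in> hecke_algebra G H"
  unfolding hecke_algebra_def mem_Collect_eq
proof (intro conjI ballI allI impI)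
  fix x h k assume x: "x \<in> carrier G" and hk: "h \<in> H" "k \<in> H"
  have "conv f g (h \<otimes> x \<otimes> k) = conv f g (h \<otimes> (x \<otimes> k))" using x hk by (simp add: m_assoc)
  also have "\<dots> = conv f g (x \<otimes> k)"
    using left_invariant_conv[OF f] x hk by (simp add: left_invariant_def)
  also have "\<dots> = conv f (\<lambda>z. g (z \<otimes> k)) x"
    using conv_translate[OF f hecke_left_invariant[OF g] x] hk by simp
  also have "\<dots> = conv f g x"
    using hecke_right_invariant[OF g] hk by (auto simp: conv_def intro!: infsum_cong)
  finally show "conv f g (h \<otimes> x \<otimes> k) = conv f g x" .
next
  \<comment> \<open>A nonzero value of \<open>conv f g\<close> at \<open>x\<close> comes from a
    coset \<open>D\<close> in \<open>?B\<close> such that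
    \<open>z = x \<otimes> inv (coset_rep D)\<close> lies in the support of \<open>f\<close>; the
    cosets of \<open>z\<close> and \<open>D\<close> determine the double coset of
    \<open>x\<close>.\<close>
  let ?A = "(\<lambda>x. H #> x) ` supp f" and ?B = "(\<lambda>x. H #> x) ` supp g"
  have "{double_coset G H x |x. x \<in> carrier G \<and> conv f g x \<noteq> 0} \<subseteq>
      (\<lambda>(C, D). double_coset G H (coset_rep C \<otimes> coset_rep D)) ` (?A \<times> ?B)"
  proof clarify
    fix x assume x: "x \<in> carrier G" "conv f g x \<noteq> 0"
    have "\<exists>D\<in>RC. f (x \<otimes> inv (coset_rep D)) * g (coset_rep D) \<noteq> 0"
    proof (rule ccontr)
      assume "\<not> ?thesis"
      hence "conv f g x = 0" using x(1) by (simp add: conv_def infsum_0)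
      thus False using x(2) by simp
    qed
    then obtain D where D: "D \<in> RC" "f (x \<otimes> inv (coset_rep D)) * g (coset_rep D) \<noteq> 0" by blast
    define z where "z = x \<otimes> inv (coset_rep D)"
    have z: "z \<in> carrier G" using x D by (simp add: z_def)
    obtain h where h: "h \<in> H" "coset_rep (H #> z) = h \<otimes> z" using coset_rep_of_coset[OF z] by blast
    have "coset_rep (H #> z) \<otimes> coset_rep D = h \<otimes> x"
      using h x D by (simp add: z_def m_assoc)
    moreover have "double_coset G H (h \<otimes> x) = double_coset G H x"
    proof -
      have "{k \<otimes> (h \<otimes> x) \<otimes> l |k l. k \<in> H \<and> l \<in> H} = {k \<otimes> x \<otimes> l |k l. k \<in> H \<and> l \<in> H}"
      proof (intro equalityI subsetI; clarify)
        fix k l assume kl: "k \<in> H" "l \<in> H"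
        have "k \<otimes> (h \<otimes> x) \<otimes> l = (k \<otimes> h) \<otimes> x \<otimes> l" using kl h x by (simp add: m_assoc)
        thus "\<exists>k' l'. k \<otimes> (h \<otimes> x) \<otimes> l = k' \<otimes> x \<otimes> l' \<and> k' \<in> H \<and> l' \<in> H"
          using subgroup.m_closed[OF sub kl(1) h(1)] kl(2) by (intro exI conjI)
        have "k \<otimes> x \<otimes> l = (k \<otimes> inv h) \<otimes> (h \<otimes> x) \<otimes> l"
          using kl h x by (simp add: m_assoc)
        thus "\<exists>k' l'. k \<otimes> x \<otimes> l = k' \<otimes> (h \<otimes> x) \<otimes> l' \<and> k' \<in> H \<and> l' \<in> H"
          using subgroup.m_closed[OF sub kl(1) subgroup.m_inv_closed[OF sub h(1)]] kl(2)
          by (intro exI conjI)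
      qed
      thus ?thesis by (simp add: double_coset_def)
    qed
    moreover have "H #> z \<in> ?A" "D \<in> ?B"
      using D by (auto simp: z_def intro!: image_eqI[of D _ "coset_rep D"])
    ultimately show "double_coset G H x \<in>
        (\<lambda>(C, D). double_coset G H (coset_rep C \<otimes> coset_rep D)) ` (?A \<times> ?B)"
      by (intro image_eqI[of _ _ "(H #> z, D)"]) auto
  qed
  thus "finite {double_coset G H x |x. x \<in> carrier G \<and> conv f g x \<noteq> 0}"
    by (rule finite_subset) (use finite_supp_cosets f g in auto)
qed (simp add: conv_def)

section \<open>Left invariant functions as vectors, and the regular representation of the
  algebra\<close>

definition on_cosets :: "('a \<Rightarrow> complex) \<Rightarrow> 'a set \<Rightarrow> complex" where
  "on_cosets F C = (if C \<in> RC then F (coset_rep C) else 0)"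

lemma on_cosets_of_ell2:
  assumes "\<xi> \<in> ell2 RC"
  shows "on_cosets (\<lambda>x. \<xi> (H #> x)) = \<xi>" and "left_invariant (\<lambda>x. \<xi> (H #> x))"
  using assms by (auto simp: on_cosets_def ell2_eq_0 left_invariant_def coset_absorb fun_eq_iff)

lemma regular_rep_on_cosets:
  assumes "on_cosets F \<in> ell2 RC"
  shows "regular_rep G H (carrier G) f (on_cosets F) = on_cosets (conv f F)"
  using assms by (auto simp: regular_rep_def on_cosets_def conv_def fun_eq_iff intro!: infsum_cong)

lemma ell2_norm_on_cosets:
  "(ell2_norm RC (on_cosets F))\<^sup>2 = (\<Sum>\<^sub>\<infinity>C\<in>RC. (cmod (F (coset_rep C)))\<^sup>2)"
  unfolding ell2_norm_power2 by (rule infsum_cong) (simp add: on_cosets_def)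

lemma on_cosets_in_ell2:
  "on_cosets F \<in> ell2 RC \<longleftrightarrow> (\<lambda>C. (cmod (F (coset_rep C)))\<^sup>2) summable_on RC"
  unfolding ell2_def by (auto simp: on_cosets_def cong: summable_on_cong)

lemma on_cosets_translate:
  assumes "left_invariant F" "y \<in> carrier G"
  shows "on_cosets (\<lambda>x. F (x \<otimes> y)) \<in> ell2 RC \<longleftrightarrow> on_cosets F \<in> ell2 RC"
    and "ell2_norm RC (on_cosets (\<lambda>x. F (x \<otimes> y))) = ell2_norm RC (on_cosets F)"
proof -
  have F: "left_invariant (\<lambda>x. (cmod (F x))\<^sup>2)" using assms(1) by (simp add: left_invariant_def)
  show "on_cosets (\<lambda>x. F (x \<otimes> y)) \<in> ell2 RC \<longleftrightarrow> on_cosets F \<in> ell2 RC"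
    unfolding on_cosets_in_ell2 by (rule summable_translate[OF F assms(2)])
  have "(ell2_norm RC (on_cosets (\<lambda>x. F (x \<otimes> y))))\<^sup>2 = (ell2_norm RC (on_cosets F))\<^sup>2"
    unfolding ell2_norm_on_cosets by (rule infsum_translate[OF F assms(2)])
  thus "ell2_norm RC (on_cosets (\<lambda>x. F (x \<otimes> y))) = ell2_norm RC (on_cosets F)" by simp
qed

lemma hecke_add:
  assumes f: "f \<in> hecke_algebra G H" and g: "g \<in> hecke_algebra G H"
  shows "(\<lambda>x. f x + g x) \<in> hecke_algebra G H"
  unfolding hecke_algebra_def mem_Collect_eq
proof (intro conjI ballI allI impI)
  have "{double_coset G H x |x. x \<in> carrier G \<and> f x + g x \<noteq> 0} \<subseteq>
    {double_coset G H x |x. x \<in> carrier G \<and> f x \<noteq> 0} \<union> {double_coset G H x |x. x \<in> carrier G \<and> g x \<noteq> 0}"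
    by force
  thus "finite {double_coset G H x |x. x \<in> carrier G \<and> f x + g x \<noteq> 0}"
    by (rule finite_subset) (use f g in \<open>simp add: hecke_algebra_def\<close>)
qed (use f g in \<open>auto simp: hecke_algebra_def\<close>)

lemma hecke_scale:
  assumes f: "f \<in> hecke_algebra G H"
  shows "(\<lambda>x. c * f x) \<in> hecke_algebra G H"
  unfolding hecke_algebra_def mem_Collect_eq
proof (intro conjI ballI allI impI)
  have "{double_coset G H x |x. x \<in> carrier G \<and> c * f x \<noteq> 0} \<subseteq>
    {double_coset G H x |x. x \<in> carrier G \<and> f x \<noteq> 0}"
    by force
  thus "finite {double_coset G H x |x. x \<in> carrier G \<and> c * f x \<noteq> 0}"
    by (rule finite_subset) (use f in \<open>simp add: hecke_algebra_def\<close>)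
qed (use f in \<open>auto simp: hecke_algebra_def\<close>)

lemma conv_add:
  assumes f: "f \<in> hecke_algebra G H" and g: "g \<in> hecke_algebra G H"
  shows "conv (\<lambda>x. f x + g x) F = (\<lambda>x. conv f F x + conv g F x)"
  using infsum_add[OF conv_summable[OF f] conv_summable[OF g]]
  by (auto simp: conv_def distrib_right fun_eq_iff)

lemma conv_scale: "conv (\<lambda>x. c * f x) F = (\<lambda>x. c * conv f F x)"
  by (auto simp: conv_def fun_eq_iff mult.assoc infsum_cmult_right')

lemma conv_add_right:
  assumes f: "f \<in> hecke_algebra G H"
  shows "conv f (\<lambda>x. F x + F' x) = (\<lambda>x. conv f F x + conv f F' x)"
  using infsum_add[OF conv_summable[OF f] conv_summable[OF f]]
  by (auto simp: conv_def distrib_left fun_eq_iff)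

lemma conv_scale_right: "conv f (\<lambda>x. c * F x) = (\<lambda>x. c * conv f F x)"
  by (auto simp: conv_def fun_eq_iff mult.left_commute[of _ c] infsum_cmult_right')

lemma conv_0_right: "conv f (\<lambda>x. 0) = (\<lambda>x. 0)"
  by (auto simp: conv_def)

lemma conv_sum_right:
  assumes f: "f \<in> hecke_algebra G H"
  shows "conv f (\<lambda>x. \<Sum>a\<in>A. F a x) = (\<lambda>x. \<Sum>a\<in>A. conv f (F a) x)"
proof (induction A rule: infinite_finite_induct)
  case (insert a A)
  thus ?case using conv_add_right[OF f, of "F a"] by simp
qed (auto simp: conv_0_right)

lemma regular_rep_ell2:
  assumes "\<xi> \<in> ell2 RC"
  shows "regular_rep G H (carrier G) f \<xi> = on_cosets (conv f (\<lambda>x. \<xi> (H #> x)))"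
  using regular_rep_on_cosets[of "\<lambda>x. \<xi> (H #> x)" f] assms by (simp add: on_cosets_of_ell2(1))

lemma regular_rep_outside: "\<xi> \<notin> ell2 RC \<Longrightarrow> regular_rep G H (carrier G) f \<xi> = undefined"
  by (simp add: regular_rep_def)

lemma regular_rep_add:
  assumes "f \<in> hecke_algebra G H" "g \<in> hecke_algebra G H"
  shows "regular_rep G H (carrier G) (\<lambda>x. f x + g x) =
    op_add RC (regular_rep G H (carrier G) f) (regular_rep G H (carrier G) g)"
proof
  fix \<xi>
  show "regular_rep G H (carrier G) (\<lambda>x. f x + g x) \<xi> =
    op_add RC (regular_rep G H (carrier G) f) (regular_rep G H (carrier G) g) \<xi>"
    by (cases "\<xi> \<in> ell2 RC")
      (simp_all add: regular_rep_ell2 regular_rep_outside op_add_def conv_add[OF assms] on_cosets_def fun_eq_iff)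
qed

lemma regular_rep_scale:
  "regular_rep G H (carrier G) (\<lambda>x. c * f x) = op_scale RC c (regular_rep G H (carrier G) f)"
proof
  fix \<xi>
  show "regular_rep G H (carrier G) (\<lambda>x. c * f x) \<xi> =
    op_scale RC c (regular_rep G H (carrier G) f) \<xi>"
    by (cases "\<xi> \<in> ell2 RC")
      (simp_all add: regular_rep_ell2 regular_rep_outside op_scale_def conv_scale on_cosets_def fun_eq_iff)
qed

lemma regular_rep_conv:
  assumes f: "f \<in> hecke_algebra G H" and g: "g \<in> hecke_algebra G H"
  shows "regular_rep G H (carrier G) (conv f g) =
    compose (ell2 RC) (regular_rep G H (carrier G) f) (regular_rep G H (carrier G) g)"
proof
  fix \<xi>
  show "regular_rep G H (carrier G) (conv f g) \<xi> =
    compose (ell2 RC) (regular_rep G H (carrier G) f) (regular_rep G H (carrier G) g) \<xi>"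
  proof (cases "\<xi> \<in> ell2 RC")
    case True
    let ?F = "\<lambda>x. \<xi> (H #> x)"
    have eq: "regular_rep G H (carrier G) g \<xi> = on_cosets (conv g ?F)" by (rule regular_rep_ell2[OF True])
    have "on_cosets (conv g ?F) \<in> ell2 RC"
      using bounded_ops_ell2[OF regular_rep_bounded[OF g] True] eq by simp
    from regular_rep_on_cosets[OF this, of f] show ?thesis
      using True eq conv_conv[OF f g on_cosets_of_ell2(2)[OF True]]
      by (simp add: compose_def regular_rep_ell2)
  qed (simp add: compose_def regular_rep_outside)
qed

end

section \<open>Self-dual characters of the finite adeles\<close>

lemma padic_cauchy_abs_convergent:
  assumes p: "prime p" and X: "padic_cauchy p X"
  shows "convergent (\<lambda>n. padic_abs p (X n))"
proof (rule Cauchy_convergent, rule metric_CauchyI)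
  fix e :: real assume "e > 0"
  then obtain M where M: "\<And>m n. m \<ge> M \<Longrightarrow> n \<ge> M \<Longrightarrow> padic_abs p (X m - X n) < e"
    using X unfolding padic_cauchy_def by meson
  have "dist (padic_abs p (X m)) (padic_abs p (X n)) < e" if "m \<ge> M" "n \<ge> M" for m n
    using padic_abs_reverse_triangle[OF p, of "X m" "X n"] M[OF that] by (simp add: dist_real_def)
  thus "\<exists>M. \<forall>m\<ge>M. \<forall>n\<ge>M. dist (padic_abs p (X m)) (padic_abs p (X n)) < e" by blast
qed

lemma adele_seq_abs_limit:
  assumes "prime p" "adele_seq x"
  shows "(\<lambda>n. padic_abs p (x p n)) \<longlonglongrightarrow> lim (\<lambda>n. padic_abs p (x p n))"
  using padic_cauchy_abs_convergent[of p "x p"] assms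
  by (simp add: adele_seq_def convergent_LIMSEQ_iff)

lemma adele_rel_same: "adele_rel x x \<longleftrightarrow> adele_seq x"
  by (simp add: adele_rel_def)

lemma adele_abs_of_rat: "prime p \<Longrightarrow> adele_abs p (adele_of_rat q) = padic_abs p q"
  by transfer simp

lemma adele_abs_mult:
  assumes p: "prime p" shows "adele_abs p (x * y) = adele_abs p x * adele_abs p y"
proof (transfer fixing: p)
  fix x y assume "adele_rel x x" "adele_rel y y"
  hence "(\<lambda>n. padic_abs p (x p n) * padic_abs p (y p n)) \<longlonglongrightarrow>
      lim (\<lambda>n. padic_abs p (x p n)) * lim (\<lambda>n. padic_abs p (y p n))"
    by (intro tendsto_mult adele_seq_abs_limit p) (auto simp: adele_rel_same)
  thus "(if prime p then lim (\<lambda>n. padic_abs p (x p n * y p n)) else 0) =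
     (if prime p then lim (\<lambda>n. padic_abs p (x p n)) else 0) *
     (if prime p then lim (\<lambda>n. padic_abs p (y p n)) else 0)"
    using p by (simp add: padic_abs_mult limI)
qed

lemma adele_abs_add:
  assumes p: "prime p" shows "adele_abs p (x + y) \<le> max (adele_abs p x) (adele_abs p y)"
proof (transfer fixing: p)
  fix x y assume "adele_rel x x" "adele_rel y y"
  hence xy: "adele_seq x" "adele_seq y" by (auto simp: adele_rel_same)
  have "lim (\<lambda>n. padic_abs p (x p n + y p n)) \<le>
      max (lim (\<lambda>n. padic_abs p (x p n))) (lim (\<lambda>n. padic_abs p (y p n)))"
  proof (rule LIMSEQ_le)
    show "(\<lambda>n. padic_abs p (x p n + y p n)) \<longlonglongrightarrow> lim (\<lambda>n. padic_abs p (x p n + y p n))"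
      using adele_seq_abs_limit[OF p adele_seq_add[OF xy]] by simp
    show "(\<lambda>n. max (padic_abs p (x p n)) (padic_abs p (y p n))) \<longlonglongrightarrow>
        max (lim (\<lambda>n. padic_abs p (x p n))) (lim (\<lambda>n. padic_abs p (y p n)))"
      by (intro tendsto_max adele_seq_abs_limit p xy)
    show "\<exists>N. \<forall>n\<ge>N. padic_abs p (x p n + y p n) \<le> max (padic_abs p (x p n)) (padic_abs p (y p n))"
      using padic_abs_add[OF p] by blast
  qed
  thus "(if prime p then lim (\<lambda>n. padic_abs p (x p n + y p n)) else 0) \<le>
     max (if prime p then lim (\<lambda>n. padic_abs p (x p n)) else 0)
      (if prime p then lim (\<lambda>n. padic_abs p (y p n)) else 0)"
    using p by simp
qed

lemma adele_of_rat_add: "adele_of_rat (x + y) = adele_of_rat x + adele_of_rat y"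
  by transfer (simp add: adele_rel_same adele_seq_const)

lemma adele_of_rat_mult: "adele_of_rat (x * y) = adele_of_rat x * adele_of_rat y"
  by transfer (simp add: adele_rel_same adele_seq_const)

lemma adele_of_rat_0: "adele_of_rat 0 = 0"
  by transfer (simp add: adele_rel_same adele_seq_const)

lemma adele_of_rat_1: "adele_of_rat 1 = 1"
  by transfer (simp add: adele_rel_same adele_seq_const)

lemma adele_of_rat_minus: "adele_of_rat (- x) = - adele_of_rat x"
  by transfer (simp add: adele_rel_same adele_seq_const)

lemma adele_rational_approx:
  assumes p: "prime p" and e: "e > 0"
  shows "\<exists>q. adele_abs p (x + adele_of_rat q) \<le> e"
proof (transfer fixing: p e)
  fix x assume "adele_rel x x"
  hence x: "adele_seq x" by (simp add: adele_rel_same)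
  then obtain M where M: "\<And>m n. m \<ge> M \<Longrightarrow> n \<ge> M \<Longrightarrow> padic_abs p (x p m - x p n) < e"
    using e p unfolding adele_seq_def padic_cauchy_def by meson
  define q where "q = - x p M"
  have "lim (\<lambda>n. padic_abs p (x p n + q)) \<le> e"
  proof (rule LIMSEQ_le_const2)
    show "(\<lambda>n. padic_abs p (x p n + q)) \<longlonglongrightarrow> lim (\<lambda>n. padic_abs p (x p n + q))"
      using adele_seq_abs_limit[OF p adele_seq_add[OF x adele_seq_const]] by simp
    show "\<exists>N. \<forall>n\<ge>N. padic_abs p (x p n + q) \<le> e"
      using M[OF _ order_refl] by (intro exI[of _ M]) (auto simp: q_def intro: less_imp_le)
  qed
  thus "\<exists>q. (if prime p then lim (\<lambda>n. padic_abs p (x p n + q)) else 0) \<le> e"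
    using p by auto
qed

section \<open>Integral elements, from the rationals to \<open>Zhat\<close>\<close>

lemma padic_abs_of_int_self:
  assumes "prime p" shows "padic_abs p (of_int (int p)) = 1 / real p"
proof -
  have "multiplicity (int p) (int p) = 1" using assms by simp
  thus ?thesis using padic_abs_fraction[OF assms, of "int p" 1] assms
    by (auto simp: power_int_minus inverse_eq_divide prime_gt_0_nat)
qed

lemma padic_abs_of_int_other:
  assumes "prime p" "\<not> int p dvd a" shows "padic_abs p (of_int a) = 1"
proof -
  have "a \<noteq> 0" using assms by auto
  thus ?thesis
    using padic_abs_fraction[OF assms(1), of a 1] assms(2) by (simp add: not_dvd_imp_multiplicity_0)
qed

lemma padic_abs_one: "prime p \<Longrightarrow> padic_abs p 1 = 1"
  using padic_abs_of_int_other[of p 1] prime_gt_1_nat[of p] by fastforce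

lemma padic_abs_inverse:
  assumes "prime p" "q \<noteq> 0" shows "padic_abs p (1 / q) = 1 / padic_abs p q"
  using padic_abs_mult[OF assms(1), of q "1 / q"] padic_abs_one[OF assms(1)] assms(2)
  by (simp add: inverse_unique[symmetric] flip: inverse_eq_divide)

lemma padic_abs_denominator:
  assumes p: "prime p" and cd: "quotient_of q = (a, b)" and le: "padic_abs p q \<le> 1"
  shows "\<not> int p dvd b"
proof
  assume b: "int p dvd b"
  have cop: "coprime a b" and b0: "b > 0"
    using quotient_of_coprime[OF cd] quotient_of_denom_pos[OF cd] by auto
  have "\<not> is_unit (int p)" using p by (metis not_prime_unit prime_nat_int_transfer)
  hence a: "\<not> int p dvd a" using coprime_common_divisor[OF cop _ b] by blast
  have q: "q = of_int a * (1 / of_int b)" using quotient_of_div[OF cd] by simp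
  obtain c where c: "b = int p * c" using b by blast
  have p1: "real p > 1" using p prime_gt_1_nat by simp
  have "padic_abs p (of_int b) = 1 / real p * padic_abs p (of_int c)"
    unfolding c of_int_mult padic_abs_mult[OF p] padic_abs_of_int_self[OF p] by simp
  also have "\<dots> \<le> 1 / real p" using padic_abs_le_1_of_int[OF p, of c] p1 by (simp add: field_simps)
  also have "\<dots> < 1" using p1 by simp
  finally have lt: "padic_abs p (of_int b) < 1" .
  have "padic_abs p (of_int b) * padic_abs p q = padic_abs p (of_int a)"
    using b0 by (simp add: q flip: padic_abs_mult[OF p])
  hence "padic_abs p (of_int b) * padic_abs p q = 1" by (simp add: padic_abs_of_int_other[OF p a])
  moreover have "padic_abs p (of_int b) * padic_abs p q \<le> padic_abs p (of_int b) * 1"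
    using le by (intro mult_left_mono) auto
  ultimately show False using lt by simp
qed

lemma integer_if_padic_integers:
  assumes "\<And>p. prime p \<Longrightarrow> padic_abs p q \<le> 1" shows "q \<in> \<int>"
proof -
  obtain a b where cd: "quotient_of q = (a, b)" by force
  have b0: "b > 0" using quotient_of_denom_pos[OF cd] .
  have "nat b = 1"
  proof (rule ccontr)
    assume "nat b \<noteq> 1"
    then obtain p where p: "prime p" "p dvd nat b" using prime_factor_nat by blast
    hence "int p dvd b" using b0 by (metis int_dvd_int_iff int_nat_eq less_imp_le)
    thus False using padic_abs_denominator[OF p(1) cd assms[OF p(1)]] by simp
  qed
  hence "b = 1" using b0 by simp
  thus ?thesis using quotient_of_div[OF cd] by simp
qed

text \<open>Write \<open>q = a / b\<close>. Since \<open>p\<close> does not divide \<open>b\<close>,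
  Bezout gives an inverse \<open>v\<close> of \<open>b\<close> modulo \<open>p\<close>, and
  \<open>q - a v = a (1 - v b) / b\<close> is then divisible by \<open>p\<close>.\<close>

lemma padic_integer_residue:
  assumes p: "prime p" and le: "padic_abs p q \<le> 1"
  shows "\<exists>n. padic_abs p (q + of_int n) \<le> 1 / real p"
proof -
  obtain a b where cd: "quotient_of q = (a, b)" by force
  have b0: "b > 0" using quotient_of_denom_pos[OF cd] .
  have nb: "\<not> int p dvd b" by (rule padic_abs_denominator[OF p cd le])
  hence "coprime (int p) b" using p by (simp add: prime_imp_coprime)
  then obtain u v where uv: "u * int p + v * b = 1" using bezout_int[of "int p" b] by auto
  have eq: "q + of_int (- (a * v)) = of_int (int p) * (of_int (u * a) * (1 / of_int b))"
  proof -
    have "of_int b * (q + of_int (- (a * v))) = of_int (a * (1 - v * b))"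
      using b0 quotient_of_div[OF cd] by (simp add: algebra_simps)
    also have "a * (1 - v * b) = int p * (u * a)" by (simp add: algebra_simps flip: uv)
    finally show ?thesis using b0 by (simp add: field_simps)
  qed
  have "padic_abs p (1 / of_int b) = 1"
    using padic_abs_inverse[OF p, of "of_int b"] b0 padic_abs_of_int_other[OF p nb] by simp
  hence "padic_abs p (q + of_int (- (a * v))) = 1 / real p * padic_abs p (of_int (u * a))"
    unfolding eq padic_abs_mult[OF p] padic_abs_of_int_self[OF p] by simp
  also have "\<dots> \<le> 1 / real p * 1" by (intro mult_left_mono padic_abs_le_1_of_int p) auto
  finally have "padic_abs p (q + of_int (- (a * v))) \<le> 1 / real p" by simp
  thus ?thesis by (rule exI)
qed

lemma Zhat_add: "x \<in> Zhat \<Longrightarrow> y \<in> Zhat \<Longrightarrow> x + y \<in> Zhat"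
  unfolding Zhat_def by (auto intro: order_trans[OF adele_abs_add])

lemma adele_abs_nonneg: "prime p \<Longrightarrow> adele_abs p x \<ge> 0"
proof (transfer)
  fix p x assume "prime (p::nat)" "adele_rel x x"
  thus "0 \<le> (if prime p then lim (\<lambda>n. padic_abs p (x p n)) else 0)"
    using LIMSEQ_le_const[OF adele_seq_abs_limit[of p x], of 0] by (auto simp: adele_rel_same)
qed

lemma Zhat_mult: "x \<in> Zhat \<Longrightarrow> y \<in> Zhat \<Longrightarrow> x * y \<in> Zhat"
  unfolding Zhat_def by (simp add: adele_abs_mult mult_le_one adele_abs_nonneg)

lemma Zhat_of_rat: "adele_of_rat q \<in> Zhat \<longleftrightarrow> q \<in> \<int>"
  unfolding Zhat_def using integer_if_padic_integers padic_abs_le_1_of_int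
  by (auto simp: adele_abs_of_rat elim!: Ints_cases)

text \<open>The integer \<open>n\<close> is chosen by looking at the component at \<open>p\<close>
  alone, approximated by a rational. Dividing the remainder by \<open>p\<close> does no harm at the
  other primes, where \<open>p\<close> is a unit.\<close>

lemma Zhat_residue:
  assumes p: "prime p" and x: "x \<in> Zhat"
  shows "\<exists>n. \<exists>z\<in>Zhat. x = adele_of_rat (of_int n) + adele_of_rat (of_int (int p)) * z"
proof -
  have p0: "real p > 0" using p prime_gt_0_nat by simp
  obtain q where q: "adele_abs p (x + adele_of_rat q) \<le> 1 / real p"
    using adele_rational_approx[OF p, of "1 / real p" x] p0 by auto
  have eq: "adele_of_rat q = (x + adele_of_rat q) + adele_of_rat (-1) * x"
    by (simp add: adele_of_rat_minus adele_of_rat_1)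
  have "adele_abs p (adele_of_rat q) \<le>
      max (adele_abs p (x + adele_of_rat q)) (adele_abs p (adele_of_rat (-1) * x))"
    by (subst eq) (rule adele_abs_add[OF p])
  also have "\<dots> \<le> max (1 / real p) (adele_abs p (adele_of_rat (-1)) * adele_abs p x)"
    by (rule max.mono[OF q]) (simp add: adele_abs_mult[OF p])
  also have "\<dots> \<le> 1"
    using p x prime_ge_1_nat[OF p] padic_abs_minus[OF p, of 1]
    by (auto simp: adele_abs_of_rat padic_abs_one Zhat_def)
  finally have "padic_abs p q \<le> 1" using p by (simp add: adele_abs_of_rat)
  then obtain n where "padic_abs p (q + of_int n) \<le> 1 / real p"
    using padic_integer_residue[OF p] by blast
  hence n: "padic_abs p (of_int (-n) + - q) \<le> 1 / real p"
    using padic_abs_minus[OF p, of "q + of_int n"] by (simp add: algebra_simps)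
  define y where "y = x + adele_of_rat (of_int (-n))"
  have "adele_of_rat (of_int (-n)) = adele_of_rat q + adele_of_rat (of_int (-n) + - q)"
    by (subst adele_of_rat_add[symmetric]) simp
  hence "y = (x + adele_of_rat q) + adele_of_rat (of_int (-n) + - q)"
    by (simp add: y_def add.assoc)
  hence "adele_abs p y \<le> max (1 / real p) (1 / real p)"
    using adele_abs_add[OF p, of "x + adele_of_rat q" "adele_of_rat (of_int (-n) + - q)"] q n
    by (simp add: adele_abs_of_rat[OF p])
  hence y: "adele_abs p y \<le> 1 / real p" by simp
  define z where "z = adele_of_rat (1 / of_int (int p)) * y"
  have "adele_abs r z \<le> 1" if r: "prime r" for r
  proof (cases "r = p")
    case True
    have "adele_abs p z = real p * adele_abs p y"
      using p padic_abs_inverse[OF p, of "of_int (int p)"] padic_abs_of_int_self[OF p]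
      by (simp add: z_def adele_abs_mult adele_abs_of_rat)
    also have "\<dots> \<le> real p * (1 / real p)" using y by (intro mult_left_mono) auto
    finally show ?thesis using True p0 by simp
  next
    case False
    have "\<not> int r dvd int p" using False p r primes_dvd_imp_eq by auto
    hence "adele_abs r z = adele_abs r y"
      using padic_abs_inverse[OF r, of "of_int (int p)"] padic_abs_of_int_other[OF r, of "int p"] p
      by (simp add: z_def adele_abs_mult[OF r] adele_abs_of_rat[OF r])
    moreover have "y \<in> Zhat" unfolding y_def by (intro Zhat_add x) (simp add: Zhat_of_rat)
    ultimately show ?thesis using r by (simp add: Zhat_def)
  qed
  hence "z \<in> Zhat" by (simp add: Zhat_def)
  moreover have "adele_of_rat (of_int (int p)) * z = y"
    using p by (auto simp: z_def adele_of_rat_1 simp flip: mult.assoc adele_of_rat_mult)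
  hence "x = adele_of_rat (of_int n) + adele_of_rat (of_int (int p)) * z"
    by (simp add: y_def adele_of_rat_minus)
  ultimately show ?thesis by blast
qed

text \<open>\<open>\<int>\<close> is dense in \<open>Zhat\<close>: the moduli \<open>d\<close> for which this holds are closed under products.\<close>

lemma Zhat_approx:
  fixes d :: nat
  assumes "d > 0" "x \<in> Zhat"
  shows "\<exists>n. \<exists>z\<in>Zhat. x = adele_of_rat (of_int n) + adele_of_rat (of_int (int d)) * z"
  using assms
proof (induction d arbitrary: x rule: prime_divisors_induct)
  case (unit d)
  hence "x = adele_of_rat (of_int 0) + adele_of_rat (of_int (int d)) * x"
    by (simp add: adele_of_rat_0 adele_of_rat_1)
  thus ?case using unit by blast
next
  case (factor p d)
  obtain n z where n: "z \<in> Zhat" "x = adele_of_rat (of_int n) + adele_of_rat (of_int (int d)) * z"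
    using factor.IH[of x] factor.prems by auto
  obtain m y where m: "y \<in> Zhat" "z = adele_of_rat (of_int m) + adele_of_rat (of_int (int p)) * y"
    using Zhat_residue[OF factor.hyps(1) n(1)] by blast
  have "x = adele_of_rat (of_int (n + int d * m)) + adele_of_rat (of_int (int (p * d))) * y"
    unfolding n(2) m(2) by (simp add: adele_of_rat_add adele_of_rat_mult algebra_simps)
  thus ?case using m(1) by blast
qed simp

locale self_dual =
  fixes chi :: "finite_adele \<Rightarrow> complex"
  assumes self_dual: "self_dual_character chi"
begin

lemma chi_add: "chi (x + y) = chi x * chi y" and cmod_chi: "cmod (chi x) = 1"
  using self_dual by (auto simp: self_dual_character_def adele_characters_def)

lemma chi_Zhat: assumes "x \<in> Zhat" shows "chi x = 1"
proof -
  have "1 \<in> Zhat" using Zhat_of_rat[of 1] by (simp add: adele_of_rat_1)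
  hence "(\<lambda>z. chi (z * 1)) \<in> Zhat_annihilator"
    using self_dual unfolding self_dual_character_def by blast
  thus ?thesis using assms by (simp add: Zhat_annihilator_def)
qed

text \<open>The character \<open>\<lambda>z. chi (z * x)\<close> annihilates \<open>Zhat\<close>,
  hence it also comes from some \<open>y\<close> in \<open>Zhat\<close>; injectivity of the
  self-duality map gives \<open>x = y\<close>.\<close>

lemma Zhat_if_chi_trivial:
  assumes x: "\<And>z. z \<in> Zhat \<Longrightarrow> chi (z * x) = 1"
  shows "x \<in> Zhat"
proof -
  let ?F = "\<lambda>y x. chi (x * y)"
  have hom: "homeomorphic_map euclidean adele_dual_topology ?F"
    and im: "?F ` Zhat = Zhat_annihilator"
    using self_dual by (auto simp: self_dual_character_def)
  have "?F x \<in> topspace adele_dual_topology"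
    using homeomorphic_imp_surjective_map[OF hom] by auto
  hence "?F x \<in> adele_characters" by (simp add: adele_dual_topology_def)
  hence "?F x \<in> Zhat_annihilator" using x by (simp add: Zhat_annihilator_def)
  then obtain y where y: "y \<in> Zhat" "?F x = ?F y" using im by blast
  have "inj ?F" using homeomorphic_imp_injective_map[OF hom] by simp
  thus ?thesis using y injD by metis
qed

end

section \<open>Two by two matrices over the rationals and the adeles\<close>

lemma trace_2: "trace (A :: 'a::semiring_1^2^2) = A $ 1 $ 1 + A $ 2 $ 2"
  by (simp add: trace_def sum_2)

lemma matrix_mult_2:
  "((A :: 'a::semiring_1^2^2) ** B) $ i $ j = A $ i $ 1 * B $ 1 $ j + A $ i $ 2 * B $ 2 $ j"
  by (simp add: matrix_matrix_mult_def sum_2)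

lemma map_matrix_nth: "map_matrix f A $ i $ j = f (A $ i $ j)"
  by (simp add: map_matrix_def)

lemma map_matrix_adele_mult:
  "map_matrix adele_of_rat (A ** B :: rat_mat) =
    map_matrix adele_of_rat (A :: rat_mat) ** map_matrix adele_of_rat (B :: rat_mat)"
  by (simp add: vec_eq_iff matrix_mult_2 adele_of_rat_add adele_of_rat_mult map_matrix_nth)

lemma common_denominator:
  fixes a :: rat_mat
  shows "\<exists>d::nat. d > 0 \<and> (\<forall>i j. of_nat d * a $ i $ j \<in> \<int>)"
proof -
  have "\<exists>d::nat. d > 0 \<and> of_nat d * q \<in> \<int>" for q :: rat
  proof -
    obtain c d where cd: "quotient_of q = (c, d)" by force
    have "of_nat (nat d) * q = of_int c"
      using quotient_of_div[OF cd] quotient_of_denom_pos[OF cd] by simp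
    thus ?thesis using quotient_of_denom_pos[OF cd] by (intro exI[of _ "nat d"]) simp
  qed
  then obtain D where D: "\<And>q. D q > (0::nat)" "\<And>q::rat. of_nat (D q) * q \<in> \<int>" by metis
  define d where "d = D (a$1$1) * D (a$1$2) * D (a$2$1) * D (a$2$2)"
  have "of_nat d * a $ i $ j \<in> \<int>" for i j
  proof -
    have "D (a $ i $ j) dvd d" using exhaust_2[of i] exhaust_2[of j] by (auto simp: d_def)
    then obtain k where k: "d = D (a $ i $ j) * k" by (rule dvdE)
    have "of_nat d * a $ i $ j = of_nat k * (of_nat (D (a $ i $ j)) * a $ i $ j)"
      by (simp add: k)
    also have "\<dots> \<in> \<int>" by (intro Ints_mult D) auto
    finally show ?thesis .
  qed
  moreover have "d > 0" using D by (simp add: d_def)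
  ultimately show ?thesis by blast
qed

text \<open>The hypothesis tests integer matrices, whereas \<open>Zhat_if_chi_trivial\<close> asks
  for all of \<open>Zhat\<close>. Density bridges the gap: in \<open>y = k + d y'\<close> the part
  \<open>d y'\<close> contributes 1 because \<open>d z\<close> is integral, and \<open>k\<close> is
  tested by the matrix whose single entry \<open>k\<close> sits at the transposed position, so that
  the trace isolates the entry of \<open>z\<close>.\<close>

lemma (in self_dual) Zhat_matrix_if_chi_trivial:
  fixes z :: "finite_adele^2^2"
  assumes d: "d > (0::nat)" and dz: "\<And>i j. adele_of_rat (of_int (int d)) * z $ i $ j \<in> Zhat"
    and triv: "\<And>n. n \<in> Mat2Z \<Longrightarrow> chi (trace (map_matrix adele_of_rat n ** z)) = 1"
  shows "z $ i $ j \<in> Zhat"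
proof (rule Zhat_if_chi_trivial)
  fix y assume "y \<in> Zhat"
  then obtain k y' where y: "y' \<in> Zhat"
    "y = adele_of_rat (of_int k) + adele_of_rat (of_int (int d)) * y'"
    using Zhat_approx[OF d] by blast
  define n :: rat_mat where "n = (\<chi> a b. if a = j \<and> b = i then of_int k else 0)"
  have "trace (map_matrix adele_of_rat n ** z) = adele_of_rat (of_int k) * z $ i $ j"
    using exhaust_2[of i] exhaust_2[of j]
    by (auto simp: trace_2 matrix_mult_2 n_def adele_of_rat_0 map_matrix_nth)
  moreover have "n \<in> Mat2Z" by (simp add: n_def Mat2Z_def)
  ultimately have "chi (adele_of_rat (of_int k) * z $ i $ j) = 1" using triv by metis
  moreover have "chi ((adele_of_rat (of_int (int d)) * z $ i $ j) * y') = 1"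
    by (intro chi_Zhat Zhat_mult dz y)
  ultimately show "chi (y * z $ i $ j) = 1"
    unfolding y(2) distrib_right chi_add by (simp add: mult_ac)
qed

section \<open>The pairing on rational matrices\<close>

text \<open>What the later arguments use of \<open>char_twist chi w\<close>. \<open>left_int\<close>
  forces the support of eigenfunctions into the integer matrices, and \<open>right_int\<close> gives
  the orthogonality of characters in \<open>ee_orthogonal\<close>.\<close>

locale matrix_pairing =
  fixes psi :: "rat_mat \<Rightarrow> complex"
  assumes psi_add: "psi (u + v) = psi u * psi v"
    and cmod_psi: "cmod (psi u) = 1"
    and psi_int: "u \<in> Mat2Z \<Longrightarrow> psi u = 1"
    and left_int: "(\<And>u. u \<in> Mat2Z \<Longrightarrow> psi (u ** a) = 1) \<Longrightarrow> a \<in> Mat2Z"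
    and right_int: "(\<And>u. u \<in> Mat2Z \<Longrightarrow> psi (a ** u) = 1) \<Longrightarrow> a \<in> Mat2Z"

text \<open>Both nondegeneracy statements reduce to \<open>Zhat_matrix_if_chi_trivial\<close>,
  applied to \<open>a w\<close> on the left and, after cyclic permutation inside the trace, to
  \<open>w a\<close> on the right. The integral inverse of \<open>w\<close> then removes
  \<open>w\<close>, and a rational number in \<open>Zhat\<close> is an integer.\<close>

lemma matrix_pairing_char_twist:
  assumes "self_dual_character chi" "w \<in> GL2Zhat"
  shows "matrix_pairing (char_twist chi w)"
proof -
  interpret self_dual chi by unfold_locales fact
  let ?M = "map_matrix adele_of_rat :: rat_mat \<Rightarrow> finite_adele^2^2"
  obtain v where w: "\<And>i j. w $ i $ j \<in> Zhat" and v: "\<And>i j. v $ i $ j \<in> Zhat"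
    and wv: "w ** v = mat 1" "v ** w = mat 1"
    using assms(2) by (auto simp: GL2Zhat_def)
  have M_Zhat: "?M u $ i $ j \<in> Zhat \<longleftrightarrow> u $ i $ j \<in> \<int>" for u i j
    by (simp add: map_matrix_nth Zhat_of_rat)
  have mult_Zhat: "(A ** B) $ i $ j \<in> Zhat"
    if "\<And>i j. A $ i $ j \<in> Zhat" "\<And>i j. B $ i $ j \<in> Zhat" for A B :: "finite_adele^2^2" and i j
    unfolding matrix_mult_2 by (intro Zhat_add Zhat_mult that)
  have scaled_Zhat: "adele_of_rat (of_int (int d)) * ?M a $ i $ j \<in> Zhat"
    if "\<And>i j. of_nat d * a $ i $ j \<in> \<int>" for d a i j
    using that by (simp add: map_matrix_nth Zhat_of_rat flip: adele_of_rat_mult)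
  show ?thesis
  proof
    fix u v :: rat_mat
    show "char_twist chi w (u + v) = char_twist chi w u * char_twist chi w v"
      by (simp add: char_twist_def trace_2 matrix_mult_2 map_matrix_nth adele_of_rat_add
          distrib_right distrib_left chi_add mult.assoc mult.left_commute)
  next
    fix u :: rat_mat
    show "cmod (char_twist chi w u) = 1" by (simp add: char_twist_def cmod_chi)
  next
    fix u :: rat_mat assume u: "u \<in> Mat2Z"
    have "(?M u ** w) $ i $ j \<in> Zhat" for i j
      by (rule mult_Zhat) (use u w in \<open>auto simp: map_matrix_nth Zhat_of_rat Mat2Z_def\<close>)
    thus "char_twist chi w u = 1"
      by (simp add: char_twist_def trace_2 chi_Zhat Zhat_add)
  next
    fix a :: rat_mat assume a: "\<And>u. u \<in> Mat2Z \<Longrightarrow> char_twist chi w (u ** a) = 1"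
    obtain d :: nat where d: "d > 0" "\<And>i j. of_nat d * a $ i $ j \<in> \<int>"
      using common_denominator by blast
    have Maw: "(?M a ** w) $ i $ j \<in> Zhat" for i j
    proof (rule Zhat_matrix_if_chi_trivial[OF d(1)])
      fix i j
      have "adele_of_rat (of_int (int d)) * (?M a ** w) $ i $ j =
          (adele_of_rat (of_int (int d)) * ?M a $ i $ 1) * w $ 1 $ j +
          (adele_of_rat (of_int (int d)) * ?M a $ i $ 2) * w $ 2 $ j"
        by (simp add: matrix_mult_2 algebra_simps)
      also have "\<dots> \<in> Zhat" by (intro Zhat_add Zhat_mult scaled_Zhat d w)
      finally show "adele_of_rat (of_int (int d)) * (?M a ** w) $ i $ j \<in> Zhat" .
    next
      fix n :: rat_mat assume "n \<in> Mat2Z"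
      from a[OF this] show "chi (trace (?M n ** (?M a ** w))) = 1"
        by (simp add: char_twist_def map_matrix_adele_mult matrix_mul_assoc)
    qed
    have "((?M a ** w) ** v) $ i $ j \<in> Zhat" for i j by (rule mult_Zhat[OF Maw v])
    hence "?M a $ i $ j \<in> Zhat" for i j by (simp add: wv flip: matrix_mul_assoc)
    thus "a \<in> Mat2Z" by (simp add: map_matrix_nth Zhat_of_rat Mat2Z_def)
  next
    fix a :: rat_mat assume a: "\<And>u. u \<in> Mat2Z \<Longrightarrow> char_twist chi w (a ** u) = 1"
    obtain d :: nat where d: "d > 0" "\<And>i j. of_nat d * a $ i $ j \<in> \<int>"
      using common_denominator by blast
    have wMa: "(w ** ?M a) $ i $ j \<in> Zhat" for i j
    proof (rule Zhat_matrix_if_chi_trivial[OF d(1)])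
      fix i j
      have "adele_of_rat (of_int (int d)) * (w ** ?M a) $ i $ j =
          w $ i $ 1 * (adele_of_rat (of_int (int d)) * ?M a $ 1 $ j) +
          w $ i $ 2 * (adele_of_rat (of_int (int d)) * ?M a $ 2 $ j)"
        by (simp add: matrix_mult_2 algebra_simps)
      also have "\<dots> \<in> Zhat" by (intro Zhat_add Zhat_mult scaled_Zhat d w)
      finally show "adele_of_rat (of_int (int d)) * (w ** ?M a) $ i $ j \<in> Zhat" .
    next
      fix n :: rat_mat assume n: "n \<in> Mat2Z"
      have "trace (?M n ** (w ** ?M a)) = trace (?M a ** ?M n ** w)"
        using trace_mul_sym[of "?M n ** w" "?M a"] by (simp add: matrix_mul_assoc)
      thus "chi (trace (?M n ** (w ** ?M a))) = 1"
        using a[OF n] by (simp add: char_twist_def map_matrix_adele_mult)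
    qed
    have "(v ** (w ** ?M a)) $ i $ j \<in> Zhat" for i j by (rule mult_Zhat[OF v wMa])
    hence "?M a $ i $ j \<in> Zhat" for i j by (simp add: wv matrix_mul_assoc)
    thus "a \<in> Mat2Z" by (simp add: map_matrix_nth Zhat_of_rat Mat2Z_def)
  qed
qed

section \<open>Rational matrices and lattices\<close>

text \<open>One family for two kinds of lattices: \<open>lat (of_nat N)\<close> is
  \<open>N^-1 Mat_2(Z)\<close>, and \<open>lat (1 / of_nat N)\<close> is \<open>N Mat_2(Z)\<close>,
  that is, congruence to 0 modulo \<open>N\<close>.\<close>

definition lat :: "rat \<Rightarrow> rat_mat set" where
  "lat c = {m. \<forall>i j. c * m $ i $ j \<in> \<int>}"

lemma lat_1: "lat 1 = Mat2Z"
  by (simp add: lat_def Mat2Z_def)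

lemma lat_add: "m \<in> lat c \<Longrightarrow> n \<in> lat c \<Longrightarrow> m + n \<in> lat c"
  by (simp add: lat_def distrib_left)

lemma lat_minus: "m \<in> lat c \<Longrightarrow> - m \<in> lat c"
  by (simp add: lat_def)

lemma lat_diff: "m \<in> lat c \<Longrightarrow> n \<in> lat c \<Longrightarrow> m - n \<in> lat c"
  by (simp add: lat_def right_diff_distrib)

lemma lat_0 [simp]: "0 \<in> lat c"
  by (simp add: lat_def)

lemma lat_Ints_mult: "m \<in> lat c \<Longrightarrow> k \<in> \<int> \<Longrightarrow> m \<in> lat (k * c)"
  by (simp add: lat_def mult.assoc)

lemma lat_dvd:
  assumes "m \<in> lat (of_nat c)" "c dvd d" shows "m \<in> lat (of_nat d)"
proof -
  obtain k where k: "d = c * k" using assms(2) by (rule dvdE)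
  have "m \<in> lat (of_nat k * of_nat c)" by (rule lat_Ints_mult[OF assms(1)]) simp
  thus ?thesis by (simp add: k mult.commute)
qed

lemma lat_mult:
  assumes "m \<in> lat c" "n \<in> lat d" shows "m ** n \<in> lat (c * d)"
proof -
  have "c * d * (m ** n) $ i $ j = (c * m $ i $ 1) * (d * n $ 1 $ j) + (c * m $ i $ 2) * (d * n $ 2 $ j)"
    for i j by (simp add: matrix_mult_2 algebra_simps)
  moreover have "(c * m $ i $ 1) * (d * n $ 1 $ j) + (c * m $ i $ 2) * (d * n $ 2 $ j) \<in> \<int>" for i j
    by (rule Ints_add[OF Ints_mult Ints_mult]) (use assms in \<open>auto simp: lat_def\<close>)
  ultimately show ?thesis unfolding lat_def by auto
qed

lemma lat_exists: "\<exists>d::nat. d > 0 \<and> m \<in> lat (of_nat d)"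
  using common_denominator[of m] by (simp add: lat_def)

lemma lat_mult_int: "m \<in> lat c \<Longrightarrow> n \<in> Mat2Z \<Longrightarrow> m ** n \<in> lat c"
  using lat_mult[of m c n 1] by (simp add: lat_1)

lemma lat_int_mult: "m \<in> Mat2Z \<Longrightarrow> n \<in> lat c \<Longrightarrow> m ** n \<in> lat c"
  using lat_mult[of m 1 n c] by (simp add: lat_1)

lemma Mat2Z_mult: "m \<in> Mat2Z \<Longrightarrow> n \<in> Mat2Z \<Longrightarrow> m ** n \<in> Mat2Z"
  using lat_mult[of m 1 n 1] by (simp add: lat_1)

lemmas Mat2Z_add = lat_add[of _ 1, unfolded lat_1]
  and Mat2Z_minus = lat_minus[of _ 1, unfolded lat_1]
  and Mat2Z_diff = lat_diff[of _ 1, unfolded lat_1]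
  and Mat2Z_0 = lat_0[of 1, unfolded lat_1]

lemma Mat2Z_mat_1: "mat 1 \<in> Mat2Z"
  by (simp add: Mat2Z_def mat_def)

definition smat :: "rat \<Rightarrow> rat_mat \<Rightarrow> rat_mat" where
  "smat c m = (\<chi> i j. c * m $ i $ j)"

lemma smat_nth [simp]: "smat c m $ i $ j = c * m $ i $ j"
  by (simp add: smat_def)

lemma smat_mult_left: "smat c m ** n = smat c (m ** n)"
  by (simp add: vec_eq_iff matrix_mult_2 algebra_simps)

lemma smat_mult_right: "m ** smat c n = smat c (m ** n)"
  by (simp add: vec_eq_iff matrix_mult_2 algebra_simps)

lemma smat_smat: "smat c (smat d m) = smat (c * d) m"
  by (simp add: vec_eq_iff)

lemma smat_1 [simp]: "smat 1 m = m"
  by (simp add: vec_eq_iff)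

lemma smat_in_lat: "smat c m \<in> lat d \<longleftrightarrow> m \<in> lat (c * d)"
  by (simp add: lat_def mult_ac)

lemma smat_in_Mat2Z: "smat c m \<in> Mat2Z \<longleftrightarrow> m \<in> lat c"
  by (simp add: lat_def Mat2Z_def)

lemma det_smat: "det (smat c m) = c\<^sup>2 * det m"
  by (simp add: det_2 power2_eq_square algebra_simps)

lemma matrix_add_rdistrib_2: "((A::rat_mat) + B) ** C = A ** C + B ** C"
  by (simp add: vec_eq_iff matrix_mult_2 algebra_simps)

lemma matrix_minus_mult: "(- (A::rat_mat)) ** C = - (A ** C)"
  by (simp add: vec_eq_iff matrix_mult_2 algebra_simps)

lemma matrix_diff_mult: "((A::rat_mat) - B) ** C = A ** C - B ** C"
  by (simp add: vec_eq_iff matrix_mult_2 algebra_simps)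

lemma matrix_mult_diff: "(A::rat_mat) ** (B - C) = A ** B - A ** C"
  by (simp add: vec_eq_iff matrix_mult_2 algebra_simps)

lemma matrix_mult_zero [simp]: "(0::rat_mat) ** A = 0" "A ** (0::rat_mat) = 0"
  by (simp_all add: vec_eq_iff matrix_mult_2)

text \<open>The adjugate. It is integral together with \<open>m\<close>, so inverses of elements of
  \<open>SL2Z\<close> are integral.\<close>

definition adj2 :: "rat_mat \<Rightarrow> rat_mat" where
  "adj2 m = (\<chi> i j. if i = j then (if i = 1 then m $ 2 $ 2 else m $ 1 $ 1) else - m $ i $ j)"

lemma matrix_inv_unique:
  assumes "(A::rat_mat) ** B = mat 1" "B ** A = mat 1"
  shows "matrix_inv A = B"
proof -
  have "A ** matrix_inv A = mat 1 \<and> matrix_inv A ** A = mat 1"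
    unfolding matrix_inv_def by (rule someI[of _ B]) (use assms in simp)
  hence "matrix_inv A = (B ** A) ** matrix_inv A" "A ** matrix_inv A = mat 1" using assms by auto
  thus ?thesis by (simp flip: matrix_mul_assoc)
qed

lemma
  fixes A :: rat_mat
  assumes "det A \<noteq> 0"
  shows matrix_inv_right: "A ** matrix_inv A = mat 1"
    and matrix_inv_left: "matrix_inv A ** A = mat 1"
    and matrix_inv_adj2: "matrix_inv A = smat (1 / det A) (adj2 A)"
proof -
  let ?B = "smat (1 / det A) (adj2 A)"
  have d: "A $ 1 $ 1 * A $ 2 $ 2 - A $ 1 $ 2 * A $ 2 $ 1 \<noteq> 0" using assms by (simp add: det_2)
  have "A ** adj2 A = smat (det A) (mat 1)" "adj2 A ** A = smat (det A) (mat 1)"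
    by (simp_all add: vec_eq_iff forall_2 matrix_mult_2 adj2_def mat_def det_2 algebra_simps)
  hence 1: "A ** ?B = mat 1" "?B ** A = mat 1"
    using assms by (simp_all add: smat_mult_left smat_mult_right smat_smat)
  show "matrix_inv A = ?B" by (rule matrix_inv_unique[OF 1])
  thus "A ** matrix_inv A = mat 1" "matrix_inv A ** A = mat 1" using 1 by simp_all
qed

lemma adj2_in_Mat2Z: "m \<in> Mat2Z \<Longrightarrow> adj2 m \<in> Mat2Z"
  by (auto simp: Mat2Z_def adj2_def)

lemma matrix_inv_in_lat:
  assumes "m \<in> Mat2Z" "det m \<noteq> 0" shows "matrix_inv m \<in> lat (det m)"
  using adj2_in_Mat2Z[OF assms(1)] assms(2)
  by (simp add: matrix_inv_adj2 smat_in_lat lat_1)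

lemma det_matrix_inv: "det (A::rat_mat) \<noteq> 0 \<Longrightarrow> det (matrix_inv A) = 1 / det A"
  using det_mul[of A "matrix_inv A"] matrix_inv_right[of A] by (simp add: field_simps)

lemma matrix_cancel:
  assumes "det (A::rat_mat) \<noteq> 0"
  shows "A ** (matrix_inv A ** B) = B" "matrix_inv A ** (A ** B) = B"
    "(B ** matrix_inv A) ** A = B" "(B ** A) ** matrix_inv A = B"
  using matrix_inv_right[OF assms] matrix_inv_left[OF assms]
  by (simp_all add: matrix_mul_assoc) (simp_all flip: matrix_mul_assoc)

lemma matrix_inv_mult:
  assumes "det (A::rat_mat) \<noteq> 0" "det (B::rat_mat) \<noteq> 0"
  shows "matrix_inv (A ** B) = matrix_inv B ** matrix_inv A"
proof (rule matrix_inv_unique)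
  show "A ** B ** (matrix_inv B ** matrix_inv A) = mat 1"
    using assms by (simp add: matrix_inv_right matrix_cancel flip: matrix_mul_assoc)
  show "matrix_inv B ** matrix_inv A ** (A ** B) = mat 1"
    using assms by (simp add: matrix_inv_left matrix_cancel flip: matrix_mul_assoc)
qed

lemma matrix_inv_inv: "det (A::rat_mat) \<noteq> 0 \<Longrightarrow> matrix_inv (matrix_inv A) = A"
  by (rule matrix_inv_unique) (simp_all add: matrix_inv_left matrix_inv_right)

lemma matrix_inv_mat_1 [simp]: "matrix_inv (mat 1 :: rat_mat) = mat 1"
  by (rule matrix_inv_unique) simp_all

section \<open>The group of integer matrices of determinant 1\<close>

lemma SL2Z_int: "g \<in> SL2Z \<Longrightarrow> g \<in> Mat2Z" and SL2Z_det: "g \<in> SL2Z \<Longrightarrow> det g = 1"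
  by (simp_all add: SL2Z_def)

lemma SL2Z_mult: "g \<in> SL2Z \<Longrightarrow> h \<in> SL2Z \<Longrightarrow> g ** h \<in> SL2Z"
  by (simp add: SL2Z_def Mat2Z_mult det_mul)

lemma SL2Z_inv: "g \<in> SL2Z \<Longrightarrow> matrix_inv g \<in> SL2Z"
  using matrix_inv_in_lat[of g] by (simp add: SL2Z_def det_matrix_inv lat_1)

lemma SL2Z_mat_1: "mat 1 \<in> SL2Z"
  by (simp add: SL2Z_def Mat2Z_mat_1)

lemma SL2Z_cancel:
  assumes g: "g \<in> SL2Z"
  shows "g ** m \<in> Mat2Z \<longleftrightarrow> m \<in> Mat2Z" and "m ** g \<in> Mat2Z \<longleftrightarrow> m \<in> Mat2Z"
proof -
  have d: "det g \<noteq> 0" using SL2Z_det[OF g] by simp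
  note ints = SL2Z_int[OF g] SL2Z_int[OF SL2Z_inv[OF g]]
  show "g ** m \<in> Mat2Z \<longleftrightarrow> m \<in> Mat2Z"
    using Mat2Z_mult[OF ints(2), of "g ** m"] Mat2Z_mult[OF ints(1), of m]
    by (auto simp: matrix_cancel(2)[OF d])
  show "m ** g \<in> Mat2Z \<longleftrightarrow> m \<in> Mat2Z"
    using Mat2Z_mult[OF _ ints(2), of "m ** g"] Mat2Z_mult[OF _ ints(1), of m]
    by (auto simp: matrix_cancel(4)[OF d])
qed

section \<open>The index of the lattice generated by an integer matrix\<close>

text \<open>
  The number of classes \<open>m \<in> Mat\<^sub>2(\<rat>) / Mat\<^sub>2(\<int>)\<close> with \<open>m k\<close> integral does not change when \<open>k\<close> is
  multiplied on the right by \<open>SL\<^sub>2(\<int>)\<close>, so \<open>k\<close> may be taken upper triangular, and then the rows of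
  \<open>m\<close> can be enumerated.
\<close>

definition zclass :: "rat_mat \<Rightarrow> rat_mat set" where
  "zclass m = {n. m - n \<in> Mat2Z}"

lemma Mat2Q_mod_Mat2Z_eq: "Mat2Q_mod_Mat2Z = range zclass"
  by (auto simp: Mat2Q_mod_Mat2Z_def quotient_def zclass_def)

lemma zclass_eq_iff: "zclass m = zclass n \<longleftrightarrow> m - n \<in> Mat2Z"
proof
  assume "zclass m = zclass n"
  moreover have "n \<in> zclass n" by (simp add: zclass_def Mat2Z_0)
  ultimately show "m - n \<in> Mat2Z" by (auto simp: zclass_def)
next
  assume mn: "m - n \<in> Mat2Z"
  have "m - k \<in> Mat2Z \<longleftrightarrow> n - k \<in> Mat2Z" for k
    using Mat2Z_diff[OF _ mn, of "m - k"] Mat2Z_add[OF _ mn, of "n - k"] by auto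
  thus "zclass m = zclass n" by (auto simp: zclass_def)
qed

lemma zclass_rep: "m - coset_rep (zclass m) \<in> Mat2Z"
proof -
  have "m \<in> zclass m" by (simp add: zclass_def Mat2Z_0)
  hence "coset_rep (zclass m) \<in> zclass m" unfolding coset_rep_def by (rule someI)
  thus ?thesis by (simp add: zclass_def)
qed

lemma zclass_rep': "coset_rep (zclass m) - m \<in> Mat2Z"
  using Mat2Z_minus[OF zclass_rep[of m]] by simp

lemma zclass_of_rep: "M \<in> Mat2Q_mod_Mat2Z \<Longrightarrow> zclass (coset_rep M) = M"
  unfolding Mat2Q_mod_Mat2Z_eq using zclass_eq_iff zclass_rep' by blast

text \<open>The hypotheses say that the row \<open>(x, y)\<close> times the triangular matrix with
  rows \<open>(a, b)\<close> and \<open>(0, d)\<close> is integral. The first column determines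
  \<open>x\<close> modulo 1 as \<open>i / a\<close>, and the second then determines \<open>y\<close>
  modulo 1 through \<open>j\<close>.\<close>

lemma fractional_row_exists:
  fixes a b d :: int and x y :: rat
  assumes "a > 0" "d > 0" "x * of_int a \<in> \<int>" "x * of_int b + y * of_int d \<in> \<int>"
  shows "\<exists>i\<in>{0..<a}. \<exists>j\<in>{0..<d}. x - of_int i / of_int a \<in> \<int> \<and>
    y - (of_int j - of_int i * of_int b / of_int a) / of_int d \<in> \<int>"
proof -
  obtain i0 where i0: "x * of_int a = of_int i0" using assms(3) by (elim Ints_cases)
  obtain j0 where j0: "x * of_int b + y * of_int d = of_int j0" using assms(4) by (elim Ints_cases)
  define i q where "i = i0 mod a" and "q = i0 div a"
  \<comment> \<open>Replacing \<open>x\<close> by \<open>i / a\<close> lowers \<open>x b\<close> by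
    the integer \<open>q b\<close>, which \<open>j1\<close> takes into account.\<close>
  define j1 where "j1 = j0 - b * q"
  define j where "j = j1 mod d"
  have i0': "i0 = a * q + i" by (simp add: i_def q_def)
  have j1': "j1 = d * (j1 div d) + j" by (simp add: j_def)
  have x: "x = of_int q + of_int i / of_int a"
    using i0 assms(1) unfolding i0' by (simp add: field_simps)
  have "y * of_int d = of_int j1 - of_int b * (of_int i / of_int a)"
    using j0 unfolding x by (simp add: j1_def algebra_simps)
  also have "\<dots> = of_int d * of_int (j1 div d) + (of_int j - of_int i * of_int b / of_int a)"
    by (subst j1') (simp add: mult.commute)
  finally have y: "y = of_int (j1 div d) + (of_int j - of_int i * of_int b / of_int a) / of_int d"
    using assms(2) by (simp add: field_simps)
  show ?thesis
    using assms(1,2) by (intro bexI[of _ i] bexI[of _ j]) (auto simp: x y, auto simp: i_def j_def)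
qed

lemma fraction_diff_Ints:
  fixes i j a :: int
  assumes "i \<in> {0..<a}" "j \<in> {0..<a}" "(of_int i / of_int a - of_int j / of_int a :: rat) \<in> \<int>"
  shows "i = j"
proof -
  obtain k where "(of_int i / of_int a - of_int j / of_int a :: rat) = of_int k"
    using assms(3) by (elim Ints_cases)
  hence "(of_int i - of_int j :: rat) = of_int (k * a)" using assms(1) by (simp add: field_simps)
  hence "i - j = k * a" by (metis of_int_diff of_int_eq_iff)
  hence "a dvd i - j" by simp
  thus ?thesis using assms(1,2) by (simp add: mod_eq_dvd_iff[symmetric])
qed

lemma card_zclass_triangular:
  fixes h :: rat_mat
  assumes h: "h $ 1 $ 1 = of_int a" "h $ 1 $ 2 = of_int b" "h $ 2 $ 1 = 0" "h $ 2 $ 2 = of_int d"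
    and ad: "a > 0" "d > 0"
  shows "card {M\<in>Mat2Q_mod_Mat2Z. coset_rep M ** h \<in> Mat2Z} = nat ((a * d)\<^sup>2)"
    and "finite {M\<in>Mat2Q_mod_Mat2Z. coset_rep M ** h \<in> Mat2Z}"
proof -
  define r1 where "r1 = (\<lambda>i::int. of_int i / of_int a :: rat)"
  define r2 where "r2 = (\<lambda>i j::int. (of_int j - of_int i * of_int b / of_int a) / of_int d :: rat)"
  \<comment> \<open>Each of the two rows is one of the representatives from
    \<open>fractional_row_exists\<close>, with \<open>a d\<close> choices per row.\<close>
  define m where "m = (\<lambda>(i, j, i', j'). \<chi> r c. if r = (1::2) then (if c = (1::2) then r1 i else r2 i j)
    else (if c = 1 then r1 i' else r2 i' j'))"
  let ?B = "{0..<a} \<times> {0..<d} \<times> {0..<a} \<times> {0..<d}"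
  have h_int: "h \<in> Mat2Z" by (simp add: Mat2Z_def forall_2 h)
  have row_iff: "n ** h \<in> Mat2Z \<longleftrightarrow> (\<forall>r. n $ r $ 1 * of_int a \<in> \<int> \<and>
      n $ r $ 1 * of_int b + n $ r $ 2 * of_int d \<in> \<int>)" for n
    unfolding Mat2Z_def by (simp add: forall_2 matrix_mult_2 h)
  have r_int: "r1 i * of_int a \<in> \<int>" "r1 i * of_int b + r2 i j * of_int d \<in> \<int>" for i j
    using ad by (simp_all add: r1_def r2_def)
  have m_int: "m p ** h \<in> Mat2Z" for p
    by (cases p) (simp add: row_iff m_def forall_2 r_int)
  have rep: "coset_rep (zclass n) ** h \<in> Mat2Z \<longleftrightarrow> n ** h \<in> Mat2Z" for n
  proof -
    have "(coset_rep (zclass n) - n) ** h \<in> Mat2Z" by (rule Mat2Z_mult[OF zclass_rep' h_int])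
    hence *: "coset_rep (zclass n) ** h - n ** h \<in> Mat2Z" by (simp add: matrix_diff_mult)
    show ?thesis
      using Mat2Z_add[OF *, of "n ** h"] Mat2Z_diff[OF _ *, of "coset_rep (zclass n) ** h"] by auto
  qed
  have "bij_betw (\<lambda>p. zclass (m p)) ?B {M\<in>Mat2Q_mod_Mat2Z. coset_rep M ** h \<in> Mat2Z}"
  proof (rule bij_betw_imageI)
    show "inj_on (\<lambda>p. zclass (m p)) ?B"
    proof (rule inj_onI)
      fix p p' assume p: "p \<in> ?B" "p' \<in> ?B" "zclass (m p) = zclass (m p')"
      obtain i j i' j' where p1: "p = (i, j, i', j')" by (cases p)
      obtain k l k' l' where p2: "p' = (k, l, k', l')" by (cases p')
      have d: "r1 i - r1 k \<in> \<int>" "r2 i j - r2 k l \<in> \<int>" "r1 i' - r1 k' \<in> \<int>" "r2 i' j' - r2 k' l' \<in> \<int>"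
        using p(3) unfolding zclass_eq_iff p1 p2 by (auto simp: Mat2Z_def m_def forall_2)
      have ik: "i = k" "i' = k'"
        using d(1,3) p(1,2) fraction_diff_Ints unfolding p1 p2 r1_def by auto
      have "(of_int j / of_int d - of_int l / of_int d :: rat) \<in> \<int>"
        "(of_int j' / of_int d - of_int l' / of_int d :: rat) \<in> \<int>"
        using d(2,4) by (simp_all add: r2_def ik diff_divide_distrib)
      hence "j = l" "j' = l'" using p(1,2) fraction_diff_Ints unfolding p1 p2 by auto
      thus "p = p'" using ik by (simp add: p1 p2)
    qed
    show "(\<lambda>p. zclass (m p)) ` ?B = {M\<in>Mat2Q_mod_Mat2Z. coset_rep M ** h \<in> Mat2Z}"
    proof (intro equalityI subsetI)
      fix M assume "M \<in> (\<lambda>p. zclass (m p)) ` ?B"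
      thus "M \<in> {M\<in>Mat2Q_mod_Mat2Z. coset_rep M ** h \<in> Mat2Z}"
        using rep m_int by (auto simp: Mat2Q_mod_Mat2Z_eq)
    next
      fix M assume M: "M \<in> {M\<in>Mat2Q_mod_Mat2Z. coset_rep M ** h \<in> Mat2Z}"
      define n where "n = coset_rep M"
      have n: "n ** h \<in> Mat2Z" "M = zclass n" using M by (auto simp: n_def zclass_of_rep)
      obtain i j where ij: "i \<in> {0..<a}" "j \<in> {0..<d}" "n $ 1 $ 1 - r1 i \<in> \<int>" "n $ 1 $ 2 - r2 i j \<in> \<int>"
        using fractional_row_exists[OF ad, of "n $ 1 $ 1" b "n $ 1 $ 2"] n(1)
        unfolding row_iff r1_def r2_def by blast
      obtain i' j' where ij': "i' \<in> {0..<a}" "j' \<in> {0..<d}" "n $ 2 $ 1 - r1 i' \<in> \<int>" "n $ 2 $ 2 - r2 i' j' \<in> \<int>"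
        using fractional_row_exists[OF ad, of "n $ 2 $ 1" b "n $ 2 $ 2"] n(1)
        unfolding row_iff r1_def r2_def by blast
      have "n - m (i, j, i', j') \<in> Mat2Z"
        using ij ij' by (simp add: Mat2Z_def m_def forall_2)
      hence "M = zclass (m (i, j, i', j'))" by (simp add: n(2) zclass_eq_iff)
      thus "M \<in> (\<lambda>p. zclass (m p)) ` ?B" using ij ij' by (intro image_eqI) auto
    qed
  qed
  note bij = this
  have "card {M\<in>Mat2Q_mod_Mat2Z. coset_rep M ** h \<in> Mat2Z} = card ?B"
    using bij_betw_same_card[OF bij] by simp
  also have "\<dots> = nat a * (nat d * (nat a * nat d))" by (simp add: card_cartesian_product)
  also have "\<dots> = nat ((a * d)\<^sup>2)" using ad by (simp add: power2_eq_square nat_mult_distrib)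
  finally show "card {M\<in>Mat2Q_mod_Mat2Z. coset_rep M ** h \<in> Mat2Z} = nat ((a * d)\<^sup>2)" .
  show "finite {M\<in>Mat2Q_mod_Mat2Z. coset_rep M ** h \<in> Mat2Z}"
    using bij_betw_finite[OF bij] by simp
qed

text \<open>With \<open>d = gcd p q\<close> for the bottom row \<open>(p, q)\<close>, the columns of
  \<open>g\<close> are \<open>(q / d, - p / d)\<close>, which is orthogonal to the bottom row, and
  the Bezout coefficients \<open>(u, v)\<close>. The Bezout identity is also
  \<open>det g = 1\<close>.\<close>

lemma triangular_form:
  assumes k: "k \<in> Mat2Z" "det k > 0"
  shows "\<exists>g\<in>SL2Z. \<exists>a b d. (k ** g) $ 1 $ 1 = of_int a \<and> (k ** g) $ 1 $ 2 = of_int b \<and>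
    (k ** g) $ 2 $ 1 = 0 \<and> (k ** g) $ 2 $ 2 = of_int d \<and> a > 0 \<and> d > 0"
proof -
  have "k $ 2 $ 1 \<in> \<int>" "k $ 2 $ 2 \<in> \<int>" using k(1) by (simp_all add: Mat2Z_def)
  then obtain p q where pq: "k $ 2 $ 1 = of_int p" "k $ 2 $ 2 = of_int q"
    by (elim Ints_cases)
  have pq0: "p \<noteq> 0 \<or> q \<noteq> 0" using k(2) by (auto simp: det_2 pq)
  define d where "d = gcd p q"
  have d: "d > 0" using pq0 by (simp add: d_def)
  obtain u v where uv: "u * p + v * q = d" using bezout_int[of p q] by (auto simp: d_def)
  have "d dvd p" "d dvd q" by (simp_all add: d_def)
  then obtain p' q' where p': "p = d * p'" and q': "q = d * q'" by (elim dvdE)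
  have "d * (u * p' + v * q') = d * 1" using uv by (simp add: p' q' algebra_simps)
  hence one: "u * p' + v * q' = 1" using d by simp
  define g :: rat_mat where "g = (\<chi> i j. if i = 1 then (if j = 1 then of_int q' else of_int u)
    else (if j = 1 then - of_int p' else of_int v))"
  have detg: "det g = 1"
  proof -
    have "det g = of_int (u * p' + v * q')" by (simp add: det_2 g_def algebra_simps)
    thus ?thesis by (simp add: one)
  qed
  have g: "g \<in> SL2Z" using detg by (auto simp: SL2Z_def Mat2Z_def g_def)
  have kg: "k ** g \<in> Mat2Z" by (rule Mat2Z_mult[OF k(1) SL2Z_int[OF g]])
  have "(k ** g) $ 1 $ 1 \<in> \<int>" "(k ** g) $ 1 $ 2 \<in> \<int>" using kg by (simp_all add: Mat2Z_def)
  then obtain a b where ab: "(k ** g) $ 1 $ 1 = of_int a" "(k ** g) $ 1 $ 2 = of_int b"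
    by (elim Ints_cases)
  have k21: "(k ** g) $ 2 $ 1 = 0" by (simp add: matrix_mult_2 pq g_def p' q')
  have "(k ** g) $ 2 $ 2 = of_int (u * p + v * q)" by (simp add: matrix_mult_2 pq g_def)
  hence k22: "(k ** g) $ 2 $ 2 = of_int d" by (simp add: uv)
  have "det (k ** g) = of_int a * of_int d" by (simp add: det_2 ab k21 k22)
  hence "(of_int a * of_int d :: rat) > 0" using k(2) detg by (simp add: det_mul)
  hence "a > 0" using d by (simp add: zero_less_mult_iff)
  thus ?thesis using g ab k21 k22 d by blast
qed

lemma card_zclass_mult_int:
  assumes k: "k \<in> Mat2Z" "det k > 0"
  shows "finite {M\<in>Mat2Q_mod_Mat2Z. coset_rep M ** k \<in> Mat2Z}"
    and "of_nat (card {M\<in>Mat2Q_mod_Mat2Z. coset_rep M ** k \<in> Mat2Z}) = (det k)\<^sup>2"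
proof -
  obtain g a b d where g: "g \<in> SL2Z" and h: "(k ** g) $ 1 $ 1 = of_int a" "(k ** g) $ 1 $ 2 = of_int b"
    "(k ** g) $ 2 $ 1 = 0" "(k ** g) $ 2 $ 2 = of_int d" "a > 0" "d > 0"
    using triangular_form[OF k] by blast
  have eq: "{M\<in>Mat2Q_mod_Mat2Z. coset_rep M ** k \<in> Mat2Z} =
      {M\<in>Mat2Q_mod_Mat2Z. coset_rep M ** (k ** g) \<in> Mat2Z}"
    by (simp add: matrix_mul_assoc SL2Z_cancel[OF g])
  note card = card_zclass_triangular[OF h]
  show "finite {M\<in>Mat2Q_mod_Mat2Z. coset_rep M ** k \<in> Mat2Z}" unfolding eq by (rule card(2))
  have "det k = det (k ** g)" using SL2Z_det[OF g] by (simp add: det_mul)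
  also have "\<dots> = of_int (a * d)" by (simp add: det_2 h)
  finally have "(det k)\<^sup>2 = of_int ((a * d)\<^sup>2)" by simp
  thus "of_nat (card {M\<in>Mat2Q_mod_Mat2Z. coset_rep M ** k \<in> Mat2Z}) = (det k)\<^sup>2"
    unfolding eq card(1) by simp
qed

section \<open>The groups and their cosets\<close>

abbreviation Pmult (infixl "\<cdot>" 70) where "x \<cdot> y \<equiv> x \<otimes>\<^bsub>P_group\<^esub> y"
abbreviation Pinv where "Pinv x \<equiv> inv\<^bsub>P_group\<^esub> x"
abbreviation Pcoset :: "rat_mat \<times> rat_mat \<Rightarrow> (rat_mat \<times> rat_mat) set" where
  "Pcoset x \<equiv> P0 #>\<^bsub>P_group\<^esub> x"
abbreviation "HP \<equiv> hecke_algebra P_group P0"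
abbreviation "P_regular \<equiv> regular_rep P_group P0 (carrier P_group)"
abbreviation "norm_S \<equiv> ell2_norm Gamma_mod_S"

lemma GL2Qpos_simps [simp]:
  "carrier GL2Qpos = {g. det g > 0}" "g \<otimes>\<^bsub>GL2Qpos\<^esub> h = g ** h" "\<one>\<^bsub>GL2Qpos\<^esub> = mat 1"
  by (simp_all add: GL2Qpos_def)

lemma P_group_simps [simp]:
  "carrier P_group = UNIV \<times> {g. det g > 0}"
  "(m, g) \<cdot> (n, h) = (m + n ** matrix_inv g, g ** h)"
  "\<one>\<^bsub>P_group\<^esub> = (0, mat 1)"
  by (simp_all add: P_group_def alpha_def)

lemma group_GL2Qpos: "group GL2Qpos"
proof (rule groupI)
  fix g :: rat_mat assume g: "g \<in> carrier GL2Qpos"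
  thus "\<exists>h\<in>carrier GL2Qpos. h \<otimes>\<^bsub>GL2Qpos\<^esub> g = \<one>\<^bsub>GL2Qpos\<^esub>"
    by (intro bexI[of _ "matrix_inv g"]) (auto simp: matrix_inv_left det_matrix_inv)
qed (auto simp: det_mul matrix_mul_assoc)

lemma subgroup_pair_GL2Qpos: "subgroup_pair GL2Qpos SL2Z"
proof -
  interpret group GL2Qpos by (rule group_GL2Qpos)
  have inv: "inv\<^bsub>GL2Qpos\<^esub> g = matrix_inv g" if "det g > 0" for g
    by (rule inv_equality) (use that in \<open>auto simp: matrix_inv_left det_matrix_inv\<close>)
  have "subgroup SL2Z GL2Qpos"
    by (rule subgroupI) (auto simp: SL2Z_det SL2Z_mult SL2Z_inv inv intro: SL2Z_mat_1)
  thus ?thesis by (intro subgroup_pair.intro subgroup_pair_axioms.intro group_GL2Qpos)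
qed

interpretation GL: subgroup_pair GL2Qpos SL2Z
  by (rule subgroup_pair_GL2Qpos)

lemma GL2Qpos_inv: "det g > 0 \<Longrightarrow> inv\<^bsub>GL2Qpos\<^esub> g = matrix_inv g"
  by (rule GL.inv_equality) (auto simp: matrix_inv_left det_matrix_inv)

lemma group_P_group: "group P_group"
proof (rule groupI)
  fix x assume x: "x \<in> carrier P_group"
  obtain m g where mg: "x = (m, g)" by (cases x)
  have "(- (m ** g), matrix_inv g) \<in> carrier P_group"
    "(- (m ** g), matrix_inv g) \<cdot> x = \<one>\<^bsub>P_group\<^esub>"
    using x by (auto simp: mg det_matrix_inv matrix_inv_inv matrix_inv_left)
  thus "\<exists>y\<in>carrier P_group. y \<cdot> x = \<one>\<^bsub>P_group\<^esub>" by blast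
next
  fix x y z assume "x \<in> carrier P_group" "y \<in> carrier P_group" "z \<in> carrier P_group"
  thus "x \<cdot> y \<cdot> z = x \<cdot> (y \<cdot> z)"
    by (cases x; cases y; cases z)
      (auto simp: matrix_inv_mult matrix_add_rdistrib_2 matrix_mul_assoc add.assoc)
qed (auto simp: det_mul)

interpretation Pgrp: group P_group
  by (rule group_P_group)

lemma P_group_inv:
  assumes "det g > 0"
  shows "Pinv (m, g) = (- (m ** g), matrix_inv g)"
  by (rule Pgrp.inv_equality)
    (use assms in \<open>auto simp: det_matrix_inv matrix_inv_inv matrix_inv_left\<close>)

lemma P0_carrier: "k \<in> P0 \<Longrightarrow> k \<in> carrier P_group"
  by (auto simp: P0_def SL2Z_det)

lemma subgroup_P0: "subgroup P0 P_group"
proof (rule Pgrp.subgroupI)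
  show "P0 \<subseteq> carrier P_group" using P0_carrier by auto
  have "(0, mat 1) \<in> P0" by (simp add: P0_def Mat2Z_0 SL2Z_mat_1)
  thus "P0 \<noteq> {}" by blast
next
  fix x assume "x \<in> P0"
  thus "Pinv x \<in> P0"
    by (auto simp: P0_def P_group_inv SL2Z_det SL2Z_inv SL2Z_int intro!: Mat2Z_minus Mat2Z_mult)
next
  fix x y assume "x \<in> P0" "y \<in> P0"
  thus "x \<cdot> y \<in> P0"
    by (auto simp: P0_def SL2Z_mult intro!: Mat2Z_add Mat2Z_mult SL2Z_int[OF SL2Z_inv])
qed

subsection \<open>The Hecke property\<close>

text \<open>
  The right coset of \<open>x k\<close>, for \<open>k\<close> in \<open>P\<^sub>0\<close>, only depends on \<open>k\<close> modulo the cube of a common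
  denominator of the entries of \<open>x\<close> and its inverse.
\<close>

definition residues :: "nat \<Rightarrow> rat_mat \<Rightarrow> int \<times> int \<times> int \<times> int" where
  "residues D m = (\<lfloor>m $ 1 $ 1\<rfloor> mod int D, \<lfloor>m $ 1 $ 2\<rfloor> mod int D,
     \<lfloor>m $ 2 $ 1\<rfloor> mod int D, \<lfloor>m $ 2 $ 2\<rfloor> mod int D)"

lemma finite_residues: "D > 0 \<Longrightarrow> finite (residues D ` A)"
  by (rule finite_subset[of _ "{0..<int D} \<times> {0..<int D} \<times> {0..<int D} \<times> {0..<int D}"])
    (auto simp: residues_def)

lemma residues_eq_imp:
  assumes "m \<in> Mat2Z" "n \<in> Mat2Z" "residues D m = residues D n" "D > 0"
  shows "m - n \<in> lat (1 / of_nat D)"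
proof -
  have "1 / of_nat D * (m - n) $ i $ j \<in> \<int>" for i j
  proof -
    obtain a b where ab: "m $ i $ j = of_int a" "n $ i $ j = of_int b"
      using assms(1,2) unfolding Mat2Z_def by (blast elim: Ints_cases)
    have "a mod int D = b mod int D"
      using assms(3) ab exhaust_2[of i] exhaust_2[of j] by (auto simp: residues_def)
    hence "int D dvd a - b" by (simp add: mod_eq_dvd_iff)
    then obtain k where "a - b = int D * k" by (rule dvdE)
    hence "(of_int a - of_int b :: rat) = of_nat D * of_int k" by (metis of_int_diff of_int_mult of_int_of_nat_eq)
    thus ?thesis using assms(4) by (simp add: ab)
  qed
  thus ?thesis by (simp add: lat_def)
qed

lemma finite_image_if_factors:
  assumes "finite (r ` A)" "\<And>x y. x \<in> A \<Longrightarrow> y \<in> A \<Longrightarrow> r x = r y \<Longrightarrow> f x = f y"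
  shows "finite (f ` A)"
proof -
  have "f ` A \<subseteq> (\<lambda>c. f (inv_into A r c)) ` r ` A"
  proof (rule image_subsetI)
    fix x assume x: "x \<in> A"
    have "f x = f (inv_into A r (r x))"
      by (rule assms(2)) (use x in \<open>auto simp: inv_into_into f_inv_into_f\<close>)
    thus "f x \<in> (\<lambda>c. f (inv_into A r c)) ` r ` A" using x by auto
  qed
  thus ?thesis by (rule finite_subset) (intro finite_imageI assms(1))
qed

text \<open>The origin of the cube: \<open>m\<close>, \<open>g\<close> and the inverse of
  \<open>g\<close> each have denominator \<open>e\<close>, so \<open>m g \<epsilon> g^-1\<close> is
  integral as soon as \<open>\<epsilon>\<close> is divisible by \<open>e ^ 3\<close>.\<close>

lemma conjugate_integral:
  assumes g: "det g > 0" "g \<in> lat (of_nat e)" "matrix_inv g \<in> lat (of_nat e)" "m \<in> lat (of_nat e)"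
    and e: "e > 0" and d: "\<delta> - mat 1 \<in> lat (1 / of_nat (e ^ 3))"
  shows "g ** \<delta> ** matrix_inv g \<in> Mat2Z" "m - m ** g ** \<delta> ** matrix_inv g \<in> Mat2Z"
proof -
  define \<epsilon> where "\<epsilon> = \<delta> - mat 1"
  have delta: "\<delta> = mat 1 + \<epsilon>" by (simp add: \<epsilon>_def)
  have eps: "\<epsilon> \<in> lat (1 / of_nat (e ^ 3))" using d by (simp add: \<epsilon>_def)
  have e': "rat_of_nat e \<noteq> 0" using e by simp
  have "g ** \<epsilon> ** matrix_inv g \<in> lat (of_nat e * (1 / of_nat (e ^ 3)) * of_nat e)"
    by (intro lat_mult g eps)
  hence "g ** \<epsilon> ** matrix_inv g \<in> lat (of_nat e * (of_nat e * (1 / of_nat (e ^ 3)) * of_nat e))"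
    by (rule lat_Ints_mult) simp
  hence 1: "g ** \<epsilon> ** matrix_inv g \<in> Mat2Z"
    using e' by (simp add: power3_eq_cube lat_1[symmetric])
  have "m ** g ** \<epsilon> ** matrix_inv g \<in> lat (of_nat e * of_nat e * (1 / of_nat (e ^ 3)) * of_nat e)"
    by (intro lat_mult g eps)
  hence 2: "m ** g ** \<epsilon> ** matrix_inv g \<in> Mat2Z"
    using e' by (simp add: power3_eq_cube lat_1[symmetric])
  have "g ** \<delta> ** matrix_inv g = mat 1 + g ** \<epsilon> ** matrix_inv g"
    using g(1) by (simp add: delta matrix_add_ldistrib matrix_add_rdistrib_2 matrix_inv_right)
  thus "g ** \<delta> ** matrix_inv g \<in> Mat2Z" using Mat2Z_add[OF Mat2Z_mat_1 1] by simp
  have "m ** g ** \<delta> ** matrix_inv g = m + m ** g ** \<epsilon> ** matrix_inv g"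
    using g(1) by (simp add: delta matrix_add_ldistrib matrix_add_rdistrib_2 matrix_cancel)
  thus "m - m ** g ** \<delta> ** matrix_inv g \<in> Mat2Z" using Mat2Z_minus[OF 2] by simp
qed

lemma lat_exists3:
  "\<exists>e::nat. e > 0 \<and> a \<in> lat (of_nat e) \<and> b \<in> lat (of_nat e) \<and> c \<in> lat (of_nat e)"
proof -
  obtain p q r :: nat where "p > 0" "a \<in> lat (of_nat p)" "q > 0" "b \<in> lat (of_nat q)"
    "r > 0" "c \<in> lat (of_nat r)"
    using lat_exists by metis
  thus ?thesis using lat_dvd[of a p "p * q * r"] lat_dvd[of b q "p * q * r"] lat_dvd[of c r "p * q * r"]
    by (intro exI[of _ "p * q * r"]) auto
qed

text \<open>In \<open>P\<close> one has
  \<open>(n, \<gamma>) (n', \<gamma>')^-1 = (\<nu>, \<delta>)\<close>, which is congruent to the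
  identity. The element \<open>z\<close> is its conjugate by \<open>x\<close>; it lies in
  \<open>P0\<close> and carries \<open>x (n', \<gamma>')\<close> to
  \<open>x (n, \<gamma>)\<close>.\<close>

lemma same_right_coset_if_congruent:
  assumes x: "x = (m, g)" "det g > 0"
    and e: "e > 0" "g \<in> lat (of_nat e)" "matrix_inv g \<in> lat (of_nat e)" "m \<in> lat (of_nat e)"
    and k: "n \<in> Mat2Z" "\<gamma> \<in> SL2Z" "n' \<in> Mat2Z" "\<gamma>' \<in> SL2Z"
    and cong: "n - n' \<in> lat (1 / of_nat (e ^ 3))" "\<gamma> - \<gamma>' \<in> lat (1 / of_nat (e ^ 3))"
  shows "Pcoset (x \<cdot> (n, \<gamma>)) = Pcoset (x \<cdot> (n', \<gamma>'))"
proof -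
  define \<delta> where "\<delta> = \<gamma> ** matrix_inv \<gamma>'"
  have dets: "det \<gamma> = 1" "det \<gamma>' = 1" using k SL2Z_det by auto
  have inv_delta: "matrix_inv \<delta> = \<gamma>' ** matrix_inv \<gamma>"
    unfolding \<delta>_def using dets by (simp add: matrix_inv_mult det_matrix_inv matrix_inv_inv)
  have delta: "\<delta> \<in> SL2Z" unfolding \<delta>_def by (intro SL2Z_mult SL2Z_inv k)
  hence det_delta: "det \<delta> = 1" by (rule SL2Z_det)
  have "\<delta> - mat 1 = (\<gamma> - \<gamma>') ** matrix_inv \<gamma>'"
    using dets by (simp add: \<delta>_def matrix_diff_mult matrix_inv_right)
  hence d1: "\<delta> - mat 1 \<in> lat (1 / of_nat (e ^ 3))"
    using lat_mult_int[OF cong(2) SL2Z_int[OF SL2Z_inv[OF k(4)]]] by simp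
  have "matrix_inv \<delta> - mat 1 = - ((\<gamma> - \<gamma>') ** matrix_inv \<gamma>)"
    using dets by (simp add: inv_delta matrix_diff_mult matrix_inv_right)
  hence d2: "matrix_inv \<delta> - mat 1 \<in> lat (1 / of_nat (e ^ 3))"
    using lat_minus[OF lat_mult_int[OF cong(2) SL2Z_int[OF SL2Z_inv[OF k(2)]]]] by simp
  define \<nu> where "\<nu> = n - n' ** matrix_inv \<delta>"
  have "\<nu> = (n - n') - n' ** (matrix_inv \<delta> - mat 1)"
    by (simp add: \<nu>_def matrix_mult_diff)
  hence nu: "\<nu> \<in> lat (1 / of_nat (e ^ 3))"
    using lat_diff[OF cong(1) lat_int_mult[OF k(3) d2]] by simp
  have e': "rat_of_nat e \<noteq> 0" using e by simp
  have "\<nu> ** matrix_inv g \<in> lat (1 / of_nat (e ^ 3) * of_nat e)" by (intro lat_mult nu e)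
  hence "\<nu> ** matrix_inv g \<in> lat (of_nat (e ^ 2) * (1 / of_nat (e ^ 3) * of_nat e))"
    by (rule lat_Ints_mult) simp
  hence nu': "\<nu> ** matrix_inv g \<in> Mat2Z"
    using e' by (simp add: power3_eq_cube power2_eq_square lat_1[symmetric])
  define z where "z = (m + \<nu> ** matrix_inv g - m ** g ** matrix_inv \<delta> ** matrix_inv g, g ** \<delta> ** matrix_inv g)"
  have "m - m ** g ** matrix_inv \<delta> ** matrix_inv g \<in> Mat2Z"
    by (rule conjugate_integral(2)[OF x(2) e(2,3,4,1) d2])
  from Mat2Z_add[OF this nu'] have "fst z \<in> Mat2Z" by (simp add: z_def algebra_simps)
  moreover have "g ** \<delta> ** matrix_inv g \<in> Mat2Z"
    by (rule conjugate_integral(1)[OF x(2) e(2,3,4,1) d1])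
  hence "snd z \<in> SL2Z"
    using x(2) det_delta by (simp add: z_def SL2Z_def det_mul det_matrix_inv)
  ultimately have z: "z \<in> P0" by (auto simp: P0_def mem_Times_iff)
  have "z \<cdot> (x \<cdot> (n', \<gamma>')) = x \<cdot> (n, \<gamma>)"
  proof -
    have inv_conj: "matrix_inv (g ** \<delta> ** matrix_inv g) = g ** matrix_inv \<delta> ** matrix_inv g"
      using x(2) det_delta by (simp add: matrix_inv_mult det_mul det_matrix_inv matrix_inv_inv matrix_mul_assoc)
    have "g ** \<delta> ** matrix_inv g ** (g ** \<gamma>') = g ** \<gamma>"
      using x(2) dets by (simp add: \<delta>_def matrix_cancel matrix_mul_assoc)
    moreover have "n' ** matrix_inv g ** (g ** matrix_inv \<delta> ** matrix_inv g) = n' ** matrix_inv \<delta> ** matrix_inv g"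
      using x(2) by (simp add: matrix_cancel matrix_mul_assoc)
    ultimately show ?thesis
      unfolding z_def x(1)
      by (simp add: inv_conj \<nu>_def matrix_add_rdistrib_2 matrix_diff_mult matrix_mul_assoc algebra_simps)
  qed
  moreover have "x \<cdot> (n', \<gamma>') \<in> carrier P_group"
    using x dets by (simp add: det_mul)
  ultimately show ?thesis
    using Pgrp.repr_independence[OF Pgrp.rcosI[OF z subgroup.subset[OF subgroup_P0]] _ subgroup_P0] by metis
qed

lemma hecke_pair_P: "hecke_pair P_group P0"
proof (intro hecke_pair.intro subgroup_pair.intro subgroup_pair_axioms.intro hecke_pair_axioms.intro
    group_P_group subgroup_P0)
  fix x assume x: "x \<in> carrier P_group"
  obtain m g where mg: "x = (m, g)" "det g > 0" using x by (cases x) auto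
  obtain e where e: "e > 0" "g \<in> lat (of_nat e)" "matrix_inv g \<in> lat (of_nat e)" "m \<in> lat (of_nat e)"
    using lat_exists3 by blast
  have fin: "finite ((\<lambda>k. Pcoset (x \<cdot> k)) ` P0)"
  proof (rule finite_image_if_factors)
    have "finite (residues (e ^ 3) ` UNIV \<times> residues (e ^ 3) ` UNIV)"
      using e(1) by (intro finite_cartesian_product finite_residues) auto
    thus "finite ((\<lambda>(n, \<gamma>). (residues (e ^ 3) n, residues (e ^ 3) \<gamma>)) ` P0)"
      by (rule finite_subset[rotated]) auto
    fix k k' assume k: "k \<in> P0" "k' \<in> P0"
      "(\<lambda>(n, \<gamma>). (residues (e ^ 3) n, residues (e ^ 3) \<gamma>)) k = (\<lambda>(n, \<gamma>). (residues (e ^ 3) n, residues (e ^ 3) \<gamma>)) k'"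
    obtain n \<gamma> n' \<gamma>' where kk: "k = (n, \<gamma>)" "k' = (n', \<gamma>')" by (cases k; cases k')
    have mem: "n \<in> Mat2Z" "\<gamma> \<in> SL2Z" "n' \<in> Mat2Z" "\<gamma>' \<in> SL2Z" using k by (auto simp: kk P0_def)
    have res: "residues (e ^ 3) n = residues (e ^ 3) n'" "residues (e ^ 3) \<gamma> = residues (e ^ 3) \<gamma>'"
      using k(3) by (auto simp: kk)
    have e3: "e ^ 3 > 0" using e(1) by simp
    show "Pcoset (x \<cdot> k) = Pcoset (x \<cdot> k')"
      unfolding kk
      by (rule same_right_coset_if_congruent[OF mg e mem])
        (use residues_eq_imp[OF mem(1,3) res(1) e3]
          residues_eq_imp[OF SL2Z_int[OF mem(2)] SL2Z_int[OF mem(4)] res(2) e3] in auto)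
  qed
  have "Pcoset ` double_coset P_group P0 x \<subseteq>
      (\<lambda>k. Pcoset (x \<cdot> k)) ` P0"
  proof (rule image_subsetI)
    fix y assume "y \<in> double_coset P_group P0 x"
    then obtain h k where hk: "h \<in> P0" "k \<in> P0" "y = h \<cdot> x \<cdot> k"
      by (auto simp: double_coset_def)
    have c: "x \<cdot> k \<in> carrier P_group"
      by (rule Pgrp.m_closed[OF x P0_carrier[OF hk(2)]])
    have "y = h \<cdot> (x \<cdot> k)"
      unfolding hk(3) by (rule Pgrp.m_assoc[OF P0_carrier[OF hk(1)] x P0_carrier[OF hk(2)]])
    hence "Pcoset y = Pcoset (x \<cdot> k)"
      using Pgrp.repr_independence[OF Pgrp.rcosI[OF hk(1) subgroup.subset[OF subgroup_P0] c] c subgroup_P0]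
      by simp
    thus "Pcoset y \<in> (\<lambda>k. Pcoset (x \<cdot> k)) ` P0"
      using hk(2) by blast
  qed
  thus "finite (Pcoset ` double_coset P_group P0 x)"
    using fin by (rule finite_subset)
qed

interpretation P: hecke_pair P_group P0
  by (rule hecke_pair_P)

text \<open>On the double coset of \<open>(a, b)\<close> the components are built from
  \<open>a\<close>, \<open>b\<close> and the inverse of \<open>b\<close> by multiplying with integer
  matrices and adding them, so a common denominator of these three serves the whole double coset.
  The support consists of finitely many double cosets, and the product of their denominators serves
  all.\<close>

lemma hecke_denominator:
  assumes f: "f \<in> HP"
  shows "\<exists>d::nat. d > 0 \<and> (\<forall>m k. f (m, k) \<noteq> 0 \<longrightarrow> m \<in> lat (of_nat d) \<and> k \<in> lat (of_nat d))"
proof -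
  let ?D = "{double_coset P_group P0 x | x. x \<in> carrier P_group \<and> f x \<noteq> 0}"
  have fin: "finite ?D" using f by (simp add: hecke_algebra_def)
  have "\<exists>d::nat. d > 0 \<and> (\<forall>(m, k)\<in>C. m \<in> lat (of_nat d) \<and> k \<in> lat (of_nat d))" if "C \<in> ?D" for C
  proof -
    have "\<exists>x. C = double_coset P_group P0 x \<and> x \<in> carrier P_group" using that by auto
    then obtain x where x: "C = double_coset P_group P0 x" "x \<in> carrier P_group" by (elim exE conjE)
    obtain a b where ab: "x = (a, b)" "det b > 0" using x(2) by (cases x) auto
    obtain d :: nat where d: "d > 0" "a \<in> lat (of_nat d)" "b \<in> lat (of_nat d)" "matrix_inv b \<in> lat (of_nat d)"
      using lat_exists3 by blast
    have int: "m \<in> lat (of_nat d)" if "m \<in> Mat2Z" for m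
      using lat_dvd[of m 1 d] that by (simp add: lat_1)
    have "m \<in> lat (of_nat d) \<and> k \<in> lat (of_nat d)" if "(m, k) \<in> C" for m k
    proof -
      have "\<exists>h\<in>P0. \<exists>l\<in>P0. (m, k) = h \<cdot> x \<cdot> l"
        using that unfolding x(1) double_coset_def by blast
      then obtain n \<gamma> n' \<gamma>' where k: "n \<in> Mat2Z" "\<gamma> \<in> SL2Z" "n' \<in> Mat2Z" "\<gamma>' \<in> SL2Z"
        "(m, k) = (n, \<gamma>) \<cdot> x \<cdot> (n', \<gamma>')"
        unfolding P0_def by blast
      have eq: "m = n + a ** matrix_inv \<gamma> + n' ** (matrix_inv b ** matrix_inv \<gamma>)" "k = \<gamma> ** b ** \<gamma>'"
        using k(5) ab SL2Z_det[OF k(2)] by (auto simp: matrix_inv_mult)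
      note i = SL2Z_int[OF SL2Z_inv[OF k(2)]]
      show ?thesis unfolding eq
      proof
        show "n + a ** matrix_inv \<gamma> + n' ** (matrix_inv b ** matrix_inv \<gamma>) \<in> lat (of_nat d)"
          by (rule lat_add[OF lat_add[OF int[OF k(1)] lat_mult_int[OF d(2) i]]
                lat_int_mult[OF k(3) lat_mult_int[OF d(4) i]]])
        show "\<gamma> ** b ** \<gamma>' \<in> lat (of_nat d)"
          by (rule lat_mult_int[OF lat_int_mult[OF SL2Z_int[OF k(2)] d(3)] SL2Z_int[OF k(4)]])
      qed
    qed
    thus ?thesis using d(1) by blast
  qed
  then obtain d :: "(rat_mat \<times> rat_mat) set \<Rightarrow> nat" where d: "\<And>C. C \<in> ?D \<Longrightarrow> d C > 0"
    "\<And>C m k. C \<in> ?D \<Longrightarrow> (m, k) \<in> C \<Longrightarrow> m \<in> lat (of_nat (d C)) \<and> k \<in> lat (of_nat (d C))"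
    by (metis (mono_tags, lifting) case_prodD)
  show ?thesis
  proof (intro exI conjI allI impI)
    show "(\<Prod>C\<in>?D. d C) > 0" using d(1) by (intro prod_pos) auto
    fix m k assume mk: "f (m, k) \<noteq> 0"
    define C where "C = double_coset P_group P0 (m, k)"
    have c: "(m, k) \<in> carrier P_group" by (rule P.hecke_supp[OF f mk])
    have C: "C \<in> ?D" "(m, k) \<in> C"
      using mk c P.self_in_double_coset[OF c] by (auto simp: C_def)
    have "d C dvd (\<Prod>C\<in>?D. d C)" by (rule dvd_prodI[OF fin C(1)])
    thus "m \<in> lat (of_nat (\<Prod>C\<in>?D. d C))" "k \<in> lat (of_nat (\<Prod>C\<in>?D. d C))"
      using d(2)[OF C] lat_dvd by blast+
  qed
qed

section \<open>Eigenfunctions of the right translations\<close>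

abbreviation "GC \<equiv> right_cosets GL2Qpos SL2Z {g. det g > 0}"
abbreviation "PC \<equiv> right_cosets P_group P0 (UNIV \<times> {g. det g > 0})"
abbreviation Gcoset :: "rat_mat \<Rightarrow> rat_mat set" where "Gcoset g \<equiv> SL2Z #>\<^bsub>GL2Qpos\<^esub> g"

lemmas GC_facts = GL.coset_rep_carrier[simplified] GL.coset_of_coset_rep[simplified]

lemma Gcoset_absorb: "g \<in> SL2Z \<Longrightarrow> det h > 0 \<Longrightarrow> Gcoset (g ** h) = Gcoset h"
  using GL.coset_absorb[of g h] by simp

lemma Gcoset_rep:
  assumes "det g > 0" obtains h where "h \<in> SL2Z" "coset_rep (Gcoset g) = h ** g"
  using GL.coset_rep_of_coset[of g] assms by auto

text \<open>Acting with \<open>\<gamma>\<close> brings \<open>g\<close> to the chosen representative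
  of its coset, and an integral translation then brings \<open>m\<close> to the representative of
  its class. Once \<open>g\<close> is fixed, \<open>\<gamma>\<close> must be 1, so the class of
  \<open>m\<close> is uniquely determined.\<close>

lemma P_coset_bij:
  "bij_betw (\<lambda>(D, M). Pcoset (coset_rep M, coset_rep D)) (GC \<times> Mat2Q_mod_Mat2Z) PC"
proof (rule bij_betw_imageI)
  show "inj_on (\<lambda>(D, M). Pcoset (coset_rep M, coset_rep D)) (GC \<times> Mat2Q_mod_Mat2Z)"
  proof (rule inj_onI, clarify)
    fix D M D' M'
    assume D: "D \<in> GC" "D' \<in> GC" and M: "M \<in> Mat2Q_mod_Mat2Z" "M' \<in> Mat2Q_mod_Mat2Z"
      and eq: "Pcoset (coset_rep M, coset_rep D) = Pcoset (coset_rep M', coset_rep D')"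
    have det: "det (coset_rep D) > 0" "det (coset_rep D') > 0" using D GC_facts by auto
    obtain h where h: "h \<in> P0" "(coset_rep M, coset_rep D) = h \<cdot> (coset_rep M', coset_rep D')"
      using P.coset_eqE[OF eq] det by auto
    obtain n \<gamma> where n: "h = (n, \<gamma>)" "n \<in> Mat2Z" "\<gamma> \<in> SL2Z" using h(1) by (auto simp: P0_def)
    have e: "coset_rep M = n + coset_rep M' ** matrix_inv \<gamma>" "coset_rep D = \<gamma> ** coset_rep D'"
      using h(2) by (simp_all add: n(1))
    have "Gcoset (coset_rep D) = Gcoset (coset_rep D')"
      unfolding e(2) by (rule Gcoset_absorb[OF n(3) det(2)])
    hence DD': "D = D'" using GC_facts(2)[OF D(1)] GC_facts(2)[OF D(2)] by simp
    note fixed = e(2)[folded DD', symmetric]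
    have "\<gamma> = \<gamma> ** coset_rep D ** matrix_inv (coset_rep D)" using det by (simp add: matrix_cancel)
    also have "\<dots> = mat 1" unfolding fixed using det by (simp add: matrix_inv_right)
    finally have "\<gamma> = mat 1" .
    hence "coset_rep M - coset_rep M' \<in> Mat2Z" using e(1) n(2) by simp
    hence "zclass (coset_rep M) = zclass (coset_rep M')" by (simp add: zclass_eq_iff)
    thus "D = D' \<and> M = M'" using zclass_of_rep M DD' by simp
  qed
  show "(\<lambda>(D, M). Pcoset (coset_rep M, coset_rep D)) ` (GC \<times> Mat2Q_mod_Mat2Z) = PC"
  proof (intro equalityI subsetI)
    fix C assume "C \<in> (\<lambda>(D, M). Pcoset (coset_rep M, coset_rep D)) ` (GC \<times> Mat2Q_mod_Mat2Z)"
    thus "C \<in> PC" using GC_facts(1) by (auto simp: right_cosets_def)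
  next
    fix C assume C: "C \<in> PC"
    obtain m g where mg: "coset_rep C = (m, g)" by fastforce
    have g: "det g > 0" using P.coset_rep_carrier[of C] C mg by auto
    obtain \<gamma> where \<gamma>: "\<gamma> \<in> SL2Z" "coset_rep (Gcoset g) = \<gamma> ** g" using Gcoset_rep[OF g] .
    define z where "z = coset_rep (zclass (m ** matrix_inv \<gamma>)) - m ** matrix_inv \<gamma>"
    have z: "(z, \<gamma>) \<in> P0" using zclass_rep' \<gamma>(1) by (simp add: z_def P0_def)
    have "(coset_rep (zclass (m ** matrix_inv \<gamma>)), coset_rep (Gcoset g)) = (z, \<gamma>) \<cdot> (m, g)"
      by (simp add: z_def \<gamma>(2))
    hence "Pcoset (coset_rep (zclass (m ** matrix_inv \<gamma>)), coset_rep (Gcoset g)) = Pcoset (m, g)"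
      using P.coset_absorb[OF z, of "(m, g)"] g by simp
    also have "\<dots> = C" using P.coset_of_coset_rep[of C] C mg by simp
    finally show "C \<in> (\<lambda>(D, M). Pcoset (coset_rep M, coset_rep D)) ` (GC \<times> Mat2Q_mod_Mat2Z)"
      using g by (intro image_eqI[of _ _ "(Gcoset g, zclass (m ** matrix_inv \<gamma>))"])
        (auto simp: right_cosets_def Mat2Q_mod_Mat2Z_eq)
  qed
qed

lemma
  assumes F: "P.left_invariant F"
  shows has_sum_P_cosets: "((\<lambda>C. F (coset_rep C)) has_sum s) PC \<longleftrightarrow>
      ((\<lambda>(D, M). F (coset_rep M, coset_rep D)) has_sum s) (GC \<times> Mat2Q_mod_Mat2Z)"
proof -
  have "((\<lambda>C. F (coset_rep C)) has_sum s) PC \<longleftrightarrow>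
      ((\<lambda>p. F (coset_rep ((\<lambda>(D, M). Pcoset (coset_rep M, coset_rep D)) p))) has_sum s)
        (GC \<times> Mat2Q_mod_Mat2Z)"
    by (rule has_sum_reindex_bij_betw[OF P_coset_bij, symmetric])
  also have "\<dots> \<longleftrightarrow> ((\<lambda>(D, M). F (coset_rep M, coset_rep D)) has_sum s) (GC \<times> Mat2Q_mod_Mat2Z)"
  proof (rule has_sum_cong)
    fix p assume "p \<in> GC \<times> Mat2Q_mod_Mat2Z"
    thus "F (coset_rep ((\<lambda>(D, M). Pcoset (coset_rep M, coset_rep D)) p)) =
        (\<lambda>(D, M). F (coset_rep M, coset_rep D)) p"
      using P.left_invariant_coset_rep[OF F, of "(coset_rep (snd p), coset_rep (fst p))"] GC_facts(1)
      by (auto split: prod.splits)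
  qed
  finally show ?thesis .
qed

section \<open>The cosets of integer matrices among all cosets\<close>

lemma Gamma_mod_S_rep:
  assumes "D \<in> Gamma_mod_S"
  shows "coset_rep D \<in> Mat2Zpos" "D \<in> GC" "Gcoset (coset_rep D) = D"
proof -
  obtain s where s: "D = Gcoset s" "s \<in> Mat2Zpos" using assms by (auto simp: right_cosets_def)
  have det: "det s > 0" using s by (simp add: Mat2Zpos_def)
  obtain h where "h \<in> SL2Z" "coset_rep D = h ** s" using Gcoset_rep[OF det] s(1) by auto
  thus "coset_rep D \<in> Mat2Zpos"
    using s(2) SL2Z_det SL2Z_int Mat2Z_mult by (simp add: Mat2Zpos_def det_mul)
  show D: "D \<in> GC" using s(1) det by (auto simp: right_cosets_def)
  show "Gcoset (coset_rep D) = D" by (rule GC_facts(2)[OF D])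
qed

lemma Gamma_mod_S_iff:
  assumes "D \<in> GC" shows "D \<in> Gamma_mod_S \<longleftrightarrow> coset_rep D \<in> Mat2Zpos"
proof
  assume "coset_rep D \<in> Mat2Zpos"
  hence "Gcoset (coset_rep D) \<in> Gamma_mod_S" by (simp add: right_cosets_def)
  thus "D \<in> Gamma_mod_S" using GC_facts(2)[OF assms] by simp
qed (rule Gamma_mod_S_rep(1))

lemma P_left_invariantD:
  assumes "P.left_invariant F" "h \<in> P0" "x \<in> carrier P_group"
  shows "F (h \<cdot> x) = F x"
  using assms unfolding P.left_invariant_def by blast

lemma Mat2Zpos_SL2Z:
  assumes "\<gamma> \<in> SL2Z" shows "\<gamma> ** g \<in> Mat2Zpos \<longleftrightarrow> g \<in> Mat2Zpos"
  by (simp add: Mat2Zpos_def SL2Z_cancel[OF assms] det_mul SL2Z_det[OF assms])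

context matrix_pairing
begin

text \<open>
  A left \<open>P\<^sub>0\<close>-invariant function \<open>F\<close> on \<open>P\<close> with \<open>F (x (v, 1)) = cnj (psi v) F x\<close> is determined by the
  numbers \<open>F (0, g)\<close>, which vanish unless \<open>g\<close> is integral. The weight \<open>1 / det g\<close> makes the cut-off
  of \<open>eigen \<xi>\<close> a multiple of an isometry, see \<open>has_sum_cut_twisted\<close>.
\<close>

definition eigen :: "(rat_mat set \<Rightarrow> complex) \<Rightarrow> rat_mat \<times> rat_mat \<Rightarrow> complex" where
  "eigen \<xi> = (\<lambda>(m, g). if g \<in> Mat2Zpos
     then cnj (psi (m ** g)) * of_rat (1 / det g) * \<xi> (Gcoset g) else 0)"

lemma psi_add_int: "z \<in> Mat2Z \<Longrightarrow> psi (z + u) = psi u"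
  by (simp add: psi_add psi_int)

lemma psi_0 [simp]: "psi 0 = 1"
  by (rule psi_int[OF Mat2Z_0])

lemma psi_cnj: "psi u * cnj (psi u) = 1"
  using cmod_psi[of u] by (simp add: complex_norm_square[symmetric])

lemma psi_minus: "psi (- u) = cnj (psi u)"
proof -
  have "psi (- u) = psi (- u) * (psi u * cnj (psi u))" by (simp add: psi_cnj)
  also have "\<dots> = psi (- u + u) * cnj (psi u)" by (simp only: psi_add mult.assoc)
  finally show ?thesis by simp
qed

lemma eigen_left_invariant: "P.left_invariant (eigen \<xi>)"
  unfolding P.left_invariant_def
proof (intro ballI)
  fix h x assume hx: "h \<in> P0" "x \<in> carrier P_group"
  obtain n \<gamma> m g where *: "h = (n, \<gamma>)" "x = (m, g)" "n \<in> Mat2Z" "\<gamma> \<in> SL2Z" "det g > 0"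
    using hx by (auto simp: P0_def)
  have g: "det \<gamma> = 1" by (rule SL2Z_det[OF *(4)])
  have "(n + m ** matrix_inv \<gamma>) ** (\<gamma> ** g) = n ** \<gamma> ** g + m ** g"
    using g by (simp add: matrix_add_rdistrib_2 matrix_mul_assoc matrix_cancel)
  moreover have "n ** \<gamma> ** g \<in> Mat2Z" if "g \<in> Mat2Zpos"
    using that *(3,4) SL2Z_int by (auto simp: Mat2Zpos_def intro!: Mat2Z_mult)
  ultimately show "eigen \<xi> (h \<cdot> x) = eigen \<xi> x"
    using *(5) by (simp add: *(1,2) eigen_def Mat2Zpos_SL2Z[OF *(4)] Gcoset_absorb[OF *(4)]
        psi_add_int det_mul g)
qed

lemma eigen_translate:
  assumes "x \<in> carrier P_group"
  shows "eigen \<xi> (x \<cdot> (v, mat 1)) = cnj (psi v) * eigen \<xi> x"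
  using assms by (cases x)
    (auto simp: eigen_def matrix_add_rdistrib_2 matrix_cancel psi_add)

text \<open>For integral \<open>z\<close>, left invariance and the eigenvalue equation compute
  \<open>F (z, g)\<close> in two ways, as \<open>F (0, g)\<close> and as
  \<open>cnj (psi (z ** g)) * F (0, g)\<close>. If \<open>F (0, g)\<close> is nonzero, then
  \<open>psi (z ** g) = 1\<close> for all such \<open>z\<close>, and \<open>left_int\<close> makes
  \<open>g\<close> integral.\<close>

lemma eigen_unique:
  assumes F: "P.left_invariant F"
    and eig: "\<And>x v. x \<in> carrier P_group \<Longrightarrow> F (x \<cdot> (v, mat 1)) = cnj (psi v) * F x"
    and g: "det g > 0"
  shows "F (m, g) = (if g \<in> Mat2Zpos then cnj (psi (m ** g)) * F (0, g) else 0)"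
proof -
  have 1: "F (m, g) = cnj (psi (m ** g)) * F (0, g)" for m
    using eig[of "(0, g)" "m ** g"] g by (simp add: matrix_cancel)
  have "F (0, g) = 0" if "g \<notin> Mat2Zpos"
  proof (rule ccontr)
    assume nz: "F (0, g) \<noteq> 0"
    have "psi (z ** g) = 1" if z: "z \<in> Mat2Z" for z
    proof -
      have "F ((z, mat 1) \<cdot> (0, g)) = F (0, g)"
        by (rule P_left_invariantD[OF F]) (use z g SL2Z_mat_1 in \<open>auto simp: P0_def\<close>)
      hence "cnj (psi (z ** g)) * F (0, g) = F (0, g)" using 1[of z] by simp
      hence "cnj (psi (z ** g)) = 1" using nz by simp
      thus ?thesis by (metis complex_cnj_cnj complex_cnj_one)
    qed
    hence "g \<in> Mat2Z" by (rule left_int)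
    thus False using that g by (simp add: Mat2Zpos_def)
  qed
  thus ?thesis by (cases "g \<in> Mat2Zpos") (simp_all add: 1[of m])
qed

text \<open>The action of \<open>f\<close> on eigenfunctions, in the coordinate \<open>\<xi>\<close>; it is \<open>\<pi>\<^sub>w(f)\<close> by \<open>pi_rep_eq_pi_op\<close>.\<close>

definition pie :: "(rat_mat \<times> rat_mat \<Rightarrow> complex) \<Rightarrow> (rat_mat set \<Rightarrow> complex) \<Rightarrow> rat_mat set \<Rightarrow> complex" where
  "pie f \<xi> C = (if C \<in> Gamma_mod_S
     then of_rat (det (coset_rep C)) * P.conv f (eigen \<xi>) (0, coset_rep C) else 0)"

text \<open>Convolution by \<open>f\<close> commutes with right translations and so preserves the
  eigenspace, which \<open>eigen_unique\<close> parametrizes by the values at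
  \<open>(0, g)\<close>.\<close>

lemma conv_eigen:
  assumes f: "f \<in> HP" and x: "x \<in> carrier P_group"
  shows "P.conv f (eigen \<xi>) x = eigen (pie f \<xi>) x"
proof -
  let ?F = "P.conv f (eigen \<xi>)"
  obtain m g where mg: "x = (m, g)" "det g > 0" using x by (cases x) auto
  have F: "P.left_invariant ?F" by (rule P.left_invariant_conv[OF f])
  have eig: "?F (y \<cdot> (v, mat 1)) = cnj (psi v) * ?F y" if y: "y \<in> carrier P_group" for y v
  proof -
    have "?F (y \<cdot> (v, mat 1)) = P.conv f (\<lambda>z. eigen \<xi> (z \<cdot> (v, mat 1))) y"
      by (rule P.conv_translate[OF f eigen_left_invariant y, symmetric]) simp
    also have "\<dots> = P.conv f (\<lambda>z. cnj (psi v) * eigen \<xi> z) y"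
      unfolding P.conv_def using y
      by (auto intro!: infsum_cong simp: eigen_translate[OF P.coset_rep_carrier] simp del: P_group_simps)
    finally show ?thesis by (simp add: P.conv_scale_right)
  qed
  show ?thesis
  proof (cases "g \<in> Mat2Zpos")
    case True
    obtain h where h: "h \<in> SL2Z" "coset_rep (Gcoset g) = h ** g" using Gcoset_rep[OF mg(2)] .
    have "?F ((0, h) \<cdot> (0, g)) = ?F (0, g)"
      by (rule P_left_invariantD[OF F]) (use h(1) mg(2) Mat2Z_0 in \<open>auto simp: P0_def\<close>)
    moreover have "Gcoset g \<in> Gamma_mod_S" using True by (simp add: right_cosets_def)
    ultimately have "pie f \<xi> (Gcoset g) = of_rat (det g) * ?F (0, g)"
      by (simp add: pie_def h det_mul SL2Z_det)
    hence "of_rat (1 / det g) * pie f \<xi> (Gcoset g) = ?F (0, g)"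
      using mg(2) by (simp add: of_rat_divide)
    thus ?thesis using eigen_unique[OF F eig mg(2), of m] True by (simp add: mg(1) eigen_def mult.assoc)
  next
    case False
    thus ?thesis using eigen_unique[OF F eig mg(2), of m] by (simp add: mg(1) eigen_def)
  qed
qed

text \<open>Since \<open>(v, 1) (0, a) = (0, a) (v a, 1)\<close>, this is an eigenfunction for the
  character \<open>cnj (psi (v ** a))\<close> of the translations \<open>v\<close>; varying
  \<open>a\<close> reaches other characters while the action of \<open>f\<close> stays the
  same.\<close>

definition twisted :: "rat_mat \<Rightarrow> (rat_mat set \<Rightarrow> complex) \<Rightarrow> rat_mat \<times> rat_mat \<Rightarrow> complex" where
  "twisted a \<xi> x = eigen \<xi> (x \<cdot> (0, a))"

lemma twisted_eq: "twisted a \<xi> (m, g) = eigen \<xi> (m, g ** a)"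
  by (simp add: twisted_def)

lemma twisted_left_invariant: "det a > 0 \<Longrightarrow> P.left_invariant (twisted a \<xi>)"
  using P.left_invariant_translate[OF eigen_left_invariant, of "(0, a)" \<xi>]
  by (simp add: twisted_def[abs_def] del: P_group_simps(2))

lemma conv_twisted:
  assumes f: "f \<in> HP" and a: "det a > 0" and x: "x \<in> carrier P_group"
  shows "P.conv f (twisted a \<xi>) x = twisted a (pie f \<xi>) x"
proof -
  have a': "(0, a) \<in> carrier P_group" using a by simp
  show ?thesis
    unfolding twisted_def[abs_def] P.conv_translate[OF f eigen_left_invariant x a']
    by (rule conv_eigen[OF f Pgrp.m_closed[OF x a']])
qed

end

text \<open>A right translation by \<open>(v, 1)\<close> adds \<open>v\<close> to
  \<open>m ** g\<close>, so the condition is invariant under the translations with \<open>v\<close>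
  in \<open>N^-1 Mat_2(Z)\<close>.\<close>

definition lat_cut :: "nat \<Rightarrow> (rat_mat \<times> rat_mat \<Rightarrow> complex) \<Rightarrow> rat_mat \<times> rat_mat \<Rightarrow> complex" where
  "lat_cut N F = (\<lambda>(m, g). if m ** g \<in> lat (of_nat N) then F (m, g) else 0)"

text \<open>Left multiplication by \<open>(n, \<gamma>)\<close> adds \<open>n \<gamma> g\<close> to
  \<open>m ** g\<close>. This stays in the lattice when \<open>g\<close> has denominator
  \<open>N\<close>, which is why the support of \<open>F\<close> is restricted.\<close>

lemma lat_cut_left_invariant:
  assumes F: "P.left_invariant F"
    and supp: "\<And>m g. F (m, g) \<noteq> 0 \<Longrightarrow> g \<in> lat (of_nat N)"
  shows "P.left_invariant (lat_cut N F)"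
  unfolding P.left_invariant_def
proof (intro ballI)
  fix h x assume hx: "h \<in> P0" "x \<in> carrier P_group"
  obtain n \<gamma> m g where *: "h = (n, \<gamma>)" "x = (m, g)" "n \<in> Mat2Z" "\<gamma> \<in> SL2Z" "det g > 0"
    using hx by (auto simp: P0_def)
  have d: "det \<gamma> = 1" by (rule SL2Z_det[OF *(4)])
  have Fhx: "F (h \<cdot> x) = F x" by (rule P_left_invariantD[OF F hx])
  show "lat_cut N F (h \<cdot> x) = lat_cut N F x"
  proof (cases "F x = 0")
    case False
    hence "g \<in> lat (of_nat N)" using supp *(2) by simp
    hence i: "n ** \<gamma> ** g \<in> lat (of_nat N)"
      using *(3,4) SL2Z_int by (auto intro!: lat_int_mult Mat2Z_mult)
    have eq: "(n + m ** matrix_inv \<gamma>) ** (\<gamma> ** g) = n ** \<gamma> ** g + m ** g"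
      using d by (simp add: matrix_add_rdistrib_2 matrix_mul_assoc matrix_cancel)
    have "n ** \<gamma> ** g + m ** g \<in> lat (of_nat N) \<longleftrightarrow> m ** g \<in> lat (of_nat N)"
      using lat_add[OF i, of "m ** g"] lat_diff[OF _ i, of "n ** \<gamma> ** g + m ** g"] by auto
    thus ?thesis using Fhx eq by (simp add: lat_cut_def *(1,2))
  qed (use Fhx in \<open>simp add: lat_cut_def *(1,2)\<close>)
qed

text \<open>If \<open>f ((m, g) (n, h)^-1) F (n, h)\<close> is nonzero, then \<open>g h^-1\<close>
  and \<open>m - n h g^-1\<close> have denominator \<open>df\<close>. Multiplying the former by
  \<open>h\<close> gives \<open>df * d\<close> for \<open>g\<close>; multiplying the latter by
  \<open>g\<close> gives \<open>df * df * d\<close> for \<open>m g - n h\<close>. When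
  \<open>N\<close> is a multiple of this, \<open>m g\<close> and \<open>n h\<close> pass the cut-off
  simultaneously.\<close>

lemma
  assumes f: "f \<in> HP"
    and df: "\<And>m k. f (m, k) \<noteq> 0 \<Longrightarrow> m \<in> lat (of_nat df) \<and> k \<in> lat (of_nat df)"
    and supp: "\<And>m g. F (m, g) \<noteq> 0 \<Longrightarrow> g \<in> lat (of_nat d)"
  shows conv_support: "P.conv f F (m, g) \<noteq> 0 \<Longrightarrow> g \<in> lat (of_nat (df * d))"
    and conv_lat_cut: "df * df * d dvd N \<Longrightarrow> x \<in> carrier P_group \<Longrightarrow> P.conv f (lat_cut N F) x = lat_cut N (P.conv f F) x"
proof -
  have key: "g \<in> lat (of_nat (df * d)) \<and> m ** g - n ** h \<in> lat (of_nat (df * df * d))"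
    if "det g > 0" "det h > 0" "f ((m, g) \<cdot> Pinv (n, h)) * F (n, h) \<noteq> 0" for m g n h
  proof -
    have fn: "f (m - n ** h ** matrix_inv g, g ** matrix_inv h) \<noteq> 0" and Fn: "F (n, h) \<noteq> 0"
      using that by (auto simp: P_group_inv matrix_minus_mult)
    have 1: "m - n ** h ** matrix_inv g \<in> lat (of_nat df)" "g ** matrix_inv h \<in> lat (of_nat df)"
      using df[OF fn] by auto
    have "(g ** matrix_inv h) ** h \<in> lat (of_nat df * of_nat d)" by (rule lat_mult[OF 1(2) supp[OF Fn]])
    hence g: "g \<in> lat (of_nat (df * d))" using that(2) by (simp add: matrix_cancel)
    have "(m - n ** h ** matrix_inv g) ** g \<in> lat (of_nat df * of_nat (df * d))"
      by (rule lat_mult[OF 1(1) g])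
    thus ?thesis using g that(1) by (simp add: matrix_diff_mult matrix_cancel mult.assoc)
  qed
  have rep: "det (snd (coset_rep D)) > 0" if "D \<in> PC" for D
    using P.coset_rep_carrier[of D] that by auto
  {
    assume nz: "P.conv f F (m, g) \<noteq> 0"
    hence g: "det g > 0" by (auto simp: P.conv_def split: if_splits)
    have "\<exists>D\<in>PC. f ((m, g) \<cdot> Pinv (coset_rep D)) * F (coset_rep D) \<noteq> 0"
    proof (rule ccontr)
      assume "\<not> ?thesis"
      hence "P.conv f F (m, g) = 0" using g by (simp add: P.conv_def infsum_0 del: P_group_simps(2))
      thus False using nz by simp
    qed
    then obtain D where "D \<in> PC" "f ((m, g) \<cdot> Pinv (coset_rep D)) * F (coset_rep D) \<noteq> 0"
      by blast
    thus "g \<in> lat (of_nat (df * d))"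
      using key[OF g rep, of D m "fst (coset_rep D)"] by simp
  }
  {
    assume N: "df * df * d dvd N" and x: "x \<in> carrier P_group"
    obtain m g where mg: "x = (m, g)" "det g > 0" using x by (cases x) auto
    have "f (x \<cdot> Pinv (coset_rep D)) * lat_cut N F (coset_rep D) =
        (if m ** g \<in> lat (of_nat N) then 1 else 0) *
          (f (x \<cdot> Pinv (coset_rep D)) * F (coset_rep D))" if D: "D \<in> P.RC" for D
    proof (cases "f (x \<cdot> Pinv (coset_rep D)) * F (coset_rep D) = 0")
      case False
      obtain n h where nh: "coset_rep D = (n, h)" by fastforce
      have h: "det h > 0" using rep[of D] D by (simp add: nh)
      have "m ** g - n ** h \<in> lat (of_nat N)"
        using key[OF mg(2) h, of m n] False lat_dvd[OF _ N] by (simp add: nh mg(1) del: P_group_simps(2))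
      hence "m ** g \<in> lat (of_nat N) \<longleftrightarrow> n ** h \<in> lat (of_nat N)"
        using lat_add[of "m ** g - n ** h" _ "n ** h"] lat_diff[of "m ** g" _ "m ** g - n ** h"] by auto
      thus ?thesis by (simp add: nh lat_cut_def)
    next
      case True
      thus ?thesis by (auto simp: lat_cut_def split: prod.splits)
    qed
    hence "P.conv f (lat_cut N F) x = (if m ** g \<in> lat (of_nat N) then 1 else 0) * P.conv f F x"
      using x unfolding P.conv_def
      by (simp only: if_True infsum_cmult_right'[symmetric] cong: infsum_cong)
    thus "P.conv f (lat_cut N F) x = lat_cut N (P.conv f F) x" by (simp add: mg(1) lat_cut_def)
  }
qed

section \<open>Cut-off eigenfunctions\<close>

lemma of_rat_eq_of_real: "(of_rat r :: complex) = of_real (of_rat r)"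
proof -
  obtain a b where "r = of_int a / of_int b" "b \<noteq> 0" by (rule rat_fraction)
  thus ?thesis by (simp add: of_rat_divide)
qed

lemma cmod_of_rat: "cmod (of_rat r) = \<bar>of_rat r\<bar>"
  by (simp add: of_rat_eq_of_real)

text \<open>Polarization: norms of differences give the real part of the inner product, and
  multiplying \<open>\<xi>\<close> by \<open>\<i>\<close> gives the imaginary part.\<close>

lemma isometry_preserves_inner:
  assumes T: "\<And>\<xi>. \<xi> \<in> ell2 Y \<Longrightarrow> T \<xi> \<in> ell2 X"
    "\<And>\<xi>. \<xi> \<in> ell2 Y \<Longrightarrow> ell2_norm X (T \<xi>) = c * ell2_norm Y \<xi>"
    "\<And>\<xi> \<eta>. \<xi> \<in> ell2 Y \<Longrightarrow> \<eta> \<in> ell2 Y \<Longrightarrow> T (\<lambda>i. \<xi> i - \<eta> i) = (\<lambda>i. T \<xi> i - T \<eta> i)"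
    "\<And>a \<xi>. \<xi> \<in> ell2 Y \<Longrightarrow> T (\<lambda>i. a * \<xi> i) = (\<lambda>i. a * T \<xi> i)"
    and xi: "\<xi> \<in> ell2 Y" and eta: "\<eta> \<in> ell2 Y"
  shows "ell2_inner X (T \<xi>) (T \<eta>) = of_real (c\<^sup>2) * ell2_inner Y \<xi> \<eta>"
proof -
  have norm_diff: "(ell2_norm Z (\<lambda>i. \<alpha> i - \<beta> i))\<^sup>2 =
      (ell2_norm Z \<alpha>)\<^sup>2 + (ell2_norm Z \<beta>)\<^sup>2 - 2 * Re (ell2_inner Z \<alpha> \<beta>)"
    if ab: "\<alpha> \<in> ell2 Z" "\<beta> \<in> ell2 Z" for Z :: "'z set" and \<alpha> \<beta>
  proof -
    have d: "(\<lambda>i. \<alpha> i - \<beta> i) \<in> ell2 Z" by (rule ell2_diff[OF ab])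
    have "of_real ((ell2_norm Z (\<lambda>i. \<alpha> i - \<beta> i))\<^sup>2) =
        ell2_inner Z \<alpha> \<alpha> - ell2_inner Z \<alpha> \<beta> - (ell2_inner Z \<beta> \<alpha> - ell2_inner Z \<beta> \<beta>)"
      unfolding ell2_inner_self[OF d, symmetric] ell2_inner_diff_left[OF ab d]
      by (simp add: ell2_inner_diff_right[OF _ ab] ab)
    also have "\<dots> = of_real ((ell2_norm Z \<alpha>)\<^sup>2 + (ell2_norm Z \<beta>)\<^sup>2)
        - (ell2_inner Z \<alpha> \<beta> + cnj (ell2_inner Z \<alpha> \<beta>))"
      by (simp add: ell2_inner_self ab ell2_inner_commute[of Z \<beta> \<alpha>])
    finally have "of_real ((ell2_norm Z (\<lambda>i. \<alpha> i - \<beta> i))\<^sup>2) =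
      complex_of_real ((ell2_norm Z \<alpha>)\<^sup>2 + (ell2_norm Z \<beta>)\<^sup>2 - 2 * Re (ell2_inner Z \<alpha> \<beta>))"
      by (simp add: complex_add_cnj)
    thus ?thesis by (simp only: of_real_eq_iff)
  qed
  have re: "Re (ell2_inner X (T \<xi>) (T \<eta>)) = c\<^sup>2 * Re (ell2_inner Y \<xi> \<eta>)"
    if xi: "\<xi> \<in> ell2 Y" and eta: "\<eta> \<in> ell2 Y" for \<xi> \<eta>
  proof -
    have "(c * ell2_norm Y (\<lambda>i. \<xi> i - \<eta> i))\<^sup>2 = (c * ell2_norm Y \<xi>)\<^sup>2 + (c * ell2_norm Y \<eta>)\<^sup>2
        - 2 * Re (ell2_inner X (T \<xi>) (T \<eta>))"
      using norm_diff[OF T(1)[OF xi] T(1)[OF eta]]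
      unfolding T(3)[OF xi eta, symmetric] T(2)[OF ell2_diff[OF xi eta]] T(2)[OF xi] T(2)[OF eta] .
    moreover have "c\<^sup>2 * (ell2_norm Y (\<lambda>i. \<xi> i - \<eta> i))\<^sup>2 = c\<^sup>2 * ((ell2_norm Y \<xi>)\<^sup>2 + (ell2_norm Y \<eta>)\<^sup>2
        - 2 * Re (ell2_inner Y \<xi> \<eta>))"
      by (simp only: norm_diff[OF xi eta])
    ultimately show ?thesis by (simp add: power_mult_distrib algebra_simps)
  qed
  have inner_i: "ell2_inner Z (\<lambda>i. \<i> * \<alpha> i) \<beta> = \<i> * ell2_inner Z \<alpha> \<beta>" for Z :: "'z set" and \<alpha> \<beta>
    by (simp add: ell2_inner_def mult.assoc infsum_cmult_right')
  show ?thesis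
    using re[OF xi eta] re[OF ell2_scale[OF xi, of "\<i>"] eta] T(4)[OF xi, of "\<i>"]
    by (simp add: complex_eq_iff inner_i)
qed

lemma cmod_of_rat_power2: "(cmod (of_rat r))\<^sup>2 = (of_rat r)\<^sup>2"
  unfolding cmod_of_rat power2_abs ..

lemma
  fixes F :: "rat_mat \<times> rat_mat \<Rightarrow> real"
  assumes F: "P.left_invariant F" and a: "det a > 0"
  shows has_sum_translate: "((\<lambda>C. F (coset_rep C \<cdot> (0, a))) has_sum s) P.RC \<longleftrightarrow>
    ((\<lambda>C. F (coset_rep C)) has_sum s) P.RC"
  unfolding has_sum_iff
  using P.summable_translate[OF F, of "(0, a)"] P.infsum_translate[OF F, of "(0, a)"] a
  by (simp del: P_group_simps(2))

context matrix_pairing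
begin

text \<open>The matrices \<open>s a^-1\<close> are the second components at which
  \<open>twisted a \<xi>\<close> can be nonzero, so this is the restriction required by
  \<open>lat_cut_left_invariant\<close>. For \<open>a = 1\<close> it holds automatically, because
  \<open>s\<close> is integral.\<close>

definition supported :: "rat_mat \<Rightarrow> nat \<Rightarrow> (rat_mat set \<Rightarrow> complex) \<Rightarrow> bool" where
  "supported a d \<xi> \<longleftrightarrow> (\<forall>s\<in>Mat2Zpos. \<xi> (Gcoset s) \<noteq> 0 \<longrightarrow> s ** matrix_inv a \<in> lat (of_nat d))"

lemma twisted_support:
  assumes "supported a d \<xi>" "det a > 0" "twisted a \<xi> (m, g) \<noteq> 0"
  shows "g \<in> lat (of_nat d)"
proof -
  have "g ** a \<in> Mat2Zpos" "\<xi> (Gcoset (g ** a)) \<noteq> 0"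
    using assms(3) by (auto simp: twisted_eq eigen_def split: if_splits)
  hence "g ** a ** matrix_inv a \<in> lat (of_nat d)" using assms(1) by (auto simp: supported_def)
  thus ?thesis using assms(2) by (simp add: matrix_cancel)
qed

lemma supported_mono: "supported a d \<xi> \<Longrightarrow> d dvd e \<Longrightarrow> supported a e \<xi>"
  using lat_dvd by (auto simp: supported_def)

lemma cut_twisted_left_invariant:
  "supported a N \<xi> \<Longrightarrow> det a > 0 \<Longrightarrow> P.left_invariant (lat_cut N (twisted a \<xi>))"
  by (rule lat_cut_left_invariant[OF twisted_left_invariant]) (auto intro: twisted_support)

text \<open>After a translation by the inverse of \<open>a\<close>, the fibre over the coset of
  \<open>g\<close> consists of the classes \<open>m\<close> with \<open>m k\<close> integral for
  \<open>k = N g a^-1\<close>, an integer matrix by \<open>supported\<close>. There are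
  \<open>(det k)^2 = N^4 (det g)^2 / (det a)^2\<close> of them, and the squared weight
  \<open>1 / (det g)^2\<close> in \<open>eigen\<close> removes the dependence on \<open>g\<close>.
  Stated with \<open>has_sum\<close>, the equivalence transports summability as well as the
  value.\<close>

lemma has_sum_cut_twisted:
  assumes a: "det a > 0" and N: "N > 0" and supp: "supported a N \<xi>"
  shows "((\<lambda>C. (cmod (lat_cut N (twisted a \<xi>) (coset_rep C)))\<^sup>2) has_sum s) P.RC \<longleftrightarrow>
    ((\<lambda>D. (real N ^ 2 / of_rat (det a))\<^sup>2 * (cmod (\<xi> D))\<^sup>2) has_sum s) Gamma_mod_S"
proof -
  define b where "b = matrix_inv a"
  have b: "det b > 0" "det b = 1 / det a" using a by (simp_all add: b_def det_matrix_inv)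
  define K where "K = (\<lambda>x. (cmod (lat_cut N (twisted a \<xi>) (x \<cdot> (0, b))))\<^sup>2)"
  define c where "c = (real N ^ 2 / of_rat (det a))\<^sup>2"
  have F: "P.left_invariant (\<lambda>x. (cmod (lat_cut N (twisted a \<xi>) x))\<^sup>2)"
    using cut_twisted_left_invariant[OF supp a] by (simp add: P.left_invariant_def)
  have K: "P.left_invariant K"
    unfolding K_def using P.left_invariant_translate[OF F, of "(0, b)"] b by simp
  have K_eq: "K (m, g) = (if g \<in> Mat2Zpos \<and> m ** (g ** b) \<in> lat (of_nat N)
      then (of_rat (1 / det g))\<^sup>2 * (cmod (\<xi> (Gcoset g)))\<^sup>2 else 0)" for m g
    unfolding K_def lat_cut_def eigen_def using a
    by (simp add: twisted_eq eigen_def b_def matrix_cancel norm_mult cmod_psi power_mult_distrib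
        cmod_of_rat_power2 del: of_rat_divide)
  have "((\<lambda>C. (cmod (lat_cut N (twisted a \<xi>) (coset_rep C)))\<^sup>2) has_sum s) P.RC \<longleftrightarrow>
      ((\<lambda>C. K (coset_rep C)) has_sum s) P.RC"
    unfolding K_def by (rule has_sum_translate[OF F b(1), symmetric])
  also have "\<dots> \<longleftrightarrow> ((\<lambda>(D, M). K (coset_rep M, coset_rep D)) has_sum s) (GC \<times> Mat2Q_mod_Mat2Z)"
    unfolding P_group_simps(1) by (rule has_sum_P_cosets[OF K])
  also have "\<dots> \<longleftrightarrow>
      ((\<lambda>(D, M). K (coset_rep M, coset_rep D)) has_sum s) (Gamma_mod_S \<times> Mat2Q_mod_Mat2Z)"
    by (rule has_sum_cong_neutral) (auto simp: K_eq Gamma_mod_S_iff dest: Gamma_mod_S_rep(2) split: if_splits)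
  also have "\<dots> \<longleftrightarrow> ((\<lambda>D. c * (cmod (\<xi> D))\<^sup>2) has_sum s) Gamma_mod_S"
  proof -
    have inner: "((\<lambda>M. case (D, M) of (D, M) \<Rightarrow> K (coset_rep M, coset_rep D)) has_sum
        c * (cmod (\<xi> D))\<^sup>2) Mat2Q_mod_Mat2Z" if D: "D \<in> Gamma_mod_S" for D
    proof (cases "\<xi> D = 0")
      case True
      hence "K (coset_rep M, coset_rep D) = 0" for M
        using Gamma_mod_S_rep(3)[OF D] by (simp add: K_eq)
      thus ?thesis using True by simp
    next
      case False
      define g where "g = coset_rep D"
      have g: "g \<in> Mat2Zpos" "Gcoset g = D" using Gamma_mod_S_rep[OF D] by (simp_all add: g_def)
      have dg: "det g > 0" using g(1) by (simp add: Mat2Zpos_def)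
      define k where "k = smat (of_nat N) (g ** b)"
      have k: "k \<in> Mat2Z" using supp g False by (auto simp: k_def smat_in_Mat2Z supported_def b_def)
      have det_k: "det k = of_nat N ^ 2 * det g / det a" by (simp add: k_def det_smat det_mul b(2))
      hence k0: "det k > 0" using N dg a by simp
      define B where "B = {M\<in>Mat2Q_mod_Mat2Z. coset_rep M ** k \<in> Mat2Z}"
      note card = card_zclass_mult_int[OF k k0, folded B_def]
      have B_iff: "coset_rep M ** (g ** b) \<in> lat (of_nat N) \<longleftrightarrow> coset_rep M ** k \<in> Mat2Z" for M
        by (simp add: k_def smat_mult_right smat_in_Mat2Z)
      have "real (card B) = of_rat ((det k)\<^sup>2)" unfolding card(2)[symmetric] by simp
      hence cB: "real (card B) * (of_rat (1 / det g))\<^sup>2 = c"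
        using dg a by (simp add: det_k c_def of_rat_mult of_rat_divide of_rat_power field_simps)
      have "(\<Sum>M\<in>B. (of_rat (1 / det g))\<^sup>2 * (cmod (\<xi> D))\<^sup>2) = c * (cmod (\<xi> D))\<^sup>2"
        by (simp add: cB[symmetric])
      thus ?thesis
        by (intro has_sum_finite_neutralI[OF card(1)])
          (auto simp: B_def K_eq B_iff g g_def[symmetric])
    qed
    have nonneg: "K x \<ge> 0" for x by (simp add: K_def)
    show ?thesis
    proof
      assume "((\<lambda>(D, M). K (coset_rep M, coset_rep D)) has_sum s) (Gamma_mod_S \<times> Mat2Q_mod_Mat2Z)"
      thus "((\<lambda>D. c * (cmod (\<xi> D))\<^sup>2) has_sum s) Gamma_mod_S"
        by (rule has_sum_Sigma'[OF _ inner])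
    next
      assume r: "((\<lambda>D. c * (cmod (\<xi> D))\<^sup>2) has_sum s) Gamma_mod_S"
      have "(\<lambda>(D, M). K (coset_rep M, coset_rep D)) summable_on (Gamma_mod_S \<times> Mat2Q_mod_Mat2Z)"
        by (rule summable_on_SigmaI[OF inner has_sum_imp_summable[OF r]]) (auto simp: nonneg)
      from has_sum_SigmaI[OF inner r this]
      show "((\<lambda>(D, M). K (coset_rep M, coset_rep D)) has_sum s) (Gamma_mod_S \<times> Mat2Q_mod_Mat2Z)"
        by simp
    qed
  qed
  finally show ?thesis by (simp add: c_def)
qed

definition embed :: "rat_mat \<Rightarrow> nat \<Rightarrow> (rat_mat set \<Rightarrow> complex) \<Rightarrow> (rat_mat \<times> rat_mat) set \<Rightarrow> complex" where
  "embed a N \<xi> = P.on_cosets (lat_cut N (twisted a \<xi>))"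

text \<open>The equivalence matters in the direction from the image to \<open>\<xi>\<close>: for
  \<open>pie f \<xi>\<close> and for the vectors from \<open>component_eq_embed\<close>,
  square-summability is first known for the image under \<open>embed\<close>.\<close>

lemma
  assumes a: "det a > 0" and N: "N > 0" and supp: "supported a N \<xi>"
    and out: "\<And>D. D \<notin> Gamma_mod_S \<Longrightarrow> \<xi> D = 0"
  shows embed_ell2_iff: "embed a N \<xi> \<in> ell2 P.RC \<longleftrightarrow> \<xi> \<in> ell2 Gamma_mod_S"
    and embed_norm: "ell2_norm P.RC (embed a N \<xi>) =
      real N ^ 2 / of_rat (det a) * norm_S \<xi>"
proof -
  define c where "c = real N ^ 2 / of_rat (det a)"
  have c: "c > 0" using N a by (simp add: c_def)
  note hs = has_sum_cut_twisted[OF a N supp, folded c_def]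
  have "embed a N \<xi> \<in> ell2 P.RC \<longleftrightarrow>
      (\<lambda>C. (cmod (lat_cut N (twisted a \<xi>) (coset_rep C)))\<^sup>2) summable_on P.RC"
    unfolding embed_def by (rule P.on_cosets_in_ell2)
  also have "\<dots> \<longleftrightarrow> (\<lambda>D. c\<^sup>2 * (cmod (\<xi> D))\<^sup>2) summable_on Gamma_mod_S"
    unfolding summable_on_def hs ..
  also have "\<dots> \<longleftrightarrow> (\<lambda>D. (cmod (\<xi> D))\<^sup>2) summable_on Gamma_mod_S"
    using c by (simp add: summable_on_cmult_right')
  also have "\<dots> \<longleftrightarrow> \<xi> \<in> ell2 Gamma_mod_S" using out by (simp add: ell2_def)
  finally show "embed a N \<xi> \<in> ell2 P.RC \<longleftrightarrow> \<xi> \<in> ell2 Gamma_mod_S" .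
  have "(ell2_norm P.RC (embed a N \<xi>))\<^sup>2 =
      (\<Sum>\<^sub>\<infinity>C\<in>P.RC. (cmod (lat_cut N (twisted a \<xi>) (coset_rep C)))\<^sup>2)"
    unfolding embed_def by (rule P.ell2_norm_on_cosets)
  also have "\<dots> = (\<Sum>\<^sub>\<infinity>D\<in>Gamma_mod_S. c\<^sup>2 * (cmod (\<xi> D))\<^sup>2)"
  proof (cases "(\<lambda>D. c\<^sup>2 * (cmod (\<xi> D))\<^sup>2) summable_on Gamma_mod_S")
    case True
    thus ?thesis by (intro infsumI hs[THEN iffD2] has_sum_infsum)
  next
    case False
    moreover from False have "\<not> (\<lambda>C. (cmod (lat_cut N (twisted a \<xi>) (coset_rep C)))\<^sup>2) summable_on P.RC"
      unfolding summable_on_def hs .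
    ultimately show ?thesis by (simp only: infsum_not_exists not_False_eq_True)
  qed
  also have "\<dots> = (c * norm_S \<xi>)\<^sup>2"
    by (simp add: infsum_cmult_right' power_mult_distrib ell2_norm_power2)
  finally show "ell2_norm P.RC (embed a N \<xi>) = c * norm_S \<xi>"
    using c by (subst (asm) power2_eq_iff_nonneg) auto
qed

lemma
  assumes a: "det a > 0" and N: "N > 0" and supp: "supported a N \<xi>" and xi: "\<xi> \<in> ell2 Gamma_mod_S"
  shows embed_in_ell2: "embed a N \<xi> \<in> ell2 P.RC"
    and embed_norm_ell2: "ell2_norm P.RC (embed a N \<xi>) =
      real N ^ 2 / of_rat (det a) * norm_S \<xi>"
proof -
  have out: "\<And>D. D \<notin> Gamma_mod_S \<Longrightarrow> \<xi> D = 0" by (rule ell2_eq_0[OF xi])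
  show "embed a N \<xi> \<in> ell2 P.RC" using embed_ell2_iff[OF a N supp out] xi by simp
  show "ell2_norm P.RC (embed a N \<xi>) = real N ^ 2 / of_rat (det a) * norm_S \<xi>"
    by (rule embed_norm[OF a N supp out])
qed

lemma pie_out: "D \<notin> Gamma_mod_S \<Longrightarrow> pie f \<xi> D = 0"
  by (simp add: pie_def)

text \<open>Convolution by \<open>f\<close> enlarges denominators: \<open>\<xi>\<close> is supported
  with \<open>d\<close>, \<open>pie f \<xi>\<close> with \<open>df * d\<close>. Taking
  \<open>N\<close> to be a multiple of \<open>df * df * d\<close> makes the same cut-off legitimate
  for both.\<close>

lemma
  assumes f: "f \<in> HP"
    and df: "\<And>m k. f (m, k) \<noteq> 0 \<Longrightarrow> m \<in> lat (of_nat df) \<and> k \<in> lat (of_nat df)"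
    and a: "det a > 0" and N: "N > 0" "df * df * d dvd N"
    and xi: "\<xi> \<in> ell2 Gamma_mod_S" and supp: "supported a d \<xi>"
  shows regular_rep_embed:
      "P_regular f (embed a N \<xi>) = embed a N (pie f \<xi>)"
    and pie_ell2: "pie f \<xi> \<in> ell2 Gamma_mod_S"
    and pie_supported: "supported a N (pie f \<xi>)"
proof -
  have dN: "d dvd N" "df * d dvd N" using N(2) by (auto dest: dvd_mult_right dvd_mult_left simp: mult.assoc)
  have suppN: "supported a N \<xi>" by (rule supported_mono[OF supp dN(1)])
  have mem: "embed a N \<xi> \<in> ell2 P.RC" by (rule embed_in_ell2[OF a N(1) suppN xi])
  have eq: "P.conv f (lat_cut N (twisted a \<xi>)) x = lat_cut N (twisted a (pie f \<xi>)) x"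
    if x: "x \<in> carrier P_group" for x
  proof -
    have "P.conv f (lat_cut N (twisted a \<xi>)) x = lat_cut N (P.conv f (twisted a \<xi>)) x"
      by (rule conv_lat_cut[OF f df twisted_support[OF supp a] N(2) x])
    thus ?thesis using conv_twisted[OF f a x] x by (auto simp: lat_cut_def split: prod.splits)
  qed
  have "P_regular f (embed a N \<xi>) =
      P.on_cosets (P.conv f (lat_cut N (twisted a \<xi>)))"
    using mem unfolding embed_def by (rule P.regular_rep_on_cosets)
  also have "\<dots> = embed a N (pie f \<xi>)"
    unfolding embed_def P.on_cosets_def using eq P.coset_rep_carrier by fastforce
  finally show rep: "P_regular f (embed a N \<xi>) = embed a N (pie f \<xi>)" .
  show sp: "supported a N (pie f \<xi>)"
    unfolding supported_def
  proof (intro ballI impI)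
    fix s assume s: "s \<in> Mat2Zpos" "pie f \<xi> (Gcoset s) \<noteq> 0"
    have ds: "det s > 0" using s(1) by (simp add: Mat2Zpos_def)
    have x: "(0, s ** matrix_inv a) \<in> carrier P_group" using ds a by (simp add: det_mul det_matrix_inv)
    have "twisted a (pie f \<xi>) (0, s ** matrix_inv a) \<noteq> 0"
      using s ds a by (simp add: twisted_eq matrix_cancel eigen_def)
    hence nz: "P.conv f (twisted a \<xi>) (0, s ** matrix_inv a) \<noteq> 0" by (simp add: conv_twisted[OF f a x])
    have "s ** matrix_inv a \<in> lat (of_nat (df * d))"
      by (rule conv_support[OF f df twisted_support[OF supp a] nz])
    thus "s ** matrix_inv a \<in> lat (of_nat N)" by (rule lat_dvd[OF _ dN(2)])
  qed
  have "embed a N (pie f \<xi>) \<in> ell2 P.RC"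
    unfolding rep[symmetric] by (rule bounded_ops_ell2[OF P.regular_rep_bounded[OF f] mem])
  thus "pie f \<xi> \<in> ell2 Gamma_mod_S" using embed_ell2_iff[OF a N(1) sp, OF pie_out] by simp
qed

lemma supported_1: "supported (mat 1) 1 \<xi>"
  by (simp add: supported_def Mat2Zpos_def lat_1)

lemma supported_mat_1: "supported (mat 1) N \<xi>"
  by (rule supported_mono[OF supported_1]) simp

text \<open>The case \<open>a = 1\<close>, where every \<open>\<xi>\<close> is supported with
  denominator 1. Both sides of the inequality for the regular representation are scaled by the same
  \<open>N ^ 2\<close>, so the bound \<open>K\<close> is inherited although \<open>N\<close> depends
  on \<open>f\<close>.\<close>

lemma
  assumes f: "f \<in> HP" and xi: "\<xi> \<in> ell2 Gamma_mod_S"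
  shows pie_in_ell2: "pie f \<xi> \<in> ell2 Gamma_mod_S"
    and pie_norm_le: "\<And>K. (\<And>\<zeta>. \<zeta> \<in> ell2 P.RC \<Longrightarrow>
        ell2_norm P.RC (P_regular f \<zeta>) \<le> K * ell2_norm P.RC \<zeta>) \<Longrightarrow>
      norm_S (pie f \<xi>) \<le> K * norm_S \<xi>"
proof -
  obtain df :: nat where df: "df > 0"
    "\<And>m k. f (m, k) \<noteq> 0 \<Longrightarrow> m \<in> lat (of_nat df) \<and> k \<in> lat (of_nat df)"
    using hecke_denominator[OF f] by blast
  define N where "N = df * df"
  have N: "N > 0" "df * df * 1 dvd N" using df(1) by (simp_all add: N_def)
  have d1: "det (mat 1 :: rat_mat) > 0" by simp
  have emb: "P_regular f (embed (mat 1) N \<xi>) = embed (mat 1) N (pie f \<xi>)"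
    by (rule regular_rep_embed[OF f df(2) d1 N xi supported_1])
  show mem: "pie f \<xi> \<in> ell2 Gamma_mod_S" by (rule pie_ell2[OF f df(2) d1 N xi supported_1])
  fix K assume K: "\<And>\<zeta>. \<zeta> \<in> ell2 P.RC \<Longrightarrow>
    ell2_norm P.RC (P_regular f \<zeta>) \<le> K * ell2_norm P.RC \<zeta>"
  have "embed (mat 1) N \<xi> \<in> ell2 P.RC"
    by (rule embed_in_ell2[OF d1 N(1) supported_mat_1 xi])
  from K[OF this] have "ell2_norm P.RC (embed (mat 1) N (pie f \<xi>)) \<le> K * ell2_norm P.RC (embed (mat 1) N \<xi>)"
    unfolding emb .
  hence "real N ^ 2 * norm_S (pie f \<xi>) \<le> K * (real N ^ 2 * norm_S \<xi>)"
    unfolding embed_norm_ell2[OF d1 N(1) supported_mat_1 xi]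
      embed_norm_ell2[OF d1 N(1) supported_mat_1 mem] by simp
  hence "real N ^ 2 * norm_S (pie f \<xi>) \<le> real N ^ 2 * (K * norm_S \<xi>)"
    by (simp add: mult_ac)
  thus "norm_S (pie f \<xi>) \<le> K * norm_S \<xi>"
    using N(1) by (simp add: mult_le_cancel_left_pos)
qed

section \<open>Algebraic properties of \<open>pie\<close>, and the operator on
  \<open>\<Gamma>\<close>-cosets\<close>

lemma eigen_add: "eigen (\<lambda>D. \<xi> D + \<eta> D) = (\<lambda>x. eigen \<xi> x + eigen \<eta> x)"
  by (auto simp: eigen_def fun_eq_iff distrib_left)

lemma eigen_diff: "eigen (\<lambda>D. \<xi> D - \<eta> D) = (\<lambda>x. eigen \<xi> x - eigen \<eta> x)"
  by (auto simp: eigen_def fun_eq_iff right_diff_distrib)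

lemma eigen_scale: "eigen (\<lambda>D. c * \<xi> D) = (\<lambda>x. c * eigen \<xi> x)"
  by (auto simp: eigen_def fun_eq_iff)

lemma pie_add: "f \<in> HP \<Longrightarrow> pie f (\<lambda>D. \<xi> D + \<eta> D) = (\<lambda>D. pie f \<xi> D + pie f \<eta> D)"
  by (auto simp: pie_def fun_eq_iff eigen_add P.conv_add_right distrib_left)

lemma pie_scale: "pie f (\<lambda>D. c * \<xi> D) = (\<lambda>D. c * pie f \<xi> D)"
  by (auto simp: pie_def fun_eq_iff eigen_scale P.conv_scale_right)

lemma pie_hecke_add:
  "f \<in> HP \<Longrightarrow> g \<in> HP \<Longrightarrow>
    pie (\<lambda>x. f x + g x) \<xi> = (\<lambda>D. pie f \<xi> D + pie g \<xi> D)"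
  by (auto simp: pie_def fun_eq_iff P.conv_add distrib_left)

lemma pie_hecke_scale: "pie (\<lambda>x. c * f x) \<xi> = (\<lambda>D. c * pie f \<xi> D)"
  by (auto simp: pie_def fun_eq_iff P.conv_scale)

lemma pie_conv:
  assumes f: "f \<in> HP" and g: "g \<in> HP"
  shows "pie (P.conv f g) \<xi> = pie f (pie g \<xi>)"
proof -
  have "P.conv (P.conv f g) (eigen \<xi>) = P.conv f (P.conv g (eigen \<xi>))"
    by (rule P.conv_conv[OF f g eigen_left_invariant, symmetric])
  also have "\<dots> = P.conv f (eigen (pie g \<xi>))"
    unfolding P.conv_def[of f] using conv_eigen[OF g P.coset_rep_carrier]
    by (auto intro!: ext infsum_cong simp del: P_group_simps)
  finally show ?thesis by (simp add: pie_def fun_eq_iff)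
qed

definition pi_op :: "(rat_mat \<times> rat_mat \<Rightarrow> complex) \<Rightarrow> rat_mat set operator" where
  "pi_op f = (\<lambda>\<xi>\<in>ell2 Gamma_mod_S. pie f \<xi>)"

lemma pi_op_bounded:
  assumes f: "f \<in> HP" shows "pi_op f \<in> bounded_ops Gamma_mod_S"
proof -
  obtain K where K: "\<And>\<zeta>. \<zeta> \<in> ell2 P.RC \<Longrightarrow>
    ell2_norm P.RC (P_regular f \<zeta>) \<le> K * ell2_norm P.RC \<zeta>"
    using bounded_ops_bound[OF P.regular_rep_bounded[OF f]] by blast
  show ?thesis
  proof (rule bounded_opsI[where K = K])
    fix \<xi> assume xi: "\<xi> \<in> ell2 Gamma_mod_S"
    show "norm_S (pi_op f \<xi>) \<le> K * norm_S \<xi>"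
      using pie_norm_le[OF f xi K] xi by (simp add: pi_op_def)
  qed (simp_all add: pi_op_def pie_in_ell2[OF f] pie_add[OF f] pie_scale ell2_add ell2_scale)
qed

text \<open>One \<open>N\<close> is chosen that suits both \<open>f\<close> and
  \<open>hecke_star f\<close>. The embedding multiplies inner products by a positive constant, so
  the adjoint relation can be pulled back from the regular representation.\<close>

lemma pi_op_adjoint:
  assumes f: "f \<in> HP"
  shows "is_adjoint Gamma_mod_S (pi_op f) (pi_op (P.hecke_star f))"
  unfolding is_adjoint_def
proof (intro ballI)
  fix \<xi> \<eta> assume xi: "\<xi> \<in> ell2 Gamma_mod_S" and eta: "\<eta> \<in> ell2 Gamma_mod_S"
  let ?g = "P.hecke_star f"
  have g: "?g \<in> HP" by (rule P.hecke_star_in[OF f])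
  obtain df :: nat where df: "df > 0"
    "\<And>m k. f (m, k) \<noteq> 0 \<Longrightarrow> m \<in> lat (of_nat df) \<and> k \<in> lat (of_nat df)"
    using hecke_denominator[OF f] by blast
  obtain dg :: nat where dg: "dg > 0"
    "\<And>m k. ?g (m, k) \<noteq> 0 \<Longrightarrow> m \<in> lat (of_nat dg) \<and> k \<in> lat (of_nat dg)"
    using hecke_denominator[OF g] by blast
  define N where "N = df * df * (dg * dg)"
  have N: "N > 0" "df * df * 1 dvd N" "dg * dg * 1 dvd N" using df(1) dg(1) by (simp_all add: N_def)
  have d1: "det (mat 1 :: rat_mat) > 0" by simp
  let ?T = "embed (mat 1) N" and ?lam = "P_regular"
  have T_mem: "?T \<xi> \<in> ell2 P.RC" if "\<xi> \<in> ell2 Gamma_mod_S" for \<xi>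
    by (rule embed_in_ell2[OF d1 N(1) supported_mat_1 that])
  have T_norm: "ell2_norm P.RC (?T \<xi>) = real N ^ 2 * norm_S \<xi>"
    if "\<xi> \<in> ell2 Gamma_mod_S" for \<xi>
    using embed_norm_ell2[OF d1 N(1) supported_mat_1 that] by simp
  have inner: "ell2_inner P.RC (?T \<xi>) (?T \<eta>) = of_real ((real N ^ 2)\<^sup>2) * ell2_inner Gamma_mod_S \<xi> \<eta>"
    if "\<xi> \<in> ell2 Gamma_mod_S" "\<eta> \<in> ell2 Gamma_mod_S" for \<xi> \<eta>
    by (rule isometry_preserves_inner[OF T_mem T_norm _ _ that])
      (auto simp: embed_def P.on_cosets_def lat_cut_def twisted_def eigen_diff eigen_scale fun_eq_iff
        split: prod.splits)
  have emb: "?lam f (?T \<xi>) = ?T (pie f \<xi>)"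
    by (rule regular_rep_embed[OF f df(2) d1 N(1,2) xi supported_1])
  have emb': "?lam ?g (?T \<eta>) = ?T (pie ?g \<eta>)"
    by (rule regular_rep_embed[OF g dg(2) d1 N(1,3) eta supported_1])
  have "of_real ((real N ^ 2)\<^sup>2) * ell2_inner Gamma_mod_S (pie f \<xi>) \<eta> =
      ell2_inner P.RC (?lam f (?T \<xi>)) (?T \<eta>)"
    by (simp only: inner[OF pie_in_ell2[OF f xi] eta] emb)
  also have "\<dots> = ell2_inner P.RC (?T \<xi>) (?lam ?g (?T \<eta>))"
    using P.regular_rep_adjoint[OF f] T_mem[OF xi] T_mem[OF eta] unfolding is_adjoint_def by blast
  also have "\<dots> = of_real ((real N ^ 2)\<^sup>2) * ell2_inner Gamma_mod_S \<xi> (pie ?g \<eta>)"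
    by (simp only: inner[OF xi pie_in_ell2[OF g eta]] emb')
  finally show "ell2_inner Gamma_mod_S (pi_op f \<xi>) \<eta> = ell2_inner Gamma_mod_S \<xi> (pi_op ?g \<eta>)"
    using N(1) xi eta by (simp add: pi_op_def)
qed

end

section \<open>Finite Fourier decomposition\<close>

definition red :: "nat \<Rightarrow> rat_mat \<Rightarrow> rat_mat" where
  "red q m = (\<chi> i j. of_int (\<lfloor>m $ i $ j\<rfloor> mod int q))"

text \<open>Representatives of \<open>Mat_2(Z)\<close> modulo \<open>q Mat_2(Z)\<close>. They serve
  both as the elements of this finite group and as the indices of its characters.\<close>

definition mat_box :: "nat \<Rightarrow> rat_mat set" where
  "mat_box q = red q ` Mat2Z"

lemma red_Mat2Z: "red q m \<in> Mat2Z"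
  by (simp add: red_def Mat2Z_def)

lemma box_Mat2Z: "n \<in> mat_box q \<Longrightarrow> n \<in> Mat2Z"
  by (auto simp: mat_box_def red_Mat2Z)

lemma red_in_box: "m \<in> Mat2Z \<Longrightarrow> red q m \<in> mat_box q"
  by (simp add: mat_box_def)

lemma finite_box:
  assumes "q > 0" shows "finite (mat_box q)"
  unfolding mat_box_def
  by (rule finite_image_if_factors[OF finite_residues[OF assms]])
    (simp add: residues_def red_def vec_eq_iff forall_2)

lemma red_congruent:
  assumes "m \<in> Mat2Z" "q > 0" shows "red q m - m \<in> lat (1 / of_nat q)"
proof -
  have "1 / of_nat q * (red q m - m) $ i $ j \<in> \<int>" for i j
  proof -
    obtain k where k: "m $ i $ j = of_int k"
      using assms(1) unfolding Mat2Z_def by (blast elim: Ints_cases)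
    have "k mod int q - k = int q * (- (k div int q))"
      using mult_div_mod_eq[of "int q" k] by (simp add: algebra_simps)
    hence "(of_int (k mod int q) - of_int k :: rat) = of_nat q * of_int (- (k div int q))"
      by (simp only: of_int_diff[symmetric] of_int_mult of_int_of_nat_eq)
    thus ?thesis using assms(2) by (simp add: red_def k)
  qed
  thus ?thesis by (simp add: lat_def)
qed

lemma box_eq_if_congruent:
  assumes "n \<in> mat_box q" "n' \<in> mat_box q" "q > 0" "n - n' \<in> lat (1 / of_nat q)"
  shows "n = n'"
proof -
  have ex: "\<exists>k\<in>{0..<int q}. n $ i $ j = of_int k" if "n \<in> mat_box q" for n i j
    using that assms(3) by (auto simp: mat_box_def red_def)
  have "n $ i $ j = n' $ i $ j" for i j
  proof -
    obtain k l where k: "k \<in> {0..<int q}" "n $ i $ j = of_int k"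
      and l: "l \<in> {0..<int q}" "n' $ i $ j = of_int l"
      using ex[OF assms(1)] ex[OF assms(2)] by blast
    have "1 / of_nat q * (n - n') $ i $ j \<in> \<int>" using assms(4) by (simp add: lat_def)
    hence "(of_int k / of_int (int q) - of_int l / of_int (int q) :: rat) \<in> \<int>"
      by (simp add: k(2) l(2) diff_divide_distrib)
    thus ?thesis using fraction_diff_Ints[OF k(1) l(1)] k(2) l(2) by simp
  qed
  thus ?thesis by (simp add: vec_eq_iff)
qed

lemma box_shift_bij:
  assumes v: "v \<in> Mat2Z" and q: "q > 0"
  shows "bij_betw (\<lambda>n. red q (n + v)) (mat_box q) (mat_box q)"
proof -
  have sub: "(\<lambda>n. red q (n + v)) ` mat_box q \<subseteq> mat_box q"
    by (rule image_subsetI) (rule red_in_box[OF Mat2Z_add[OF box_Mat2Z v]])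
  have inj: "inj_on (\<lambda>n. red q (n + v)) (mat_box q)"
  proof (rule inj_onI)
    fix n n' assume n: "n \<in> mat_box q" "n' \<in> mat_box q" "red q (n + v) = red q (n' + v)"
    have "n - n' = (red q (n' + v) - (n' + v)) - (red q (n + v) - (n + v))" using n(3) by simp
    also have "\<dots> \<in> lat (1 / of_nat q)"
      by (intro lat_diff red_congruent Mat2Z_add box_Mat2Z[OF n(1)] box_Mat2Z[OF n(2)] v q)
    finally show "n = n'" by (rule box_eq_if_congruent[OF n(1,2) q])
  qed
  show ?thesis
    using endo_inj_surj[OF finite_box[OF q] sub inj] inj by (simp add: bij_betw_def)
qed

lemma has_sum_sum:
  fixes f :: "'b \<Rightarrow> 'a \<Rightarrow> real"
  assumes "\<And>b. b \<in> B \<Longrightarrow> (f b has_sum s b) A"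
  shows "((\<lambda>x. \<Sum>b\<in>B. f b x) has_sum (\<Sum>b\<in>B. s b)) A"
  using assms by (induction B rule: infinite_finite_induct) (auto intro: has_sum_add)

lemma parseval:
  fixes e :: "'n \<Rightarrow> 'b \<Rightarrow> complex"
  assumes B: "finite B" and A: "finite A"
    and orth: "\<And>n n'. n \<in> A \<Longrightarrow> n' \<in> A \<Longrightarrow> (\<Sum>b\<in>B. e n b * cnj (e n' b)) = (if n = n' then c else 0)"
  shows "(\<Sum>b\<in>B. of_real ((cmod (\<Sum>n\<in>A. e n b * \<phi> n))\<^sup>2)) = c * of_real (\<Sum>n\<in>A. (cmod (\<phi> n))\<^sup>2)"
proof -
  have "(\<Sum>b\<in>B. of_real ((cmod (\<Sum>n\<in>A. e n b * \<phi> n))\<^sup>2)) =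
      (\<Sum>b\<in>B. \<Sum>n\<in>A. \<Sum>n'\<in>A. (\<phi> n * cnj (\<phi> n')) * (e n b * cnj (e n' b)))"
    by (simp add: complex_norm_square sum_product mult_ac del: of_real_power)
  also have "\<dots> = (\<Sum>n\<in>A. \<Sum>n'\<in>A. \<Sum>b\<in>B. (\<phi> n * cnj (\<phi> n')) * (e n b * cnj (e n' b)))"
    by (subst sum.swap, rule sum.cong[OF refl], rule sum.swap)
  also have "\<dots> = (\<Sum>n\<in>A. \<Sum>n'\<in>A. (\<phi> n * cnj (\<phi> n')) * (if n = n' then c else 0))"
    by (intro sum.cong refl) (simp add: orth flip: sum_distrib_left)
  also have "\<dots> = (\<Sum>n\<in>A. (\<phi> n * cnj (\<phi> n)) * c)"
    using A by (simp add: if_distrib cong: if_cong)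
  also have "\<dots> = c * of_real (\<Sum>n\<in>A. (cmod (\<phi> n))\<^sup>2)"
    by (simp add: complex_norm_square sum_distrib_left mult.commute del: of_real_power)
  finally show ?thesis .
qed

context matrix_pairing
begin

text \<open>The pairing of \<open>Mat_2(Z)\<close> modulo \<open>q\<close> with itself induced by
  \<open>psi\<close>; it is well defined by \<open>ee_red_left\<close> and
  \<open>ee_red_right\<close>, and for fixed \<open>b\<close> it is a character in
  \<open>n\<close>.\<close>

definition ee :: "nat \<Rightarrow> rat_mat \<Rightarrow> rat_mat \<Rightarrow> complex" where
  "ee q n b = psi (smat (1 / of_nat q) (n ** b))"

lemma smat_add: "smat c (m + n) = smat c m + smat c n"
  by (simp add: vec_eq_iff algebra_simps)

lemma ee_add_left: "ee q (n + n') b = ee q n b * ee q n' b"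
  by (simp add: ee_def matrix_add_rdistrib_2 smat_add psi_add)

lemma ee_add_right: "ee q n (b + b') = ee q n b * ee q n b'"
  by (simp add: ee_def matrix_add_ldistrib smat_add psi_add)

lemma ee_minus_left: "ee q (- n) b = cnj (ee q n b)"
proof -
  have "smat (1 / of_nat q) (- n ** b) = - smat (1 / of_nat q) (n ** b)"
    by (simp add: vec_eq_iff matrix_minus_mult)
  thus ?thesis by (simp add: ee_def psi_minus)
qed

lemma ee_cnj: "ee q n b * cnj (ee q n b) = 1"
  by (simp add: ee_def psi_cnj)

lemma ee_period_left:
  assumes "n \<in> lat (1 / of_nat q)" "b \<in> Mat2Z" shows "ee q n b = 1"
  unfolding ee_def by (rule psi_int) (use lat_mult_int[OF assms] in \<open>simp add: smat_in_Mat2Z\<close>)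

lemma ee_period_right:
  assumes "n \<in> Mat2Z" "b \<in> lat (1 / of_nat q)" shows "ee q n b = 1"
  unfolding ee_def by (rule psi_int) (use lat_int_mult[OF assms] in \<open>simp add: smat_in_Mat2Z\<close>)

lemma ee_red_left:
  assumes "n \<in> Mat2Z" "b \<in> Mat2Z" "q > 0" shows "ee q (red q n) b = ee q n b"
  using ee_add_left[of q "red q n - n" n b] ee_period_left[OF red_congruent[OF assms(1,3)] assms(2)]
  by simp

lemma ee_red_right:
  assumes "n \<in> Mat2Z" "b \<in> Mat2Z" "q > 0" shows "ee q n (red q b) = ee q n b"
  using ee_add_right[of q n "red q b - b" b] ee_period_right[OF assms(1) red_congruent[OF assms(2,3)]]
  by simp

text \<open>For \<open>d = n - n'\<close> nonzero, shifting the summation by \<open>u\<close>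
  multiplies the sum by \<open>ee q d u\<close>. Some \<open>u\<close> makes this factor different
  from 1, since otherwise \<open>right_int\<close> would make \<open>d / q\<close> integral and
  force \<open>n = n'\<close>.\<close>

lemma ee_orthogonal:
  assumes n: "n \<in> mat_box q" "n' \<in> mat_box q" and q: "q > 0"
  shows "(\<Sum>b\<in>mat_box q. ee q n b * cnj (ee q n' b)) = (if n = n' then of_nat (card (mat_box q)) else 0)"
proof -
  define d where "d = n - n'"
  have d_int: "d \<in> Mat2Z" unfolding d_def by (rule Mat2Z_diff[OF box_Mat2Z[OF n(1)] box_Mat2Z[OF n(2)]])
  have eq: "ee q n b * cnj (ee q n' b) = ee q d b" for b
    using ee_add_left[of q n "- n'" b] by (simp add: ee_minus_left d_def)
  show ?thesis
  proof (cases "n = n'")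
    case True
    thus ?thesis by (simp add: ee_cnj)
  next
    case False
    have "\<exists>u\<in>Mat2Z. ee q d u \<noteq> 1"
    proof (rule ccontr)
      assume "\<not> ?thesis"
      hence "psi (smat (1 / of_nat q) d ** u) = 1" if "u \<in> Mat2Z" for u
        using that by (simp add: ee_def smat_mult_left)
      hence "smat (1 / of_nat q) d \<in> Mat2Z" by (rule right_int)
      hence "n - n' \<in> lat (1 / of_nat q)" by (simp add: smat_in_Mat2Z d_def)
      thus False using box_eq_if_congruent[OF n q] False by simp
    qed
    then obtain u where u: "u \<in> Mat2Z" "ee q d u \<noteq> 1" by blast
    have "(\<Sum>b\<in>mat_box q. ee q d b) = (\<Sum>b\<in>mat_box q. ee q d (red q (b + u)))"
      by (rule sum.reindex_bij_betw[OF box_shift_bij[OF u(1) q], symmetric])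
    also have "\<dots> = (\<Sum>b\<in>mat_box q. ee q d b * ee q d u)"
      by (intro sum.cong refl)
        (simp add: ee_red_right[OF d_int _ q] Mat2Z_add box_Mat2Z u(1) ee_add_right)
    also have "\<dots> = (\<Sum>b\<in>mat_box q. ee q d b) * ee q d u" by (simp add: sum_distrib_right)
    finally have "(\<Sum>b\<in>mat_box q. ee q d b) = 0" using u(2) by simp
    thus ?thesis using False by (simp add: eq)
  qed
qed

text \<open>
  The component of \<open>F\<close> under right translations by \<open>N\<^sup>-\<^sup>1 Mat\<^sub>2(\<int>)\<close> for the character with index \<open>b\<close>. If
  \<open>F\<close> is invariant under \<open>M Mat\<^sub>2(\<int>)\<close> and \<open>q = N M\<close>, these are all of its components.
\<close>

definition component :: "nat \<Rightarrow> nat \<Rightarrow> rat_mat \<Rightarrow> (rat_mat \<times> rat_mat \<Rightarrow> complex) \<Rightarrow>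
    rat_mat \<times> rat_mat \<Rightarrow> complex" where
  "component q N b F x = (\<Sum>n\<in>mat_box q. ee q n b * F (x \<cdot> (smat (1 / of_nat N) n, mat 1)))
     / of_nat (card (mat_box q))"

lemma card_box_pos: "q > 0 \<Longrightarrow> card (mat_box q) > 0"
  using finite_box red_in_box[OF Mat2Z_0] by (auto simp: card_gt_0_iff)

lemma component_parseval:
  assumes q: "q > 0"
  shows "(\<Sum>b\<in>mat_box q. (cmod (component q N b F x))\<^sup>2) =
    (\<Sum>n\<in>mat_box q. (cmod (F (x \<cdot> (smat (1 / of_nat N) n, mat 1))))\<^sup>2) / card (mat_box q)"
proof -
  define \<phi> where "\<phi> = (\<lambda>n. F (x \<cdot> (smat (1 / of_nat N) n, mat 1)))"
  define k where "k = real (card (mat_box q))"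
  have k: "k > 0" using card_box_pos[OF q] by (simp add: k_def)
  have "(\<Sum>b\<in>mat_box q. complex_of_real ((cmod (\<Sum>n\<in>mat_box q. ee q n b * \<phi> n))\<^sup>2)) =
      of_nat (card (mat_box q)) * of_real (\<Sum>n\<in>mat_box q. (cmod (\<phi> n))\<^sup>2)"
    by (rule parseval[OF finite_box[OF q] finite_box[OF q] ee_orthogonal[OF _ _ q]])
  hence "complex_of_real (\<Sum>b\<in>mat_box q. (cmod (\<Sum>n\<in>mat_box q. ee q n b * \<phi> n))\<^sup>2) =
      of_real (k * (\<Sum>n\<in>mat_box q. (cmod (\<phi> n))\<^sup>2))"
    by (simp add: k_def)
  hence *: "(\<Sum>b\<in>mat_box q. (cmod (\<Sum>n\<in>mat_box q. ee q n b * \<phi> n))\<^sup>2) = k * (\<Sum>n\<in>mat_box q. (cmod (\<phi> n))\<^sup>2)"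
    by (simp only: of_real_eq_iff)
  have "component q N b F x = (\<Sum>n\<in>mat_box q. ee q n b * \<phi> n) / of_nat (card (mat_box q))" for b
    by (simp only: component_def \<phi>_def)
  hence "(\<Sum>b\<in>mat_box q. (cmod (component q N b F x))\<^sup>2) =
      (\<Sum>b\<in>mat_box q. (cmod (\<Sum>n\<in>mat_box q. ee q n b * \<phi> n))\<^sup>2) / k\<^sup>2"
    by (simp add: norm_divide power_divide k_def flip: sum_divide_distrib)
  also have "\<dots> = (\<Sum>n\<in>mat_box q. (cmod (\<phi> n))\<^sup>2) / k"
    unfolding * using k by (simp add: power2_eq_square)
  finally show ?thesis by (simp add: \<phi>_def k_def)
qed

lemma carrier_unipotent: "(v, mat 1) \<in> carrier P_group"
  by simp

lemma component_in_ell2: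
  assumes F: "P.left_invariant F" "P.on_cosets F \<in> ell2 P.RC"
  shows "P.on_cosets (component q N b F) \<in> ell2 P.RC"
proof -
  let ?G = "\<lambda>n. P.on_cosets (\<lambda>x. F (x \<cdot> (smat (1 / of_nat N) n, mat 1)))"
  have G: "?G n \<in> ell2 P.RC" for n
    using P.on_cosets_translate(1)[OF F(1) carrier_unipotent] F(2) by blast
  have "(\<lambda>C. \<Sum>n\<in>A. ee q n b * ?G n C) \<in> ell2 P.RC" for A
  proof (induction A rule: infinite_finite_induct)
    case (insert n A)
    thus ?case using ell2_add[OF ell2_scale[OF G] insert.IH] by simp
  qed (simp_all add: ell2_def)
  from ell2_scale[OF this[of "mat_box q"], of "1 / of_nat (card (mat_box q))"]
  show ?thesis
    by (rule back_subst[where P = "\<lambda>\<xi>. \<xi> \<in> ell2 P.RC"])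
      (auto simp: P.on_cosets_def component_def fun_eq_iff simp del: P_group_simps)
qed

text \<open>Parseval holds at each point \<open>x\<close>. Summed over the cosets, each translate of
  \<open>F\<close> contributes the same norm because right translations preserve it, and their
  number cancels the normalization of \<open>component\<close>.\<close>

lemma component_norm_sum:
  assumes q: "q > 0" and F: "P.left_invariant F" "P.on_cosets F \<in> ell2 P.RC"
  shows "(\<Sum>b\<in>mat_box q. (ell2_norm P.RC (P.on_cosets (component q N b F)))\<^sup>2) =
    (ell2_norm P.RC (P.on_cosets F))\<^sup>2"
proof -
  let ?u = "\<lambda>n. (smat (1 / of_nat N) n, mat 1)"
  have hs_F: "((\<lambda>C. (cmod (F (coset_rep C \<cdot> ?u n)))\<^sup>2) has_sum
      (ell2_norm P.RC (P.on_cosets F))\<^sup>2) P.RC" for n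
  proof -
    have "P.on_cosets (\<lambda>x. F (x \<cdot> ?u n)) \<in> ell2 P.RC"
      using P.on_cosets_translate(1)[OF F(1) carrier_unipotent] F(2) by blast
    hence "(\<lambda>C. (cmod (F (coset_rep C \<cdot> ?u n)))\<^sup>2) summable_on P.RC"
      unfolding P.on_cosets_in_ell2 .
    moreover have "(\<Sum>\<^sub>\<infinity>C\<in>P.RC. (cmod (F (coset_rep C \<cdot> ?u n)))\<^sup>2) =
        (ell2_norm P.RC (P.on_cosets F))\<^sup>2"
      using P.on_cosets_translate(2)[OF F(1) carrier_unipotent, of "smat (1 / of_nat N) n"]
        P.ell2_norm_on_cosets[of "\<lambda>x. F (x \<cdot> ?u n)"]
      by (simp only:)
    ultimately show ?thesis by (simp only: has_sum_iff)
  qed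
  have hs_comp: "((\<lambda>C. (cmod (component q N b F (coset_rep C)))\<^sup>2) has_sum
      (ell2_norm P.RC (P.on_cosets (component q N b F)))\<^sup>2) P.RC" for b
    using component_in_ell2[OF F, of q N b] unfolding P.on_cosets_in_ell2 P.ell2_norm_on_cosets
    by (rule has_sum_infsum)
  have "((\<lambda>C. \<Sum>b\<in>mat_box q. (cmod (component q N b F (coset_rep C)))\<^sup>2) has_sum
      (\<Sum>b\<in>mat_box q. (ell2_norm P.RC (P.on_cosets (component q N b F)))\<^sup>2)) P.RC"
    by (rule has_sum_sum) (rule hs_comp)
  moreover have "((\<lambda>C. \<Sum>b\<in>mat_box q. (cmod (component q N b F (coset_rep C)))\<^sup>2) has_sum
      (\<Sum>n\<in>mat_box q. (ell2_norm P.RC (P.on_cosets F))\<^sup>2) / card (mat_box q)) P.RC"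
    unfolding component_parseval[OF q]
    by (intro has_sum_divide_const has_sum_sum hs_F)
  ultimately have "(\<Sum>b\<in>mat_box q. (ell2_norm P.RC (P.on_cosets (component q N b F)))\<^sup>2) =
      (\<Sum>n\<in>mat_box q. (ell2_norm P.RC (P.on_cosets F))\<^sup>2) / card (mat_box q)"
    by (rule has_sum_unique)
  thus ?thesis using card_box_pos[OF q] by simp
qed

lemma conv_component:
  assumes f: "f \<in> HP" and F: "P.left_invariant F" and x: "x \<in> carrier P_group"
  shows "P.conv f (component q N b F) x = component q N b (P.conv f F) x"
proof -
  let ?u = "\<lambda>n. (smat (1 / of_nat N) n, mat 1)"
  have eq: "component q N b F = (\<lambda>x. (1 / of_nat (card (mat_box q))) *
      (\<Sum>n\<in>mat_box q. ee q n b * F (x \<cdot> ?u n)))" for F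
    by (simp add: component_def fun_eq_iff)
  show ?thesis
    unfolding eq P.conv_scale_right P.conv_sum_right[OF f]
    by (intro arg_cong[where f = "\<lambda>s. 1 / of_nat (card (mat_box q)) * s"] sum.cong refl
        arg_cong[where f = "\<lambda>s. _ * s"] P.conv_translate[OF f F x carrier_unipotent])
qed

lemma component_left_invariant:
  assumes F: "P.left_invariant F" shows "P.left_invariant (component q N b F)"
  using P.left_invariant_translate[OF F carrier_unipotent]
  by (simp add: P.left_invariant_def component_def del: P_group_simps)

end

section \<open>Weak containment of the regular representation\<close>

lemma det_shift_positive:
  fixes c :: rat_mat
  assumes N: "N > (0::nat)"
  shows "\<exists>k::nat. det (c + smat (of_nat (N * k)) (mat 1)) > 0"
proof -
  \<comment> \<open>For a shift \<open>u \<ge> t\<close> the diagonal entries are at least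
    \<open>1 + \<bar>c $ 1 $ 2 * c $ 2 $ 1\<bar>\<close> and 1, so their product exceeds the product
    of the other two entries.\<close>
  define t where "t = \<bar>c $ 1 $ 1\<bar> + \<bar>c $ 2 $ 2\<bar> + \<bar>c $ 1 $ 2 * c $ 2 $ 1\<bar> + 1"
  obtain k where k: "t \<le> of_nat k" using real_arch_simple[of t] by blast
  define u :: rat where "u = of_nat (N * k)"
  have "rat_of_nat k \<le> of_nat (N * k)" unfolding of_nat_le_iff using N by (cases N) auto
  hence u: "t \<le> u" using k by (simp add: u_def)
  have "1 + \<bar>c $ 1 $ 2 * c $ 2 $ 1\<bar> \<le> c $ 1 $ 1 + u" "1 \<le> c $ 2 $ 2 + u"
    using u unfolding t_def by linarith+
  hence "(1 + \<bar>c $ 1 $ 2 * c $ 2 $ 1\<bar>) * 1 \<le> (c $ 1 $ 1 + u) * (c $ 2 $ 2 + u)"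
    by (intro mult_mono) auto
  moreover have "c $ 1 $ 2 * c $ 2 $ 1 < (1 + \<bar>c $ 1 $ 2 * c $ 2 $ 1\<bar>) * 1"
    using abs_ge_self[of "c $ 1 $ 2 * c $ 2 $ 1"] by simp
  ultimately have "c $ 1 $ 2 * c $ 2 $ 1 < (c $ 1 $ 1 + u) * (c $ 2 $ 2 + u)" by simp
  moreover have "det (c + smat u (mat 1)) = (c $ 1 $ 1 + u) * (c $ 2 $ 2 + u) - c $ 1 $ 2 * c $ 2 $ 1"
    by (simp add: det_2 mat_def)
  ultimately have "det (c + smat u (mat 1)) > 0" by simp
  thus ?thesis unfolding u_def by blast
qed

text \<open>
  The character with index \<open>b\<close> is \<open>v \<mapsto> psi (v a)\<close> for every \<open>a\<close> congruent to \<open>b / M\<close> modulo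
  \<open>N Mat\<^sub>2(\<int>)\<close>. A suitable multiple of \<open>N\<close> added on the diagonal makes \<open>det a\<close> positive.
\<close>

lemma (in matrix_pairing) component_eq_embed:
  assumes F: "P.left_invariant F"
    and supp: "\<And>m g. F (m, g) \<noteq> 0 \<Longrightarrow>
      det g > 0 \<and> m ** g \<in> lat (of_nat e) \<and> g \<in> lat (of_nat e) \<and> matrix_inv g \<in> lat (of_nat e)"
    and pos: "N > 0" "M > 0" and dvd: "e dvd N" "e dvd M"
    and b: "b \<in> Mat2Z" and a: "a = smat (1 / of_nat M) b + smat (of_nat (N * k)) (mat 1)" "det a > 0"
  shows "\<exists>\<xi>. supported a e \<xi> \<and> (\<forall>D. D \<notin> Gamma_mod_S \<longrightarrow> \<xi> D = 0) \<and>
    P.on_cosets (component (N * M) N b F) = embed a N \<xi>"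
proof -
  define q where "q = N * M"
  have q: "q > 0" using pos by (simp add: q_def)
  let ?Fb = "component q N b F"
  have Fb: "P.left_invariant ?Fb" by (rule component_left_invariant[OF F])
  \<comment> \<open>The multiple \<open>N k\<close> added on the diagonal contributes the integer
    matrix \<open>k v\<close>, on which \<open>psi\<close> is 1.\<close>
  have ee_psi: "ee q v b = psi (smat (1 / of_nat N) v ** a)" if v: "v \<in> Mat2Z" for v
  proof -
    have "smat (1 / of_nat N) v ** a = smat (1 / of_nat q) (v ** b) + smat (of_nat k) v"
      using pos unfolding a(1) q_def
      by (simp add: vec_eq_iff matrix_mult_2 mat_def forall_2 field_simps)
    moreover have "smat (of_nat k) v \<in> Mat2Z"
      using lat_Ints_mult[of v 1 "of_nat k"] v by (simp add: smat_in_Mat2Z lat_1)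
    ultimately show ?thesis by (simp add: ee_def psi_add psi_int)
  qed
  \<comment> \<open>A right translation by \<open>M z\<close> is a left translation by
    \<open>M z g^-1\<close>. On the support of \<open>F\<close> the inverse of \<open>g\<close> has
    denominator \<open>e\<close>, a divisor of \<open>M\<close>, so this matrix is integral;
    elsewhere both sides vanish.\<close>
  have period: "F ((m, g) \<cdot> (y + smat (of_nat M) z, mat 1)) = F ((m, g) \<cdot> (y, mat 1))"
    if g: "det g > 0" and z: "z \<in> Mat2Z" for m g y z
  proof -
    define m0 where "m0 = m + y ** matrix_inv g"
    define z' where "z' = smat (of_nat M) (z ** matrix_inv g)"
    have eqs: "(m, g) \<cdot> (y + smat (of_nat M) z, mat 1) = (m0 + z', g)"
      "(m, g) \<cdot> (y, mat 1) = (m0, g)"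
      by (simp_all add: m0_def z'_def matrix_add_rdistrib_2 smat_mult_left add.assoc)
    show ?thesis
    proof (cases "matrix_inv g \<in> lat (of_nat e)")
      case True
      hence "matrix_inv g \<in> lat (of_nat M)" by (rule lat_dvd[OF _ dvd(2)])
      hence "z' \<in> Mat2Z" using lat_int_mult[OF z] by (simp add: z'_def smat_in_Mat2Z)
      hence "F ((z', mat 1) \<cdot> (m0, g)) = F (m0, g)"
        by (intro P_left_invariantD[OF F]) (simp_all add: P0_def SL2Z_mat_1 g)
      thus ?thesis unfolding eqs by (simp add: add.commute)
    next
      case False
      thus ?thesis unfolding eqs using supp[of "m0 + z'" g] supp[of m0 g] by metis
    qed
  qed
  \<comment> \<open>Translating by \<open>v = v' / N\<close> shifts the summation index
    \<open>n\<close> to \<open>n + v'\<close>. Reducing the index modulo \<open>q = N M\<close>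
    changes \<open>n / N\<close> by an element of \<open>M Mat_2(Z)\<close>, which
    \<open>period\<close> absorbs.\<close>
  have eigen: "?Fb ((m, g) \<cdot> (v, mat 1)) = cnj (psi (v ** a)) * ?Fb (m, g)"
    if g: "det g > 0" and v: "v \<in> lat (of_nat N)" for m g v
  proof -
    define v' where "v' = smat (of_nat N) v"
    have v': "v' \<in> Mat2Z" using v by (simp add: v'_def smat_in_Mat2Z)
    have v_eq: "v = smat (1 / of_nat N) v'" using pos by (simp add: v'_def smat_smat)
    let ?u = "\<lambda>n. F ((m, g) \<cdot> (smat (1 / of_nat N) n, mat 1))"
    have shift: "F ((m, g) \<cdot> (v, mat 1) \<cdot> (smat (1 / of_nat N) n, mat 1)) = ?u (red q (n + v'))"
      if n: "n \<in> mat_box q" for n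
    proof -
      define z where "z = smat (1 / of_nat q) (red q (n + v') - (n + v'))"
      have nv: "n + v' \<in> Mat2Z" by (rule Mat2Z_add[OF box_Mat2Z[OF n] v'])
      have z: "z \<in> Mat2Z" using red_congruent[OF nv q] by (simp add: z_def smat_in_Mat2Z)
      have "smat (1 / of_nat N) (red q (n + v')) = (v + smat (1 / of_nat N) n) + smat (of_nat M) z"
        using pos by (simp add: v_eq z_def q_def vec_eq_iff field_simps)
      hence "?u (red q (n + v')) = F ((m, g) \<cdot> (v + smat (1 / of_nat N) n, mat 1))"
        using period[OF g z] by simp
      thus ?thesis by (simp add: matrix_add_rdistrib_2 add.assoc)
    qed
    have "?Fb ((m, g) \<cdot> (v, mat 1)) =
        (\<Sum>n\<in>mat_box q. ee q n b * ?u (red q (n + v'))) / of_nat (card (mat_box q))"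
      unfolding component_def by (simp add: shift del: P_group_simps)
    also have "(\<Sum>n\<in>mat_box q. ee q n b * ?u (red q (n + v'))) =
        (\<Sum>n\<in>mat_box q. cnj (ee q v' b) * (ee q (red q (n + v')) b * ?u (red q (n + v'))))"
    proof (rule sum.cong[OF refl])
      fix n assume n: "n \<in> mat_box q"
      have "ee q (red q (n + v')) b = ee q n b * ee q v' b"
        using ee_red_left[OF Mat2Z_add[OF box_Mat2Z[OF n] v'] b q] by (simp add: ee_add_left)
      hence "cnj (ee q v' b) * ee q (red q (n + v')) b = ee q n b * (ee q v' b * cnj (ee q v' b))"
        by simp
      thus "ee q n b * ?u (red q (n + v')) =
          cnj (ee q v' b) * (ee q (red q (n + v')) b * ?u (red q (n + v')))"
        by (simp only: ee_cnj mult_1_right flip: mult.assoc)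
    qed
    also have "\<dots> = cnj (ee q v' b) * (\<Sum>n\<in>mat_box q. ee q n b * ?u n)"
      unfolding sum_distrib_left[symmetric]
      by (rule arg_cong[where f = "\<lambda>s. _ * s"]) (rule sum.reindex_bij_betw[OF box_shift_bij[OF v' q]])
    finally show ?thesis
      unfolding component_def using ee_psi[OF v'] by (simp add: v_eq del: P_group_simps)
  qed
  \<comment> \<open>The translations averaged in \<open>?Fb\<close> fix \<open>g\<close> and move
    \<open>m ** g\<close> by elements of \<open>N^-1 Mat_2(Z)\<close>, so the conditions on the
    support survive with \<open>N\<close> in place of \<open>e\<close> for
    \<open>m ** g\<close>.\<close>
  have Fb_supp: "det g > 0 \<and> g \<in> lat (of_nat e) \<and> m ** g \<in> lat (of_nat N)"
    if nz: "?Fb (m, g) \<noteq> 0" for m g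
  proof -
    have "\<exists>n\<in>mat_box q. F ((m, g) \<cdot> (smat (1 / of_nat N) n, mat 1)) \<noteq> 0"
    proof (rule ccontr)
      assume "\<not> ?thesis"
      hence "?Fb (m, g) = 0" by (simp add: component_def del: P_group_simps)
      thus False using nz by simp
    qed
    then obtain n where n: "n \<in> mat_box q"
      "F ((m, g) \<cdot> (smat (1 / of_nat N) n, mat 1)) \<noteq> 0" by blast
    define v where "v = smat (1 / of_nat N) n"
    have "F (m + v ** matrix_inv g, g) \<noteq> 0" using n(2) by (simp add: v_def)
    from supp[OF this] have s: "det g > 0" "(m + v ** matrix_inv g) ** g \<in> lat (of_nat e)" "g \<in> lat (of_nat e)"
      by auto
    have "m ** g + v \<in> lat (of_nat N)"
      using lat_dvd[OF s(2) dvd(1)] s(1) by (simp add: matrix_add_rdistrib_2 matrix_cancel)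
    moreover have "v \<in> lat (of_nat N)" using box_Mat2Z[OF n(1)] pos by (simp add: v_def smat_in_lat lat_1)
    ultimately have "m ** g \<in> lat (of_nat N)" using lat_diff[of "m ** g + v" _ v] by simp
    thus ?thesis using s by simp
  qed
  \<comment> \<open>The argument of \<open>eigen_unique\<close>, except that \<open>eigen\<close> is
    available for \<open>v\<close> in \<open>lat (of_nat N)\<close>. The translation in question is
    \<open>v = z ** g\<close>, which qualifies because \<open>g\<close> has denominator
    \<open>e\<close>, a divisor of \<open>N\<close>.\<close>
  have Fb_int: "g ** a \<in> Mat2Zpos" if nz: "?Fb (0, g) \<noteq> 0" for g
  proof -
    have g: "det g > 0" "g \<in> lat (of_nat N)" using Fb_supp[OF nz] lat_dvd[OF _ dvd(1)] by auto
    have "psi (z ** (g ** a)) = 1" if z: "z \<in> Mat2Z" for z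
    proof -
      have "?Fb ((z, mat 1) \<cdot> (0, g)) = ?Fb (0, g)"
        by (rule P_left_invariantD[OF Fb]) (simp_all add: P0_def SL2Z_mat_1 g z)
      moreover have "?Fb ((0, g) \<cdot> (z ** g, mat 1)) = cnj (psi (z ** g ** a)) * ?Fb (0, g)"
        by (rule eigen[OF g(1) lat_int_mult[OF z g(2)]])
      ultimately have "cnj (psi (z ** g ** a)) * ?Fb (0, g) = 1 * ?Fb (0, g)"
        using g(1) by (simp add: matrix_cancel)
      hence "cnj (psi (z ** g ** a)) = cnj 1" using nz by simp
      thus ?thesis by (simp only: complex_cnj_cancel_iff matrix_mul_assoc)
    qed
    hence "g ** a \<in> Mat2Z" by (rule left_int)
    thus ?thesis using g(1) a(2) by (simp add: Mat2Zpos_def det_mul)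
  qed
  \<comment> \<open>This solves \<open>?Fb (0, g) = twisted a \<xi> (0, g)\<close> for the value of
    \<open>\<xi>\<close> at the coset of \<open>s = g ** a\<close>; the factor \<open>det\<close>
    undoes the weight in \<open>eigen\<close>.\<close>
  define \<xi> where "\<xi> = (\<lambda>D. if D \<in> Gamma_mod_S
    then of_rat (det (coset_rep D)) * ?Fb (0, coset_rep D ** matrix_inv a) else 0)"
  have xi: "\<xi> (Gcoset s) = of_rat (det s) * ?Fb (0, s ** matrix_inv a)" if s: "s \<in> Mat2Zpos" for s
  proof -
    have ds: "det s > 0" using s by (simp add: Mat2Zpos_def)
    obtain h where h: "h \<in> SL2Z" "coset_rep (Gcoset s) = h ** s" using Gcoset_rep[OF ds] .
    have "?Fb ((0, h) \<cdot> (0, s ** matrix_inv a)) = ?Fb (0, s ** matrix_inv a)"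
      by (rule P_left_invariantD[OF Fb])
        (use ds a(2) in \<open>simp_all add: P0_def h Mat2Z_0 det_mul det_matrix_inv\<close>)
    thus ?thesis using s by (simp add: \<xi>_def right_cosets_def h det_mul SL2Z_det matrix_mul_assoc)
  qed
  have sup: "supported a e \<xi>"
    unfolding supported_def using xi Fb_supp[of 0] by auto
  have eq: "?Fb x = lat_cut N (twisted a \<xi>) x" if x: "x \<in> carrier P_group" for x
  proof -
    obtain m g where mg: "x = (m, g)" "det g > 0" using x by (cases x) auto
    show ?thesis
    proof (cases "m ** g \<in> lat (of_nat N)")
      case True
      have F0: "?Fb (m, g) = cnj (psi (m ** g ** a)) * ?Fb (0, g)"
        using eigen[OF mg(2) True, of 0] mg(2) by (simp add: matrix_cancel)
      show ?thesis
      proof (cases "g ** a \<in> Mat2Zpos")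
        case ga: True
        hence "det (g ** a) > 0" by (simp add: Mat2Zpos_def)
        thus ?thesis using True F0 xi[OF ga] a(2)
          by (simp add: mg(1) lat_cut_def twisted_eq eigen_def ga matrix_cancel matrix_mul_assoc
              flip: of_rat_mult)
      next
        case False
        hence "?Fb (0, g) = 0" using Fb_int by blast
        thus ?thesis using F0 False by (simp add: mg(1) lat_cut_def twisted_eq eigen_def)
      qed
    next
      case False
      hence "?Fb (m, g) = 0" using Fb_supp by blast
      thus ?thesis using False by (simp add: mg(1) lat_cut_def)
    qed
  qed
  have "P.on_cosets ?Fb = embed a N \<xi>"
    unfolding embed_def P.on_cosets_def by (intro ext if_cong refl eq P.coset_rep_carrier)
  thus ?thesis using sup by (auto simp: q_def \<xi>_def)
qed

lemma finite_common_denominator: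
  assumes "finite A"
  shows "\<exists>e::nat. e > 0 \<and> (\<forall>m\<in>A. m \<in> lat (of_nat e))"
  using assms
proof (induction A)
  case (insert m A)
  then obtain e where e: "e > 0" "\<forall>m\<in>A. m \<in> lat (of_nat e)" by blast
  obtain d :: nat where d: "d > 0" "m \<in> lat (of_nat d)" using lat_exists by blast
  show ?case
    using e d lat_dvd[of _ e "e * d"] lat_dvd[of m d "e * d"] by (intro exI[of _ "e * d"]) auto
qed auto

text \<open>Finite support provides the common denominator \<open>e\<close> that
  \<open>component_eq_embed\<close> requires. Parseval is then applied with the same
  \<open>q\<close> and \<open>N\<close> to \<open>\<zeta>\<close> and to its image under
  \<open>f\<close>; the components correspond to each other since convolution commutes with right
  translations, so the bound \<open>c\<close> for each component gives the bound for the
  sum.\<close>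

lemma (in matrix_pairing) regular_rep_norm_le:
  assumes f: "f \<in> HP" and c: "0 \<le> c"
    and le: "\<And>\<eta>. \<eta> \<in> ell2 Gamma_mod_S \<Longrightarrow>
      norm_S (pie f \<eta>) \<le> c * norm_S \<eta>"
    and z: "\<zeta> \<in> ell2 P.RC"
  shows "ell2_norm P.RC (P_regular f \<zeta>) \<le> c * ell2_norm P.RC \<zeta>"
proof -
  let ?lam = "P_regular f"
  obtain r B where "finite_kernel P.RC (P.hecke_kernel f) r B"
    using P.hecke_finite_kernel[OF f] by blast
  note reduction = finite_kernel.kernel_op_norm_le_if_finite_support[OF this, folded P.regular_rep_eq]
  show ?thesis
  proof (rule reduction[OF c _ z])
    fix \<zeta> assume z: "\<zeta> \<in> ell2 P.RC" and fin: "finite {C. \<zeta> C \<noteq> 0}"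
    define F where "F = (\<lambda>x. if x \<in> carrier P_group then \<zeta> (Pcoset x) else 0)"
    have F: "P.left_invariant F"
      unfolding P.left_invariant_def F_def
      by (simp add: P.coset_absorb P0_carrier Pgrp.m_closed del: P_group_simps)
    have on_F: "P.on_cosets F = \<zeta>"
      using z by (auto simp: P.on_cosets_def F_def fun_eq_iff ell2_eq_0 simp del: P_group_simps)
    define R where "R = coset_rep ` {C. \<zeta> C \<noteq> 0}"
    have "finite ((\<lambda>(m, g). m ** g) ` R \<union> snd ` R \<union> (\<lambda>(m, g). matrix_inv g) ` R)"
      using fin by (simp add: R_def)
    from finite_common_denominator[OF this] obtain e :: nat where e: "e > 0"
      and R_lat: "\<forall>m\<in>(\<lambda>(m, g). m ** g) ` R \<union> snd ` R \<union> (\<lambda>(m, g). matrix_inv g) ` R. m \<in> lat (of_nat e)"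
      by blast
    have e_R: "m ** g \<in> lat (of_nat e) \<and> g \<in> lat (of_nat e) \<and> matrix_inv g \<in> lat (of_nat e)"
      if "(m, g) \<in> R" for m g
      using bspec[OF R_lat, of "m ** g"] bspec[OF R_lat, of g] bspec[OF R_lat, of "matrix_inv g"] that
      by force
    have supp: "det g > 0 \<and> m ** g \<in> lat (of_nat e) \<and> g \<in> lat (of_nat e) \<and> matrix_inv g \<in> lat (of_nat e)"
      if nz: "F (m, g) \<noteq> 0" for m g
    proof -
      have g: "det g > 0" and zn: "\<zeta> (Pcoset (m, g)) \<noteq> 0" using nz by (auto simp: F_def split: if_splits)
      have x: "(m, g) \<in> carrier P_group" using g by simp
      obtain h where h: "h \<in> P0" "coset_rep (Pcoset (m, g)) = h \<cdot> (m, g)"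
        by (rule P.coset_rep_of_coset[OF x])
      obtain n \<gamma> where n: "h = (n, \<gamma>)" "n \<in> Mat2Z" "\<gamma> \<in> SL2Z" using h(1) by (auto simp: P0_def)
      have d\<gamma>: "det \<gamma> = 1" by (rule SL2Z_det[OF n(3)])
      have "(n + m ** matrix_inv \<gamma>, \<gamma> ** g) \<in> R"
        unfolding R_def by (rule image_eqI[of _ _ "Pcoset (m, g)"]) (use zn h(2) in \<open>simp_all add: n(1)\<close>)
      from e_R[OF this] have l: "(n + m ** matrix_inv \<gamma>) ** (\<gamma> ** g) \<in> lat (of_nat e)"
        "\<gamma> ** g \<in> lat (of_nat e)" "matrix_inv g ** matrix_inv \<gamma> \<in> lat (of_nat e)"
        using g d\<gamma> by (auto simp: matrix_inv_mult)
      have 1: "g \<in> lat (of_nat e)"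
        using lat_int_mult[OF SL2Z_int[OF SL2Z_inv[OF n(3)]] l(2)] d\<gamma> by (simp add: matrix_cancel)
      have 2: "matrix_inv g \<in> lat (of_nat e)"
        using lat_mult_int[OF l(3) SL2Z_int[OF n(3)]] d\<gamma> by (simp add: matrix_cancel)
      have "(n + m ** matrix_inv \<gamma>) ** (\<gamma> ** g) - n ** (\<gamma> ** g) \<in> lat (of_nat e)"
        by (rule lat_diff[OF l(1) lat_int_mult[OF n(2) l(2)]])
      hence "m ** g \<in> lat (of_nat e)"
        using d\<gamma> by (simp add: matrix_add_rdistrib_2 matrix_mul_assoc matrix_cancel)
      thus ?thesis using g 1 2 by simp
    qed
    obtain df :: nat where df: "df > 0"
      "\<And>m k. f (m, k) \<noteq> 0 \<Longrightarrow> m \<in> lat (of_nat df) \<and> k \<in> lat (of_nat df)"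
      using hecke_denominator[OF f] by blast
    define N where "N = df * df * e"
    have N: "N > 0" "e dvd N" "df * df * e dvd N" using df(1) e by (simp_all add: N_def)
    \<comment> \<open>The modulus \<open>M\<close> of \<open>component_eq_embed\<close> is
      \<open>e\<close> here, while \<open>N\<close> contains the additional factors
      \<open>df * df\<close> required by \<open>regular_rep_embed\<close>.\<close>
    define q where "q = N * e"
    have q: "q > 0" using N(1) e by (simp add: q_def)
    let ?G = "\<lambda>b. P.on_cosets (component q N b F)"
    have FG: "P.on_cosets F \<in> ell2 P.RC" using z on_F by simp
    have comp: "ell2_norm P.RC (?lam (?G b)) \<le> c * ell2_norm P.RC (?G b)" if b: "b \<in> mat_box q" for b
    proof -
      obtain k :: nat where k: "det (smat (1 / of_nat e) b + smat (of_nat (N * k)) (mat 1)) > 0"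
        using det_shift_positive[OF N(1)] by blast
      define a where "a = smat (1 / of_nat e) b + smat (of_nat (N * k)) (mat 1)"
      have a: "det a > 0" using k by (simp add: a_def)
      have "\<exists>\<xi>. supported a e \<xi> \<and> (\<forall>D. D \<notin> Gamma_mod_S \<longrightarrow> \<xi> D = 0) \<and>
          P.on_cosets (component (N * e) N b F) = embed a N \<xi>"
        by (rule component_eq_embed[OF F supp N(1) e N(2) dvd_refl box_Mat2Z[OF b] a_def a])
      then obtain \<xi> where xi: "supported a e \<xi>" "\<And>D. D \<notin> Gamma_mod_S \<Longrightarrow> \<xi> D = 0"
        and G: "?G b = embed a N \<xi>"
        by (auto simp: q_def)
      have sN: "supported a N \<xi>" by (rule supported_mono[OF xi(1) N(2)])
      have xi_mem: "\<xi> \<in> ell2 Gamma_mod_S"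
        using embed_ell2_iff[OF a N(1) sN xi(2)] component_in_ell2[OF F FG, of q N b] by (simp add: G)
      have rep: "?lam (embed a N \<xi>) = embed a N (pie f \<xi>)"
        by (rule regular_rep_embed[OF f df(2) a N(1,3) xi_mem xi(1)])
      have mem: "pie f \<xi> \<in> ell2 Gamma_mod_S" by (rule pie_in_ell2[OF f xi_mem])
      have sup: "supported a N (pie f \<xi>)" by (rule pie_supported[OF f df(2) a N(1,3) xi_mem xi(1)])
      define t where "t = real N ^ 2 / of_rat (det a)"
      have t: "t \<ge> 0" using a by (simp add: t_def)
      have "ell2_norm P.RC (?lam (?G b)) = t * norm_S (pie f \<xi>)"
        unfolding G rep t_def by (rule embed_norm_ell2[OF a N(1) sup mem])
      also have "\<dots> \<le> t * (c * norm_S \<xi>)" by (rule mult_left_mono[OF le[OF xi_mem] t])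
      also have "\<dots> = c * ell2_norm P.RC (?G b)"
        unfolding G t_def embed_norm_ell2[OF a N(1) sN xi_mem] by simp
      finally show ?thesis .
    qed
    have cF: "?lam \<zeta> = P.on_cosets (P.conv f F)"
      using P.regular_rep_on_cosets[OF FG, of f] on_F by simp
    have cF_mem: "P.on_cosets (P.conv f F) \<in> ell2 P.RC"
      using bounded_ops_ell2[OF P.regular_rep_bounded[OF f] z] cF by simp
    have cG: "P.on_cosets (component q N b (P.conv f F)) = ?lam (?G b)" for b
    proof -
      have "?lam (?G b) = P.on_cosets (P.conv f (component q N b F))"
        by (rule P.regular_rep_on_cosets[OF component_in_ell2[OF F FG]])
      also have "\<dots> = P.on_cosets (component q N b (P.conv f F))"
        unfolding P.on_cosets_def
        by (intro ext if_cong refl conv_component[OF f F] P.coset_rep_carrier)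
      finally show ?thesis ..
    qed
    have "(ell2_norm P.RC (?lam \<zeta>))\<^sup>2 = (\<Sum>b\<in>mat_box q. (ell2_norm P.RC (?lam (?G b)))\<^sup>2)"
      using component_norm_sum[OF q P.left_invariant_conv[OF f] cF_mem, of N] by (simp only: cF cG)
    also have "\<dots> \<le> (\<Sum>b\<in>mat_box q. (c * ell2_norm P.RC (?G b))\<^sup>2)"
      by (intro sum_mono power_mono comp) auto
    also have "\<dots> = c\<^sup>2 * (ell2_norm P.RC \<zeta>)\<^sup>2"
      using component_norm_sum[OF q F FG, of N] on_F by (simp add: power_mult_distrib flip: sum_distrib_left)
    finally have "(ell2_norm P.RC (?lam \<zeta>))\<^sup>2 \<le> (c * ell2_norm P.RC \<zeta>)\<^sup>2"
      by (simp add: power_mult_distrib)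
    thus "ell2_norm P.RC (?lam \<zeta>) \<le> c * ell2_norm P.RC \<zeta>"
      by (rule power2_le_imp_le) (use c in simp)
  qed
qed

section \<open>The representation on the integer matrices\<close>

text \<open>By \<open>P_coset_bij\<close> the convolution at \<open>(0, t)\<close> is a sum over
  cosets of \<open>s\<close> and classes of \<open>m\<close>. There \<open>(0, t) (m, s)^-1\<close>
  is the product of \<open>t s^-1\<close> and \<open>-m\<close>, and \<open>det t\<close> together
  with the weight \<open>1 / det s\<close> in \<open>eigen\<close> gives the factor
  \<open>det (t s^-1)\<close>.\<close>

lemma pi_rep_eq_pi_op:
  assumes mp: "matrix_pairing (char_twist chi w)" and f: "f \<in> HP"
  shows "pi_rep chi w f = matrix_pairing.pi_op (char_twist chi w) f"
proof -
  interpret matrix_pairing "char_twist chi w" by (rule mp)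
  show ?thesis
    unfolding pi_rep_def pi_op_def
  proof (intro restrict_ext ext)
    fix \<xi> C assume xi: "\<xi> \<in> ell2 Gamma_mod_S"
    show "(if C \<in> Gamma_mod_S then let t = coset_rep C in
       \<Sum>\<^sub>\<infinity>D\<in>Gamma_mod_S. let s = coset_rep D in
         \<Sum>\<^sub>\<infinity>M\<in>Mat2Q_mod_Mat2Z. let m = coset_rep M in
           of_rat (det (t ** matrix_inv s)) * cnj (char_twist chi w (m ** s)) *
           f (GL_in_P (t ** matrix_inv s) \<cdot> mat_in_P (- m)) * \<xi> D
     else 0) = pie f \<xi> C"
    proof (cases "C \<in> Gamma_mod_S")
      case False
      thus ?thesis by (simp add: pie_out)
    next
      case True
      define t where "t = coset_rep C"
      have dt: "det t > 0" using Gamma_mod_S_rep(1)[OF True] by (simp add: t_def Mat2Zpos_def)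
      have x: "(0, t) \<in> carrier P_group" using dt by simp
      define \<Phi> where "\<Phi> = (\<lambda>y. f ((0, t) \<cdot> Pinv y) * eigen \<xi> y)"
      have \<Phi>: "P.left_invariant \<Phi>"
        unfolding \<Phi>_def by (rule P.left_invariant_integrand[OF f eigen_left_invariant x])
      have "((\<lambda>D. \<Phi> (coset_rep D)) has_sum P.conv f (eigen \<xi>) (0, t)) P.RC"
        unfolding \<Phi>_def P.conv_def if_P[OF x] by (rule has_sum_infsum[OF P.conv_summable[OF f x]])
      hence "((\<lambda>(D, M). \<Phi> (coset_rep M, coset_rep D)) has_sum P.conv f (eigen \<xi>) (0, t)) (GC \<times> Mat2Q_mod_Mat2Z)"
        unfolding P_group_simps(1) has_sum_P_cosets[OF \<Phi>] .
      also have "?this \<longleftrightarrow> ((\<lambda>(D, M). \<Phi> (coset_rep M, coset_rep D)) has_sum P.conv f (eigen \<xi>) (0, t))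
          (Gamma_mod_S \<times> Mat2Q_mod_Mat2Z)"
        by (rule has_sum_cong_neutral)
          (auto simp: \<Phi>_def eigen_def Gamma_mod_S_iff dest: Gamma_mod_S_rep(2) split: if_splits)
      finally have hs: "((\<lambda>(D, M). \<Phi> (coset_rep M, coset_rep D)) has_sum P.conv f (eigen \<xi>) (0, t))
          (Gamma_mod_S \<times> Mat2Q_mod_Mat2Z)" .
      have "pie f \<xi> C = of_rat (det t) * (\<Sum>\<^sub>\<infinity>D\<in>Gamma_mod_S. \<Sum>\<^sub>\<infinity>M\<in>Mat2Q_mod_Mat2Z. \<Phi> (coset_rep M, coset_rep D))"
        using infsum_Sigma_banach[OF has_sum_imp_summable[OF hs]] infsumI[OF hs] True
        by (simp add: pie_def t_def)
      also have "\<dots> = (\<Sum>\<^sub>\<infinity>D\<in>Gamma_mod_S. \<Sum>\<^sub>\<infinity>M\<in>Mat2Q_mod_Mat2Z. of_rat (det t) * \<Phi> (coset_rep M, coset_rep D))"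
        by (simp add: infsum_cmult_right')
      also have "\<dots> = (\<Sum>\<^sub>\<infinity>D\<in>Gamma_mod_S. \<Sum>\<^sub>\<infinity>M\<in>Mat2Q_mod_Mat2Z.
           of_rat (det (t ** matrix_inv (coset_rep D))) * cnj (char_twist chi w (coset_rep M ** coset_rep D)) *
           f (GL_in_P (t ** matrix_inv (coset_rep D)) \<cdot> mat_in_P (- coset_rep M)) * \<xi> D)"
      proof (intro infsum_cong)
        fix D M assume D: "D \<in> Gamma_mod_S"
        define s where "s = coset_rep D"
        define m :: rat_mat where "m = coset_rep M"
        have s: "s \<in> Mat2Zpos" "Gcoset s = D" using Gamma_mod_S_rep[OF D] by (simp_all add: s_def)
        have ds: "det s > 0" using s by (simp add: Mat2Zpos_def)
        have "(0, t) \<cdot> Pinv (m, s) = GL_in_P (t ** matrix_inv s) \<cdot> mat_in_P (- m)"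
          using ds dt by (simp add: P_group_inv GL_in_P_def mat_in_P_def matrix_inv_mult det_matrix_inv
              matrix_inv_inv matrix_minus_mult matrix_mul_assoc)
        hence "of_rat (det t) * \<Phi> (m, s) = of_rat (det (t ** matrix_inv s)) * cnj (char_twist chi w (m ** s)) *
           f (GL_in_P (t ** matrix_inv s) \<cdot> mat_in_P (- m)) * \<xi> D"
          using ds by (simp add: \<Phi>_def eigen_def s det_mul det_matrix_inv of_rat_mult of_rat_divide
              del: P_group_simps)
        thus "of_rat (det t) * \<Phi> (coset_rep M, coset_rep D) =
           of_rat (det (t ** matrix_inv (coset_rep D))) * cnj (char_twist chi w (coset_rep M ** coset_rep D)) *
           f (GL_in_P (t ** matrix_inv (coset_rep D)) \<cdot> mat_in_P (- coset_rep M)) * \<xi> D"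
          by (simp add: s_def m_def)
      qed
      finally show ?thesis using True by (simp add: Let_def t_def)
    qed
  qed
qed

text \<open>For \<open>(n, \<gamma>) s (n', \<gamma>') = (u, k)\<close> one finds
  \<open>u k = n k + n' \<gamma>'\<close>, which is integral because \<open>k\<close> is. Conversely
  \<open>n = 0\<close> and \<open>n' = u \<gamma> s\<close> realize every such
  \<open>u\<close>.\<close>

lemma double_coset_P_iff:
  assumes s: "s \<in> Mat2Zpos"
  shows "(u, k) \<in> double_coset P_group P0 (GL_in_P s) \<longleftrightarrow>
    k \<in> double_coset GL2Qpos SL2Z s \<and> u ** k \<in> Mat2Z"
proof
  have s_int: "s \<in> Mat2Z" and ds: "det s > 0" using s by (simp_all add: Mat2Zpos_def)
  {
    assume "(u, k) \<in> double_coset P_group P0 (GL_in_P s)"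
    hence "\<exists>h\<in>P0. \<exists>l\<in>P0. (u, k) = h \<cdot> (0, s) \<cdot> l"
      unfolding double_coset_def GL_in_P_def by blast
    then obtain n \<gamma> n' \<gamma>' where h: "n \<in> Mat2Z" "\<gamma> \<in> SL2Z" "n' \<in> Mat2Z" "\<gamma>' \<in> SL2Z"
      "(u, k) = (n, \<gamma>) \<cdot> (0, s) \<cdot> (n', \<gamma>')"
      unfolding P0_def by blast
    have u: "u = n + n' ** matrix_inv (\<gamma> ** s)" and k: "k = \<gamma> ** s ** \<gamma>'" using h(5) by simp_all
    have "det (\<gamma> ** s) \<noteq> 0" using ds SL2Z_det[OF h(2)] by (simp add: det_mul)
    hence "n' ** matrix_inv (\<gamma> ** s) ** (\<gamma> ** s ** \<gamma>') = n' ** \<gamma>'"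
      by (simp add: matrix_cancel(3) matrix_mul_assoc[of _ "\<gamma> ** s" \<gamma>'])
    hence "u ** k = n ** k + n' ** \<gamma>'" by (simp add: u k matrix_add_rdistrib_2)
    moreover have "k \<in> Mat2Z" unfolding k by (intro Mat2Z_mult SL2Z_int h s_int)
    ultimately have "u ** k \<in> Mat2Z" using Mat2Z_add[OF Mat2Z_mult[OF h(1)] Mat2Z_mult[OF h(3) SL2Z_int[OF h(4)]]] by simp
    moreover have "k \<in> double_coset GL2Qpos SL2Z s" using h(2,4) by (auto simp: double_coset_def k)
    ultimately show "k \<in> double_coset GL2Qpos SL2Z s \<and> u ** k \<in> Mat2Z" by simp
  }
  assume "k \<in> double_coset GL2Qpos SL2Z s \<and> u ** k \<in> Mat2Z"
  hence uk: "u ** k \<in> Mat2Z" and "k \<in> double_coset GL2Qpos SL2Z s" by auto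
  then obtain \<gamma> \<gamma>' where g: "\<gamma> \<in> SL2Z" "\<gamma>' \<in> SL2Z" and k: "k = \<gamma> ** s ** \<gamma>'"
    by (auto simp: double_coset_def)
  define n' where "n' = u ** (\<gamma> ** s)"
  have "u ** k = n' ** \<gamma>'" by (simp add: n'_def k matrix_mul_assoc)
  hence n': "n' \<in> Mat2Z" using uk SL2Z_cancel(2)[OF g(2)] by simp
  have "det (\<gamma> ** s) \<noteq> 0" using ds SL2Z_det[OF g(1)] by (simp add: det_mul)
  hence "n' ** matrix_inv (\<gamma> ** s) = u" by (simp add: n'_def matrix_cancel(4))
  hence "(u, k) = (0, \<gamma>) \<cdot> (0, s) \<cdot> (n', \<gamma>')" by (simp add: k)
  moreover have "(0, \<gamma>) \<in> P0" "(n', \<gamma>') \<in> P0" using g n' Mat2Z_0 by (simp_all add: P0_def)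
  ultimately show "(u, k) \<in> double_coset P_group P0 (GL_in_P s)"
    unfolding double_coset_def GL_in_P_def by blast
qed

text \<open>For \<open>k = t r^-1\<close> the product of \<open>k\<close> and \<open>-m\<close> has
  first component \<open>- m k^-1\<close>, so by \<open>double_coset_P_iff\<close> it lies in the
  double coset of \<open>s\<close> only if \<open>m\<close> is integral. Hence the inner sum reduces
  to the class of 0, where the character is 1, and \<open>det k = det s\<close> on the double coset
  of \<open>s\<close>.\<close>

lemma pi_rep_hecke_char:
  assumes mp: "matrix_pairing (char_twist chi w)" and s: "s \<in> Mat2Zpos"
  shows "pi_rep chi w (hecke_char P_group P0 (GL_in_P s)) =
    op_scale Gamma_mod_S (of_rat (det s)) (regular_rep GL2Qpos SL2Z Mat2Zpos (hecke_char GL2Qpos SL2Z s))"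
proof -
  interpret matrix_pairing "char_twist chi w" by (rule mp)
  let ?f = "hecke_char P_group P0 (GL_in_P s)" and ?g = "hecke_char GL2Qpos SL2Z s"
  have inner: "(\<Sum>\<^sub>\<infinity>M\<in>Mat2Q_mod_Mat2Z.
           of_rat (det (t ** matrix_inv r)) * cnj (char_twist chi w (coset_rep M ** r)) *
           ?f (GL_in_P (t ** matrix_inv r) \<cdot> mat_in_P (- coset_rep M)) * z) =
      of_rat (det s) * (?g (t \<otimes>\<^bsub>GL2Qpos\<^esub> inv\<^bsub>GL2Qpos\<^esub> r) * z)"
    if t: "t \<in> Mat2Zpos" and r: "r \<in> Mat2Zpos" for t r z
  proof -
    have dets: "det t > 0" "det r > 0" and r_int: "r \<in> Mat2Z" using t r by (simp_all add: Mat2Zpos_def)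
    define k where "k = t ** matrix_inv r"
    have dk: "det k > 0" using dets by (simp add: k_def det_mul det_matrix_inv)
    have f_eq: "?f (GL_in_P k \<cdot> mat_in_P (- m)) = (if m \<in> Mat2Z then ?g k else 0)" for m
      using dk Mat2Z_minus[of m] Mat2Z_minus[of "- m"]
      by (auto simp: hecke_char_def GL_in_P_def[of k] mat_in_P_def indicator_def double_coset_P_iff[OF s]
          matrix_minus_mult matrix_cancel)
    have det_eq: "of_rat (det k) * ?g k = of_rat (det s) * ?g k"
      by (auto simp: hecke_char_def indicator_def double_coset_def det_mul SL2Z_det)
    let ?term = "\<lambda>M. of_rat (det k) * cnj (char_twist chi w (coset_rep M ** r)) *
           ?f (GL_in_P k \<cdot> mat_in_P (- coset_rep M)) * z"
    have rep0: "coset_rep (zclass 0) \<in> Mat2Z" using zclass_rep'[of 0] by simp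
    have "(\<Sum>\<^sub>\<infinity>M\<in>Mat2Q_mod_Mat2Z. ?term M) = (\<Sum>\<^sub>\<infinity>M\<in>{zclass 0}. ?term M)"
    proof (rule infsum_cong_neutral)
      fix M assume M: "M \<in> Mat2Q_mod_Mat2Z - {zclass 0}"
      have "coset_rep M \<notin> Mat2Z"
      proof
        assume "coset_rep M \<in> Mat2Z"
        hence "zclass (coset_rep M) = zclass 0" by (simp add: zclass_eq_iff)
        thus False using M zclass_of_rep[of M] by simp
      qed
      thus "?term M = 0" by (simp add: f_eq)
    qed (auto simp: Mat2Q_mod_Mat2Z_eq)
    also have "\<dots> = of_rat (det k) * ?g k * z"
      using psi_int[OF Mat2Z_mult[OF rep0 r_int]] by (simp add: f_eq rep0)
    also have "\<dots> = of_rat (det s) * (?g k * z)" by (simp add: det_eq)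
    finally show ?thesis using dets by (simp add: k_def GL2Qpos_inv)
  qed
  show ?thesis
    unfolding pi_rep_def op_scale_def
  proof (intro restrict_ext ext)
    fix \<xi> C assume xi: "\<xi> \<in> ell2 Gamma_mod_S"
    show "(if C \<in> Gamma_mod_S then let t = coset_rep C in
       \<Sum>\<^sub>\<infinity>D\<in>Gamma_mod_S. let s = coset_rep D in
         \<Sum>\<^sub>\<infinity>M\<in>Mat2Q_mod_Mat2Z. let m = coset_rep M in
           of_rat (det (t ** matrix_inv s)) * cnj (char_twist chi w (m ** s)) *
           ?f (GL_in_P (t ** matrix_inv s) \<cdot> mat_in_P (- m)) * \<xi> D
     else 0) = of_rat (det s) * regular_rep GL2Qpos SL2Z Mat2Zpos ?g \<xi> C"
    proof (cases "C \<in> Gamma_mod_S")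
      case True
      have "(\<Sum>\<^sub>\<infinity>D\<in>Gamma_mod_S. \<Sum>\<^sub>\<infinity>M\<in>Mat2Q_mod_Mat2Z.
           of_rat (det (coset_rep C ** matrix_inv (coset_rep D))) *
           cnj (char_twist chi w (coset_rep M ** coset_rep D)) *
           ?f (GL_in_P (coset_rep C ** matrix_inv (coset_rep D)) \<cdot> mat_in_P (- coset_rep M)) * \<xi> D) =
        (\<Sum>\<^sub>\<infinity>D\<in>Gamma_mod_S. of_rat (det s) *
           (?g (coset_rep C \<otimes>\<^bsub>GL2Qpos\<^esub> inv\<^bsub>GL2Qpos\<^esub> (coset_rep D)) * \<xi> D))"
        by (intro infsum_cong inner Gamma_mod_S_rep(1) True)
      thus ?thesis using True xi
        by (simp only: Let_def if_True regular_rep_def restrict_apply' infsum_cmult_right')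
    qed (use xi in \<open>simp add: regular_rep_def\<close>)
  qed
qed


theorem theorem2p14:
  fixes chi :: "finite_adele \<Rightarrow> complex" and w :: "finite_adele^2^2"
  assumes "self_dual_character chi" and "w \<in> GL2Zhat"
  shows "(\<exists>\<rho>. faithful_representation
                 (right_cosets P_group P0 (carrier P_group)) (reduced_hecke_cstar P_group P0)
                 Gamma_mod_S \<rho> \<and>
               (\<forall>f\<in>hecke_algebra P_group P0.
                  \<rho> (regular_rep P_group P0 (carrier P_group) f) = pi_rep chi w f))
       \<and> (\<forall>s\<in>Mat2Zpos.
            pi_rep chi w (hecke_char P_group P0 (GL_in_P s))
            = op_scale Gamma_mod_S (of_rat (det s))
                (regular_rep GL2Qpos SL2Z Mat2Zpos (hecke_char GL2Qpos SL2Z s)))"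
proof -
  have mp: "matrix_pairing (char_twist chi w)" by (rule matrix_pairing_char_twist[OF assms])
  interpret matrix_pairing "char_twist chi w" by (rule mp)
  let ?H = "HP" and ?lam = "P_regular"
  \<comment> \<open>The identification is available for \<open>f\<close> in the Hecke algebra, so
    each witness \<open>h\<close> below is first shown to lie there.\<close>
  have eq: "pi_rep chi w f = pi_op f" if "f \<in> ?H" for f by (rule pi_rep_eq_pi_op[OF mp that])
  interpret norm_preserving_family P.RC Gamma_mod_S ?H ?lam "pi_rep chi w"
  proof
    fix f assume f: "f \<in> ?H"
    show "?lam f \<in> bounded_ops P.RC" by (rule P.regular_rep_bounded[OF f])
    show "pi_rep chi w f \<in> bounded_ops Gamma_mod_S" unfolding eq[OF f] by (rule pi_op_bounded[OF f])
    show "\<exists>h\<in>?H. is_adjoint P.RC (?lam f) (?lam h) \<and> is_adjoint Gamma_mod_S (pi_rep chi w f) (pi_rep chi w h)"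
    proof (intro bexI conjI)
      show h: "P.hecke_star f \<in> ?H" by (rule P.hecke_star_in[OF f])
      show "is_adjoint P.RC (?lam f) (?lam (P.hecke_star f))" by (rule P.regular_rep_adjoint[OF f])
      show "is_adjoint Gamma_mod_S (pi_rep chi w f) (pi_rep chi w (P.hecke_star f))"
        unfolding eq[OF f] eq[OF h] by (rule pi_op_adjoint[OF f])
    qed
    {
      fix c
      have h: "(\<lambda>x. c * f x) \<in> ?H" by (rule P.hecke_scale[OF f])
      have "pi_op (\<lambda>x. c * f x) = op_scale Gamma_mod_S c (pi_op f)"
        by (auto simp: pi_op_def op_scale_def pie_hecke_scale fun_eq_iff)
      thus "\<exists>h\<in>?H. ?lam h = op_scale P.RC c (?lam f) \<and> pi_rep chi w h = op_scale Gamma_mod_S c (pi_rep chi w f)"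
        using P.regular_rep_scale[of c f] by (intro bexI[OF _ h]) (simp only: eq[OF f] eq[OF h])
    }
    {
      fix K :: real assume K: "0 \<le> K"
      show "(\<forall>\<xi>\<in>ell2 P.RC. ell2_norm P.RC (?lam f \<xi>) \<le> K * ell2_norm P.RC \<xi>) \<longleftrightarrow>
        (\<forall>\<eta>\<in>ell2 Gamma_mod_S. norm_S (pi_rep chi w f \<eta>) \<le> K * norm_S \<eta>)"
      proof
        assume le: "\<forall>\<xi>\<in>ell2 P.RC. ell2_norm P.RC (?lam f \<xi>) \<le> K * ell2_norm P.RC \<xi>"
        show "\<forall>\<eta>\<in>ell2 Gamma_mod_S. norm_S (pi_rep chi w f \<eta>) \<le> K * norm_S \<eta>"
        proof
          fix \<eta> assume eta: "\<eta> \<in> ell2 Gamma_mod_S"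
          show "norm_S (pi_rep chi w f \<eta>) \<le> K * norm_S \<eta>"
            unfolding eq[OF f] pi_op_def restrict_apply'[OF eta] by (rule pie_norm_le[OF f eta le[rule_format]])
        qed
      next
        assume le: "\<forall>\<eta>\<in>ell2 Gamma_mod_S.
          norm_S (pi_rep chi w f \<eta>) \<le> K * norm_S \<eta>"
        have "norm_S (pie f \<eta>) \<le> K * norm_S \<eta>"
          if "\<eta> \<in> ell2 Gamma_mod_S" for \<eta>
          using le[rule_format, OF that] that by (simp add: eq[OF f] pi_op_def)
        thus "\<forall>\<xi>\<in>ell2 P.RC. ell2_norm P.RC (?lam f \<xi>) \<le> K * ell2_norm P.RC \<xi>"
          by (intro ballI regular_rep_norm_le[OF f K])
      qed
    }
    fix g assume g: "g \<in> ?H"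
    {
      have h: "(\<lambda>x. f x + g x) \<in> ?H" by (rule P.hecke_add[OF f g])
      have "pi_op (\<lambda>x. f x + g x) = op_add Gamma_mod_S (pi_op f) (pi_op g)"
        by (auto simp: pi_op_def op_add_def pie_hecke_add[OF f g] fun_eq_iff)
      thus "\<exists>h\<in>?H. ?lam h = op_add P.RC (?lam f) (?lam g) \<and>
          pi_rep chi w h = op_add Gamma_mod_S (pi_rep chi w f) (pi_rep chi w g)"
        using P.regular_rep_add[OF f g] by (intro bexI[OF _ h]) (simp only: eq[OF f] eq[OF g] eq[OF h])
    }
    {
      have h: "P.conv f g \<in> ?H" by (rule P.conv_in[OF f g])
      have "pi_op (P.conv f g) = FuncSet.compose (ell2 Gamma_mod_S) (pi_op f) (pi_op g)"
        using pie_in_ell2[OF g] by (auto simp: pi_op_def compose_def pie_conv[OF f g] fun_eq_iff)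
      thus "\<exists>h\<in>?H. ?lam h = FuncSet.compose (ell2 P.RC) (?lam f) (?lam g) \<and>
          pi_rep chi w h = FuncSet.compose (ell2 Gamma_mod_S) (pi_rep chi w f) (pi_rep chi w g)"
        using P.regular_rep_conv[OF f g] by (intro bexI[OF _ h]) (simp only: eq[OF f] eq[OF g] eq[OF h])
    }
  qed
  show ?thesis
    using faithful_extension pi_rep_hecke_char[OF mp] unfolding reduced_hecke_cstar_def by blast
qed

end
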